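(* Let $(X,\omega_0)$ be a connected compact Kähler manifold of complex dimension $n$, let $S=\{s\in\mathbb C: 0<\operatorname{Im}s<1\}$, and let $\omega$ be the pullback of $\omega_0$ to $\overline S\times X$ under the projection onto $X$. Let $u_0,u_1\in\mathcal H$ and suppose that $u\in C^3(\overline S\times X)$ is a real-valued function satisfying (i) $(\omega+i\partial\overline\partial u)^{n+1}=0$ on $\overline S\times X$; (ii) $(\omega+i\partial\overline\partial u)^{n}\neq 0$ at every point of $\overline S\times X$; (iii) $u(r+it,x)=u(it,x)$ for all $x\in X$, $t\in[0,1]$, $r\in\mathbb R$; (iv) $u(0,x)=u_0(x)$ and $u(i,x)=u_1(x)$ for all $x\in X$. Let $\dot u_0:=\frac{d}{dt}u(it,\cdot)\big|_{t=0}\in C^2(X)$. Then every critical point of $\dot u_0$ is a critical point of $u_1-u_0$. Moreover, if $u_1-u_0$ is a Morse function, then $\dot u_0$ is a Morse function as well.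
   Context: $\mathcal H:=\{v\in C^\infty(X): \omega_0+i\partial\overline\partial v>0\}$ is the set of smooth (real-valued) Kähler potentials of $\omega_0$. On $\overline S\times X$ the operators $\partial,\overline\partial$ are those of the product complex structure, where $s$ is the complex coordinate on $\overline S$. A $C^2$ function on $X$ is Morse if its Hessian is nondegenerate at each of its critical points. *)

theory Defs
  imports "HOL-Analysis.Analysis"
begin

section \<open>Functions of class \<open>C\<^sup>k\<close>\<close>

text \<open>
  Derivatives are taken within \<open>D\<close>. Below, \<open>D\<close> is open, or it is the coordinate image of a
  chart of \<open>closure S \<times> X\<close>, where they are one-sided in \<open>Im s\<close> at the boundary; in both cases
  the derivative within \<open>D\<close> is unique and this is \<open>C\<^sup>k\<close> regularity up to the boundary.
\<close>

primrec Ck_on :: "nat \<Rightarrow> 'v::real_normed_vector set \<Rightarrow> ('v \<Rightarrow> 'w::real_normed_vector) \<Rightarrow> bool" where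
  "Ck_on 0 = (\<lambda>D f. continuous_on D f)"
| "Ck_on (Suc k) = (\<lambda>D f. \<exists>f'. (\<forall>x\<in>D. (f has_derivative f' x) (at x within D)) \<and>
                                (\<forall>v. Ck_on k D (\<lambda>x. f' x v)))"

definition smooth_on :: "'v::real_normed_vector set \<Rightarrow> ('v \<Rightarrow> 'w::real_normed_vector) \<Rightarrow> bool" where
  "smooth_on D f \<longleftrightarrow> (\<forall>k. Ck_on k D f)"


section \<open>Exterior algebra and differential forms in coordinates\<close>

text \<open>
  An exterior \<open>k\<close>-form takes a sequence of vectors and depends on its entries \<open>0, \<dots>, k - 1\<close> only.
  The values are complex.
\<close>

type_synonym 'v ext_form = "(nat \<Rightarrow> 'v) \<Rightarrow> complex"

definition is_ext_form :: "nat \<Rightarrow> 'v::real_vector ext_form \<Rightarrow> bool" where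
  "is_ext_form k \<alpha> \<longleftrightarrow>
     (\<forall>v w. (\<forall>i<k. v i = w i) \<longrightarrow> \<alpha> v = \<alpha> w) \<and>
     (\<forall>v. \<forall>i<k. linear (\<lambda>x. \<alpha> (v(i := x)))) \<and>
     (\<forall>v. \<forall>i<k. \<forall>j<k. i \<noteq> j \<and> v i = v j \<longrightarrow> \<alpha> v = 0)"

definition wedge :: "nat \<Rightarrow> nat \<Rightarrow> 'v ext_form \<Rightarrow> 'v ext_form \<Rightarrow> 'v ext_form" where
  "wedge p q \<alpha> \<beta> = (\<lambda>v. (\<Sum>\<sigma> | \<sigma> permutes {..<p + q}.
      of_int (sign \<sigma>) * \<alpha> (\<lambda>i. v (\<sigma> i)) * \<beta> (\<lambda>i. v (\<sigma> (p + i)))) / (fact p * fact q))"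

text \<open>The \<open>k\<close>-th exterior power of a 2-form.\<close>

primrec wedge_power :: "'v ext_form \<Rightarrow> nat \<Rightarrow> 'v ext_form" where
  "wedge_power \<alpha> 0 = (\<lambda>v. 1)"
| "wedge_power \<alpha> (Suc k) = wedge 2 (2 * k) \<alpha> (wedge_power \<alpha> k)"

definition pullback :: "('v::real_normed_vector \<Rightarrow> 'w::real_normed_vector) \<Rightarrow>
    ('w \<Rightarrow> 'w ext_form) \<Rightarrow> 'v \<Rightarrow> 'v ext_form" where
  "pullback F \<alpha> z = (\<lambda>v. \<alpha> (F z) (\<lambda>i. frechet_derivative F (at z) (v i)))"

definition ext_deriv :: "nat \<Rightarrow> ('v::real_normed_vector \<Rightarrow> 'v ext_form) \<Rightarrow> 'v \<Rightarrow> 'v ext_form" where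
  "ext_deriv k \<alpha> z = (\<lambda>v. \<Sum>i\<le>k. (-1) ^ i *
      frechet_derivative (\<lambda>y. \<alpha> y (\<lambda>j. if j < i then v j else v (Suc j))) (at z) (v i))"


section \<open>Complex coordinates\<close>

abbreviation J :: "complex ^ 'm::finite \<Rightarrow> complex ^ 'm" where
  "J v \<equiv> \<i> *s v"

definition dz :: "'m::finite \<Rightarrow> (complex ^ 'm) ext_form" where
  "dz j = (\<lambda>v. v 0 $ j)"

definition dzbar :: "'m::finite \<Rightarrow> (complex ^ 'm) ext_form" where
  "dzbar j = (\<lambda>v. cnj (v 0 $ j))"

text \<open>The Wirtinger derivatives \<open>\<partial>/\<partial>z\<^sub>j\<close> and its conjugate, on a set \<open>D\<close> as above.\<close>

definition wirt :: "(complex ^ 'm::finite) set \<Rightarrow> 'm \<Rightarrow> (complex ^ 'm \<Rightarrow> complex) \<Rightarrow> complex ^ 'm \<Rightarrow> complex" where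
  "wirt D j f z =
     (frechet_derivative f (at z within D) (axis j 1)
       - \<i> * frechet_derivative f (at z within D) (axis j \<i>)) / 2"

definition wirtbar :: "(complex ^ 'm::finite) set \<Rightarrow> 'm \<Rightarrow> (complex ^ 'm \<Rightarrow> complex) \<Rightarrow> complex ^ 'm \<Rightarrow> complex" where
  "wirtbar D j f z =
     (frechet_derivative f (at z within D) (axis j 1)
       + \<i> * frechet_derivative f (at z within D) (axis j \<i>)) / 2"

definition ddbar :: "(complex ^ 'm::finite) set \<Rightarrow> (complex ^ 'm \<Rightarrow> complex) \<Rightarrow>
    complex ^ 'm \<Rightarrow> (complex ^ 'm) ext_form" where
  "ddbar D f z = (\<lambda>v. \<Sum>j\<in>UNIV. \<Sum>k\<in>UNIV.
      wirt D j (wirtbar D k f) z * wedge 1 1 (dz j) (dzbar k) v)"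

definition real_form :: "'v ext_form \<Rightarrow> bool" where
  "real_form \<alpha> \<longleftrightarrow> (\<forall>v. \<alpha> v \<in> \<real>)"

definition pair_args :: "'v \<Rightarrow> 'v \<Rightarrow> nat \<Rightarrow> 'v" where
  "pair_args x y = (\<lambda>i. if i = 0 then x else y)"

text \<open>A 2-form has type (1,1) iff it is \<open>J\<close>-invariant.\<close>

definition type_1_1 :: "(complex ^ 'm::finite) ext_form \<Rightarrow> bool" where
  "type_1_1 \<alpha> \<longleftrightarrow> (\<forall>x y. \<alpha> (pair_args (J x) (J y)) = \<alpha> (pair_args x y))"

text \<open>With this sign convention \<open>\<i> dz \<and> dzbar\<close> is positive. It is meant for real (1,1)-forms.\<close>

definition positive_form :: "(complex ^ 'm::finite) ext_form \<Rightarrow> bool" where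
  "positive_form \<alpha> \<longleftrightarrow> (\<forall>x. x \<noteq> 0 \<longrightarrow> Re (\<alpha> (pair_args x (J x))) > 0)"


section \<open>Complex manifolds\<close>

text \<open>A chart consists of its domain and its coordinate map.\<close>

type_synonym ('p, 'm) chart = "'p set \<times> ('p \<Rightarrow> complex ^ 'm)"

abbreviation chart_image :: "('p, 'm::finite) chart \<Rightarrow> (complex ^ 'm) set" where
  "chart_image c \<equiv> snd c ` fst c"

abbreviation chart_inv :: "('p, 'm::finite) chart \<Rightarrow> complex ^ 'm \<Rightarrow> 'p" where
  "chart_inv c \<equiv> inv_into (fst c) (snd c)"

definition local_rep :: "('p, 'm::finite) chart \<Rightarrow> ('p \<Rightarrow> 'b) \<Rightarrow> complex ^ 'm \<Rightarrow> 'b" where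
  "local_rep c f = (\<lambda>z. f (chart_inv c z))"

definition transition :: "('p, 'm::finite) chart \<Rightarrow> ('p, 'm) chart \<Rightarrow> complex ^ 'm \<Rightarrow> complex ^ 'm" where
  "transition c d = local_rep c (snd d)"

definition overlap :: "('p, 'm::finite) chart \<Rightarrow> ('p, 'm::finite) chart \<Rightarrow> (complex ^ 'm) set" where
  "overlap c d = snd c ` (fst c \<inter> fst d)"

text \<open>
  The manifold is the whole type \<open>'p\<close>. Transition maps are holomorphic: smooth with complex
  linear derivative. Second countability is not required, as it follows from compactness.
\<close>

definition complex_atlas :: "('p::t2_space, 'm::finite) chart set \<Rightarrow> bool" where
  "complex_atlas A \<longleftrightarrow>
     (\<Union>c\<in>A. fst c) = UNIV \<and>
     (\<forall>c\<in>A. open (fst c) \<and> open (chart_image c) \<and>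
        homeomorphism (fst c) (chart_image c) (snd c) (chart_inv c)) \<and>
     (\<forall>c\<in>A. \<forall>d\<in>A. smooth_on (overlap c d) (transition c d) \<and>
        (\<forall>z\<in>overlap c d. \<forall>v. frechet_derivative (transition c d) (at z) (J v)
                            = J (frechet_derivative (transition c d) (at z) v)))"

text \<open>
  A 2-form on the manifold is the compatible family of its coordinate expressions; \<open>\<omega> c z\<close> is
  relevant for \<open>c \<in> A\<close> and \<open>z\<close> in the image of \<open>c\<close> only.
\<close>

type_synonym ('p, 'm) mform = "('p, 'm) chart \<Rightarrow> complex ^ 'm \<Rightarrow> (complex ^ 'm) ext_form"

definition smooth_2_form :: "('p, 'm::finite) chart set \<Rightarrow> ('p, 'm) mform \<Rightarrow> bool" where
  "smooth_2_form A \<omega> \<longleftrightarrow>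
     (\<forall>c\<in>A. (\<forall>z\<in>chart_image c. is_ext_form 2 (\<omega> c z)) \<and>
            (\<forall>v. smooth_on (chart_image c) (\<lambda>z. \<omega> c z v))) \<and>
     (\<forall>c\<in>A. \<forall>d\<in>A. \<forall>z\<in>overlap c d. \<omega> c z = pullback (transition c d) (\<omega> d) z)"

definition kahler_form :: "('p, 'm::finite) chart set \<Rightarrow> ('p, 'm) mform \<Rightarrow> bool" where
  "kahler_form A \<omega> \<longleftrightarrow> smooth_2_form A \<omega> \<and>
     (\<forall>c\<in>A. \<forall>z\<in>chart_image c. real_form (\<omega> c z) \<and> type_1_1 (\<omega> c z) \<and>
        positive_form (\<omega> c z) \<and> ext_deriv 2 (\<omega> c) z = (\<lambda>v. 0))"

definition Ck_manifold :: "('p, 'm::finite) chart set \<Rightarrow> nat \<Rightarrow> ('p \<Rightarrow> real) \<Rightarrow> bool" where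
  "Ck_manifold A k f \<longleftrightarrow> (\<forall>c\<in>A. Ck_on k (chart_image c) (local_rep c f))"

definition i_ddbar :: "('p, 'm::finite) chart \<Rightarrow> ('p \<Rightarrow> real) \<Rightarrow> complex ^ 'm \<Rightarrow> (complex ^ 'm) ext_form" where
  "i_ddbar c f z =
     (\<lambda>v. \<i> * ddbar (chart_image c) (\<lambda>y. complex_of_real (local_rep c f y)) z v)"

definition kahler_potentials :: "('p, 'm::finite) chart set \<Rightarrow> ('p, 'm) mform \<Rightarrow> ('p \<Rightarrow> real) set" where
  "kahler_potentials A \<omega> = {f. (\<forall>k. Ck_manifold A k f) \<and>
     (\<forall>c\<in>A. \<forall>z\<in>chart_image c. positive_form (\<lambda>v. \<omega> c z v + i_ddbar c f z v))}"

definition critical_point :: "('p, 'm::finite) chart set \<Rightarrow> ('p \<Rightarrow> real) \<Rightarrow> 'p \<Rightarrow> bool" where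
  "critical_point A f p \<longleftrightarrow>
     (\<forall>c\<in>A. p \<in> fst c \<longrightarrow> (local_rep c f has_derivative (\<lambda>v. 0)) (at (snd c p)))"

definition hessian :: "('v::real_normed_vector \<Rightarrow> real) \<Rightarrow> 'v \<Rightarrow> 'v \<Rightarrow> 'v \<Rightarrow> real" where
  "hessian f z v w = frechet_derivative (\<lambda>y. frechet_derivative f (at y) v) (at z) w"

definition morse :: "('p, 'm::finite) chart set \<Rightarrow> ('p \<Rightarrow> real) \<Rightarrow> bool" where
  "morse A f \<longleftrightarrow> Ck_manifold A 2 f \<and>
     (\<forall>p. critical_point A f p \<longrightarrow>
        (\<forall>c\<in>A. p \<in> fst c \<longrightarrow>
           (\<forall>v. v \<noteq> 0 \<longrightarrow> (\<exists>w. hessian (local_rep c f) (snd c p) v w \<noteq> 0))))"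


section \<open>The product of the closed strip with \<open>X\<close>\<close>

definition strip :: "complex set" where
  "strip = {s. 0 < Im s \<and> Im s < 1}"

text \<open>
  \<open>\<complex> \<times> \<complex>\<^sup>n\<close> is rendered as \<open>complex ^ 'n option\<close>: the coordinate \<open>None\<close> is \<open>s\<close>, and \<open>Some j\<close>
  is the \<open>j\<close>-th coordinate on \<open>X\<close>.
\<close>

definition strip_chart :: "('p, 'n::finite) chart \<Rightarrow> (complex \<times> 'p, 'n option) chart" where
  "strip_chart c = (closure strip \<times> fst c,
     \<lambda>(s, x). \<chi> i. case i of None \<Rightarrow> s | Some j \<Rightarrow> snd c x $ j)"

definition strip_atlas :: "('p, 'n::finite) chart set \<Rightarrow> (complex \<times> 'p, 'n option) chart set" where
  "strip_atlas A = strip_chart ` A"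

text \<open>The projection onto \<open>X\<close> in the coordinates \<open>strip_chart c\<close> and \<open>c\<close>.\<close>

definition proj_X :: "complex ^ ('n::finite) option \<Rightarrow> complex ^ 'n" where
  "proj_X w = (\<chi> j. w $ Some j)"

text \<open>The form \<open>\<omega> + \<i> \<partial>\<partial>bar u\<close> in the coordinates \<open>strip_chart c\<close>, for \<open>\<omega>\<close> the pullback of \<open>\<omega>\<^sub>0\<close>.\<close>

definition omega_u :: "('p, 'n::finite) mform \<Rightarrow> (complex \<times> 'p \<Rightarrow> real) \<Rightarrow> ('p, 'n) chart \<Rightarrow>
    complex ^ 'n option \<Rightarrow> (complex ^ 'n option) ext_form" where
  "omega_u \<omega>0 u c w = (\<lambda>v. pullback proj_X (\<omega>0 c) w v + i_ddbar (strip_chart c) u w v)"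

definition initial_velocity :: "(complex \<times> 'p \<Rightarrow> real) \<Rightarrow> 'p \<Rightarrow> real" where
  "initial_velocity u x =
     vector_derivative (\<lambda>t. u (\<i> * complex_of_real t, x)) (at 0 within {0..1})"

end

theory Submission
  imports Defs
begin

text \<open>
  Write \<open>\<Omega> = \<omega> + \<i> \<partial>\<partial>bar u\<close>, let \<open>t = Im s\<close>, and let \<open>v = du/dt\<close> be the velocity. By the invariance under real
  translations everything depends on \<open>t\<close> and \<open>x \<in> X\<close> only. The theorem follows from one inequality: near a
  critical point \<open>p\<close> of the initial velocity,
  \<open>|d(u\<^sub>1 - u\<^sub>0)(x)| \<le> C |dv(0, x)|\<close>. At \<open>x = p\<close> it says that \<open>p\<close> is critical for \<open>u\<^sub>1 - u\<^sub>0\<close>. If the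
  Hessian of \<open>v(0, \<cdot>)\<close> at \<open>p\<close> annihilates a vector \<open>w\<close>, then \<open>dv(0, \<cdot>)\<close> is \<open>o(h)\<close> at distance \<open>h\<close> from \<open>p\<close>
  along \<open>w\<close>; hence so is \<open>d(u\<^sub>1 - u\<^sub>0)\<close>, and its Hessian annihilates \<open>w\<close> too. Thus a degenerate critical
  point of the initial velocity is a degenerate critical point of \<open>u\<^sub>1 - u\<^sub>0\<close>.

  The inequality is obtained by integrating \<open>|dv(t, x)| \<le> C |dv(0, x)|\<close> over \<open>t\<close>, and this in turn is
  Gronwall's lemma for the differential along the fibres: \<open>d/dt (dv) = d(u\<^sub>t\<^sub>t)\<close>, so that the point is to show
  \<open>|d(u\<^sub>t\<^sub>t)| \<le> C |dv|\<close>. Let \<open>e\<close> be the direction of \<open>Re s\<close>. Wherever \<open>\<Omega>\<close> is positive on the fibres, the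
  equation \<open>\<Omega>\<^sup>n\<^sup>+\<^sup>1 = 0\<close> provides a kernel vector \<open>e + \<xi>\<close> with \<open>\<xi>\<close> tangent to the fibre
  (\<open>kernel_vector\<close>), and \<open>|\<xi>| \<le> C |dv|\<close> because \<open>\<Omega>\<close> pairs \<open>e\<close> with fibre vectors through \<open>dv\<close>. Moreover
  \<open>\<Omega>(y, J y) \<ge> 0\<close> for all \<open>y\<close> (\<open>form_nonneg\<close>). Therefore, for the fixed vector \<open>e + \<xi>\<close>, the function
  \<open>\<Omega>(e + \<xi>, J (e + \<xi>))\<close> has a minimum at the given point of the fibre, and its derivatives vanish there.
  Expanded, this expresses \<open>d(u\<^sub>t\<^sub>t)\<close> through terms that carry a factor \<open>\<xi>\<close>
  (\<open>Ft_second_derivative\<close>). Only three derivatives of \<open>u\<close> occur, and neither the kernel field nor the leaves of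
  its foliation have to be differentiated.

  It remains to see that the fibres are positive along \<open>{p}\<close> for all \<open>t \<in> [0, 1]\<close>
  (\<open>positive_along_critical\<close>). They are for \<open>t = 0\<close>, since \<open>u\<^sub>0\<close> is a Kaehler potential. If \<open>T\<close> is the first time
  at which positivity fails, then the estimate on the intervals before \<open>T\<close> yields \<open>dv(t, p) = 0\<close>, hence \<open>\<xi> = 0\<close>
  and \<open>u\<^sub>t\<^sub>t(t, p) = 0\<close>, for \<open>t < T\<close>, and by continuity \<open>dv = 0\<close> and \<open>u\<^sub>t\<^sub>t = 0\<close> also at \<open>T\<close>. So \<open>e\<close> lies
  in the kernel of \<open>\<Omega>\<close> at \<open>(T, p)\<close>. A null vector of the semipositive form on the fibre would be a second
  complex direction in the kernel, which \<open>\<Omega>\<^sup>n \<noteq> 0\<close> excludes (\<open>kernel_transversal\<close>).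
\<close>

section \<open>Powers of a two-form as Pfaffians\<close>

text \<open>
  For \<open>B\<close> alternating, \<open>pfaff B k v\<close> below is \<open>2\<^sup>k k!\<close> times the Pfaffian of the matrix of \<open>B\<close> on the first
  \<open>2 k\<close> entries of \<open>v\<close>. Summing over all permutations, and not over matchings, makes it multilinear and
  alternating in \<open>v\<close> by inspection.
\<close>

definition pf_term :: "('v \<Rightarrow> 'v \<Rightarrow> real) \<Rightarrow> nat \<Rightarrow> (nat \<Rightarrow> 'v) \<Rightarrow> (nat \<Rightarrow> nat) \<Rightarrow> real" where
  "pf_term B k v \<sigma> = of_int (sign \<sigma>) * (\<Prod>i<k. B (v (\<sigma> (2 * i))) (v (\<sigma> (2 * i + 1))))"

definition pfaff :: "('v \<Rightarrow> 'v \<Rightarrow> real) \<Rightarrow> nat \<Rightarrow> (nat \<Rightarrow> 'v) \<Rightarrow> real" where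
  "pfaff B k v = (\<Sum>\<sigma> | \<sigma> permutes {..<2 * k}. pf_term B k v \<sigma>)"

text \<open>
  A permutation acting after the first two places. It turns the nested sums over permutations in the
  recursive definition of \<open>wedge_power\<close> into one sum.
\<close>

definition shift2 :: "nat \<Rightarrow> (nat \<Rightarrow> nat) \<Rightarrow> nat \<Rightarrow> nat" where
  "shift2 m \<tau> = map_permutation {..<m} (\<lambda>i. i + 2) \<tau>"

lemma shift2_permutes:
  assumes "\<tau> permutes {..<m}"
  shows "shift2 m \<tau> permutes {2..<m + 2}"
  unfolding shift2_def
proof (rule map_permutation_permutes[OF _ assms])
  show "bij_betw (\<lambda>i. i + 2) {..<m} {2..<m + 2}"
    by (rule bij_betw_byWitness[where f' = "\<lambda>i. i - 2"]) auto
qed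

lemma shift2_permutes': "\<tau> permutes {..<m} \<Longrightarrow> shift2 m \<tau> permutes {..<m + 2}"
  by (rule permutes_subset[OF shift2_permutes]) auto

lemma sign_shift2: "\<tau> permutes {..<m} \<Longrightarrow> sign (shift2 m \<tau>) = sign \<tau>"
  unfolding shift2_def by (rule sign_map_permutation) (auto simp: inj_on_def)

lemma shift2_apply: "i < m \<Longrightarrow> shift2 m \<tau> (i + 2) = \<tau> i + 2"
  unfolding shift2_def by (rule map_permutation_apply) (auto simp: inj_on_def)

lemma shift2_low: "\<tau> permutes {..<m} \<Longrightarrow> i < 2 \<Longrightarrow> shift2 m \<tau> i = i"
  using shift2_permutes[of \<tau> m] by (auto simp: permutes_def)

text \<open>
  Unfolding one wedge product, each pair of an outer permutation \<open>\<sigma>\<close> and an inner one \<open>\<tau>\<close> contributes the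
  Pfaffian term of \<open>\<sigma> \<circ> shift2 \<tau>\<close>. For fixed \<open>\<tau>\<close> these compositions run through all permutations, so
  the whole sum is counted \<open>(2 k)!\<close> times, which cancels the normalisation of the wedge product.
\<close>

lemma wedge_power_eq_pfaff:
  assumes \<alpha>: "\<And>v. \<alpha> v = complex_of_real (B (v 0) (v 1))"
  shows "wedge_power \<alpha> k v = complex_of_real (pfaff B k v) / 2 ^ k"
proof (induction k arbitrary: v)
  case 0
  then show ?case by (simp add: pfaff_def pf_term_def)
next
  case (Suc k)
  let ?S = "{\<sigma>. \<sigma> permutes {..<2 + 2 * k}}"
  let ?T = "{\<tau>. \<tau> permutes {..<2 * k}}"
  have term_split: "of_int (sign \<sigma>) * B (v (\<sigma> 0)) (v (\<sigma> 1)) * pf_term B k (\<lambda>i. v (\<sigma> (2 + i))) \<tau>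
      = pf_term B (Suc k) v (\<sigma> \<circ> shift2 (2 * k) \<tau>)"
    if \<sigma>: "\<sigma> \<in> ?S" and \<tau>: "\<tau> \<in> ?T" for \<sigma> \<tau>
  proof -
    have p: "permutation \<sigma>" "permutation (shift2 (2 * k) \<tau>)"
      using \<sigma> shift2_permutes'[of \<tau> "2 * k"] \<tau> permutation_permutes by blast+
    have s: "sign (\<sigma> \<circ> shift2 (2 * k) \<tau>) = sign \<sigma> * sign \<tau>"
      using sign_compose[OF p] \<tau> by (simp add: sign_shift2)
    have low: "shift2 (2 * k) \<tau> 0 = 0" "shift2 (2 * k) \<tau> (Suc 0) = Suc 0"
      using \<tau> by (auto intro!: shift2_low)
    have hi: "shift2 (2 * k) \<tau> (Suc (Suc (2 * i))) = Suc (Suc (\<tau> (2 * i)))"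
      "shift2 (2 * k) \<tau> (Suc (Suc (Suc (2 * i)))) = Suc (Suc (\<tau> (Suc (2 * i))))" if "i < k" for i
      using shift2_apply[of "2 * i" "2 * k" \<tau>] shift2_apply[of "2 * i + 1" "2 * k" \<tau>] that
      by simp_all
    have "(\<Prod>i<Suc k. B (v ((\<sigma> \<circ> shift2 (2 * k) \<tau>) (2 * i))) (v ((\<sigma> \<circ> shift2 (2 * k) \<tau>) (2 * i + 1))))
       = B (v (\<sigma> 0)) (v (\<sigma> 1)) * (\<Prod>i<k. B (v (\<sigma> (2 + \<tau> (2 * i)))) (v (\<sigma> (2 + \<tau> (2 * i + 1)))))"
      unfolding prod.lessThan_Suc_shift
      by (intro arg_cong2[of _ _ _ _ "(*)"] prod.cong) (auto simp: low hi)
    then show ?thesis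
      unfolding pf_term_def s by simp
  qed
  have "(\<Sum>\<sigma>\<in>?S. of_int (sign \<sigma>) * B (v (\<sigma> 0)) (v (\<sigma> 1)) * pfaff B k (\<lambda>i. v (\<sigma> (2 + i))))
      = (\<Sum>\<sigma>\<in>?S. \<Sum>\<tau>\<in>?T. pf_term B (Suc k) v (\<sigma> \<circ> shift2 (2 * k) \<tau>))"
    unfolding pfaff_def sum_distrib_left by (intro sum.cong refl term_split)
  also have "\<dots> = (\<Sum>\<tau>\<in>?T. \<Sum>\<sigma>\<in>?S. pf_term B (Suc k) v (\<sigma> \<circ> shift2 (2 * k) \<tau>))"
    by (rule sum.swap)
  also have "\<dots> = (\<Sum>\<tau>\<in>?T. pfaff B (Suc k) v)"
  proof (rule sum.cong[OF refl])
    fix \<tau> assume "\<tau> \<in> ?T"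
    then have "shift2 (2 * k) \<tau> permutes {..<2 + 2 * k}"
      using shift2_permutes'[of \<tau> "2 * k"] by (simp add: add.commute)
    from sum_permutations_compose_right[OF this, of "pf_term B (Suc k) v"]
    show "(\<Sum>\<sigma>\<in>?S. pf_term B (Suc k) v (\<sigma> \<circ> shift2 (2 * k) \<tau>)) = pfaff B (Suc k) v"
      unfolding pfaff_def by simp
  qed
  also have "\<dots> = fact (2 * k) * pfaff B (Suc k) v"
    by (simp add: card_permutations)
  finally have main: "(\<Sum>\<sigma>\<in>?S. of_int (sign \<sigma>) * B (v (\<sigma> 0)) (v (\<sigma> 1)) * pfaff B k (\<lambda>i. v (\<sigma> (2 + i))))
      = fact (2 * k) * pfaff B (Suc k) v" .
  have "wedge_power \<alpha> (Suc k) v = (\<Sum>\<sigma>\<in>?S. complex_of_real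
      (of_int (sign \<sigma>) * B (v (\<sigma> 0)) (v (\<sigma> 1)) * pfaff B k (\<lambda>i. v (\<sigma> (2 + i)))) / 2 ^ k) / (2 * fact (2 * k))"
    unfolding wedge_power.simps wedge_def Suc.IH by (simp add: \<alpha> fact_2)
  also have "\<dots> = complex_of_real (\<Sum>\<sigma>\<in>?S.
      of_int (sign \<sigma>) * B (v (\<sigma> 0)) (v (\<sigma> 1)) * pfaff B k (\<lambda>i. v (\<sigma> (2 + i)))) / 2 ^ k / (2 * fact (2 * k))"
    unfolding sum_divide_distrib[symmetric] by simp
  also have "\<dots> = complex_of_real (pfaff B (Suc k) v) / 2 ^ Suc k"
    unfolding main by (simp add: field_simps)
  finally show ?case .
qed

text \<open>
  Exchanging the first pair of places with another pair is an even permutation that only reorders the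
  factors. Together with the next lemma, it moves any given place to the front.
\<close>

lemma pf_term_swap_blocks:
  assumes "a < k" and "\<sigma> permutes {..<2 * k}"
  shows "pf_term B k v (\<sigma> \<circ> (Transposition.transpose 0 (2 * a) \<circ> Transposition.transpose 1 (2 * a + 1))) = pf_term B k v \<sigma>"
proof -
  let ?\<rho> = "Transposition.transpose 0 (2 * a) \<circ> Transposition.transpose 1 (2 * a + 1)"
  have p: "permutation \<sigma>"
    using assms(2) permutation_permutes by blast
  have s: "sign (\<sigma> \<circ> ?\<rho>) = sign \<sigma>"
    by (simp add: sign_compose p permutation_compose permutation_swap_id sign_swap_id)
  have r: "?\<rho> (2 * i) = 2 * Transposition.transpose 0 a i" "?\<rho> (2 * i + 1) = 2 * Transposition.transpose 0 a i + 1" for i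
    by (auto simp: Transposition.transpose_def) presburger+
  let ?f = "\<lambda>i. B (v (\<sigma> (2 * i))) (v (\<sigma> (2 * i + 1)))"
  have "(\<Prod>i<k. B (v ((\<sigma> \<circ> ?\<rho>) (2 * i))) (v ((\<sigma> \<circ> ?\<rho>) (2 * i + 1)))) = (\<Prod>i<k. ?f (Transposition.transpose 0 a i))"
    by (intro prod.cong refl) (metis comp_apply r)
  also have "\<dots> = prod (?f \<circ> Transposition.transpose 0 a) {..<k}"
    by (simp add: o_def)
  also have "\<dots> = prod ?f {..<k}"
    by (rule prod.permute[symmetric]) (use assms(1) in \<open>auto intro!: permutes_swap_id\<close>)
  finally show ?thesis
    unfolding pf_term_def s by simp
qed

lemma pf_term_flip:
  assumes anti: "\<And>x y. B x y = - B y x" and "0 < k" and "\<sigma> permutes {..<2 * k}"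
  shows "pf_term B k v (\<sigma> \<circ> Transposition.transpose 0 1) = pf_term B k v \<sigma>"
proof -
  have p: "permutation \<sigma>"
    using assms(3) permutation_permutes by blast
  have s: "sign (\<sigma> \<circ> Transposition.transpose 0 1) = - sign \<sigma>"
    by (simp add: sign_compose p permutation_swap_id sign_swap_id)
  let ?f = "\<lambda>\<sigma> i. B (v (\<sigma> (2 * i))) (v (\<sigma> (2 * i + 1)))"
  have k: "{..<k} = insert 0 {1..<k}" using \<open>0 < k\<close> by auto
  have 0: "?f (\<sigma> \<circ> Transposition.transpose 0 1) 0 = - ?f \<sigma> 0"
    using anti[of "v (\<sigma> 1)" "v (\<sigma> 0)"] by simp
  have r: "(\<Prod>i\<in>{1..<k}. ?f (\<sigma> \<circ> Transposition.transpose 0 1) i) = (\<Prod>i\<in>{1..<k}. ?f \<sigma> i)"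
    by (intro prod.cong refl) (auto simp: Transposition.transpose_def)
  have "(\<Prod>i<k. ?f (\<sigma> \<circ> Transposition.transpose 0 1) i) = - (\<Prod>i<k. ?f \<sigma> i)"
    unfolding k by (subst (1 2) prod.insert) (use 0 r in simp_all)
  then show ?thesis
    unfolding pf_term_def s by simp
qed

text \<open>
  Expansion along \<open>v 0\<close>. By the symmetries above, each of the \<open>2 k + 2\<close> places at which \<open>0\<close> can occur gives the
  same contribution as the first place, and there only the permutations that fix both \<open>0\<close> and \<open>1\<close> survive.
\<close>

lemma pfaff_contract:
  assumes anti: "\<And>x y. B x y = - B y x"
    and pair: "\<And>j. j < 2 * k + 2 \<Longrightarrow> j \<noteq> 1 \<Longrightarrow> B (v 0) (v j) = 0"
  shows "pfaff B (Suc k) v = 2 * real (k + 1) * B (v 0) (v 1) * pfaff B k (\<lambda>i. v (i + 2))"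
proof -
  let ?m = "2 * Suc k"
  let ?S = "{\<sigma>. \<sigma> permutes {..<?m}}"
  let ?g = "pf_term B (Suc k) v"
  let ?Z = "\<Sum>\<sigma>\<in>?S. if \<sigma> 0 = 0 then ?g \<sigma> else 0"
  have fin: "finite ?S" by (rule finite_permutations) simp
  have "(\<Sum>\<sigma>\<in>?S. if \<sigma> q = 0 then ?g \<sigma> else 0) = ?Z" if q: "q < ?m" for q
  proof -
    define a where "a = q div 2"
    have a: "a < Suc k" using q a_def by auto
    let ?\<rho> = "Transposition.transpose 0 (2 * a) \<circ> Transposition.transpose 1 (2 * a + 1)"
    have \<rho>: "?\<rho> permutes {..<?m}"
      using a by (auto intro!: permutes_compose permutes_swap_id)
    have fl: "Transposition.transpose 0 1 permutes {..<?m}"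
      by (auto intro!: permutes_swap_id)
    \<comment> \<open>a symmetry of the Pfaffian terms that moves the place \<open>q\<close> to the front\<close>
    have "\<exists>\<rho>. \<rho> permutes {..<?m} \<and> \<rho> q = 0 \<and> (\<forall>\<sigma>\<in>?S. ?g (\<sigma> \<circ> \<rho>) = ?g \<sigma>)"
    proof (cases "even q")
      case True
      then have "?\<rho> q = 0" by (auto simp: a_def Transposition.transpose_def)
      then show ?thesis
        using \<rho> pf_term_swap_blocks[OF a] by blast
    next
      case False
      then have q': "q = 2 * a + 1" by (simp add: a_def)
      have "?\<rho> q = 1" unfolding q' by (auto simp: Transposition.transpose_def)
      moreover have "?g (\<sigma> \<circ> (Transposition.transpose 0 1 \<circ> ?\<rho>)) = ?g \<sigma>" if "\<sigma> \<in> ?S" for \<sigma>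
      proof -
        have "\<sigma> \<circ> Transposition.transpose 0 1 permutes {..<?m}"
          using that fl by (auto intro: permutes_compose)
        from pf_term_swap_blocks[OF a this, of B v]
        have "?g (\<sigma> \<circ> (Transposition.transpose 0 1 \<circ> ?\<rho>)) = ?g (\<sigma> \<circ> Transposition.transpose 0 1)"
          by (simp add: o_assoc)
        also have "\<dots> = ?g \<sigma>"
          by (rule pf_term_flip[OF anti]) (use that in auto)
        finally show ?thesis .
      qed
      ultimately show ?thesis
        using permutes_compose[OF \<rho> fl] by (intro exI[of _ "Transposition.transpose 0 1 \<circ> ?\<rho>"]) auto
    qed
    then obtain \<rho> where r: "\<rho> permutes {..<?m}" "\<rho> q = 0" "\<And>\<sigma>. \<sigma> \<in> ?S \<Longrightarrow> ?g (\<sigma> \<circ> \<rho>) = ?g \<sigma>"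
      by blast
    have "(\<Sum>\<sigma>\<in>?S. if \<sigma> q = 0 then ?g \<sigma> else 0)
        = (\<Sum>\<sigma>\<in>?S. if (\<sigma> \<circ> \<rho>) q = 0 then ?g (\<sigma> \<circ> \<rho>) else 0)"
      by (rule sum_permutations_compose_right[OF r(1)])
    also have "\<dots> = ?Z"
      by (intro sum.cong refl) (simp add: r)
    finally show ?thesis .
  qed
  note Z = this
  have "pfaff B (Suc k) v = (\<Sum>\<sigma>\<in>?S. \<Sum>q<?m. if \<sigma> q = 0 then ?g \<sigma> else 0)"
    unfolding pfaff_def
  proof (intro sum.cong refl)
    fix \<sigma> assume "\<sigma> \<in> ?S"
    then have \<sigma>: "\<sigma> permutes {..<?m}" by simp
    have "\<sigma> q = 0 \<longleftrightarrow> q = inv \<sigma> 0" for q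
      using permutes_inv_eq[OF \<sigma>, of 0 q] by auto
    moreover have "inv \<sigma> 0 < ?m"
      using permutes_in_image[OF permutes_inv[OF \<sigma>], of 0] by auto
    ultimately show "?g \<sigma> = (\<Sum>q<?m. if \<sigma> q = 0 then ?g \<sigma> else 0)"
      by simp
  qed
  also have "\<dots> = (\<Sum>q<?m. \<Sum>\<sigma>\<in>?S. if \<sigma> q = 0 then ?g \<sigma> else 0)"
    by (rule sum.swap)
  also have "\<dots> = (\<Sum>q<?m. ?Z)"
    by (intro sum.cong refl Z) simp
  also have "\<dots> = 2 * real (k + 1) * ?Z" by simp
  also have "?Z = (\<Sum>\<sigma> | \<sigma> permutes {2..<2 * k + 2}. ?g \<sigma>)"
  proof -
    have sub: "{\<sigma>. \<sigma> permutes {2..<2 * k + 2}} \<subseteq> ?S"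
      by (auto intro: permutes_subset)
    have "?Z = (\<Sum>\<sigma> | \<sigma> permutes {2..<2 * k + 2}. if \<sigma> 0 = 0 then ?g \<sigma> else 0)"
    proof (rule sum.mono_neutral_right[OF fin sub], intro ballI)
      fix \<sigma> assume "\<sigma> \<in> ?S - {\<sigma>. \<sigma> permutes {2..<2 * k + 2}}"
      then have \<sigma>: "\<sigma> permutes {..<?m}" and n: "\<not> \<sigma> permutes {2..<2 * k + 2}" by auto
      have "?g \<sigma> = 0" if 0: "\<sigma> 0 = 0"
      proof -
        have "\<sigma> 1 \<noteq> 1"
        proof
          assume 1: "\<sigma> 1 = 1"
          have "\<sigma> permutes {2..<2 * k + 2}"
            by (rule permutes_superset[OF \<sigma>])
              (use 0 1 in \<open>auto simp: not_le less_2_cases_iff\<close>)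
          then show False using n by simp
        qed
        moreover have "\<sigma> 1 < 2 * k + 2"
          using permutes_in_image[OF \<sigma>, of 1] by auto
        ultimately have "B (v (\<sigma> 0)) (v (\<sigma> 1)) = 0"
          using pair 0 by simp
        then show ?thesis
          unfolding pf_term_def by (subst prod_zero[of "{..<Suc k}"]) (auto intro!: bexI[of _ 0])
      qed
      then show "(if \<sigma> 0 = 0 then ?g \<sigma> else 0) = 0" by simp
    qed
    also have "\<dots> = (\<Sum>\<sigma> | \<sigma> permutes {2..<2 * k + 2}. ?g \<sigma>)"
      by (intro sum.cong refl) (auto simp: permutes_def)
    finally show ?thesis .
  qed
  also have "\<dots> = (\<Sum>\<tau> | \<tau> permutes {..<2 * k}. ?g (shift2 (2 * k) \<tau>))"
  proof (rule sum.reindex_bij_witness[symmetric, of _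
        "map_permutation {2..<2 * k + 2} (\<lambda>i. i - 2)" "shift2 (2 * k)"])
    fix \<tau> assume "\<tau> \<in> {\<tau>. \<tau> permutes {..<2 * k}}"
    then have t: "\<tau> permutes {..<2 * k}" by simp
    show "map_permutation {2..<2 * k + 2} (\<lambda>i. i - 2) (shift2 (2 * k) \<tau>) = \<tau>"
      unfolding shift2_def
      by (rule map_permutation_compose_inv[OF _ t])
        (auto intro!: bij_betw_byWitness[where f' = "\<lambda>i. i - 2"])
    show "shift2 (2 * k) \<tau> \<in> {\<sigma>. \<sigma> permutes {2..<2 * k + 2}}"
      using shift2_permutes[OF t] by simp
  next
    fix \<sigma> assume "\<sigma> \<in> {\<sigma>. \<sigma> permutes {2..<2 * k + 2}}"
    then have t: "\<sigma> permutes {2..<2 * k + 2}" by simp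
    have b: "bij_betw (\<lambda>i. i - 2) {2..<2 * k + 2} {..<2 * k}"
      by (rule bij_betw_byWitness[where f' = "\<lambda>i. i + 2"]) auto
    show "shift2 (2 * k) (map_permutation {2..<2 * k + 2} (\<lambda>i. i - 2) \<sigma>) = \<sigma>"
      unfolding shift2_def
      by (rule map_permutation_compose_inv[OF b t]) auto
    show "map_permutation {2..<2 * k + 2} (\<lambda>i. i - 2) \<sigma> \<in> {\<tau>. \<tau> permutes {..<2 * k}}"
      using map_permutation_permutes[OF b t] by simp
  qed simp
  also have "\<dots> = (\<Sum>\<tau> | \<tau> permutes {..<2 * k}. B (v 0) (v 1) * pf_term B k (\<lambda>i. v (i + 2)) \<tau>)"
  proof (intro sum.cong refl)
    fix \<tau> assume "\<tau> \<in> {\<tau>. \<tau> permutes {..<2 * k}}"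
    then have t: "\<tau> permutes {..<2 * k}" by simp
    have low: "shift2 (2 * k) \<tau> 0 = 0" "shift2 (2 * k) \<tau> (Suc 0) = Suc 0"
      using t by (auto intro!: shift2_low)
    have hi: "shift2 (2 * k) \<tau> (Suc (Suc (2 * i))) = Suc (Suc (\<tau> (2 * i)))"
      "shift2 (2 * k) \<tau> (Suc (Suc (Suc (2 * i)))) = Suc (Suc (\<tau> (Suc (2 * i))))" if "i < k" for i
      using shift2_apply[of "2 * i" "2 * k" \<tau>] shift2_apply[of "2 * i + 1" "2 * k" \<tau>] that
      by simp_all
    have "(\<Prod>i<Suc k. B (v (shift2 (2 * k) \<tau> (2 * i))) (v (shift2 (2 * k) \<tau> (2 * i + 1))))
       = B (v 0) (v 1) * (\<Prod>i<k. B (v (\<tau> (2 * i) + 2)) (v (\<tau> (2 * i + 1) + 2)))"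
      unfolding prod.lessThan_Suc_shift
      by (intro arg_cong2[of _ _ _ _ "(*)"] prod.cong) (auto simp: low hi)
    then show "?g (shift2 (2 * k) \<tau>) = B (v 0) (v 1) * pf_term B k (\<lambda>i. v (i + 2)) \<tau>"
      unfolding pf_term_def sign_shift2[OF t] by simp
  qed
  finally show ?thesis
    unfolding pfaff_def by (simp add: sum_distrib_left mult.assoc add.commute)
qed

lemma pfaff_eq_0_if_repeated:
  assumes ij: "i < 2 * k" "j < 2 * k" "i \<noteq> j" and v: "v i = v j"
  shows "pfaff B k v = 0"
proof -
  let ?S = "{\<sigma>. \<sigma> permutes {..<2 * k}}"
  have t: "Transposition.transpose i j permutes {..<2 * k}"
    using ij by (auto intro: permutes_swap_id)
  have vt: "v (Transposition.transpose i j m) = v m" for m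
    using v by (auto simp: Transposition.transpose_def)
  have "pfaff B k v = (\<Sum>\<sigma>\<in>?S. pf_term B k v (Transposition.transpose i j \<circ> \<sigma>))"
    unfolding pfaff_def by (rule setum_permutations_compose_left[OF t])
  also have "\<dots> = (\<Sum>\<sigma>\<in>?S. - pf_term B k v \<sigma>)"
  proof (intro sum.cong refl)
    fix \<sigma> assume "\<sigma> \<in> ?S"
    then have "permutation \<sigma>" using permutation_permutes by blast
    then have "sign (Transposition.transpose i j \<circ> \<sigma>) = - sign \<sigma>"
      by (simp add: sign_compose permutation_swap_id sign_swap_id ij)
    then show "pf_term B k v (Transposition.transpose i j \<circ> \<sigma>) = - pf_term B k v \<sigma>"
      unfolding pf_term_def by (simp add: vt)
  qed
  also have "\<dots> = - pfaff B k v" by (simp add: pfaff_def sum_negf)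
  finally show ?thesis by simp
qed

lemma linear_pfaff:
  assumes l1: "\<And>y. linear (\<lambda>x. B x y)" and l2: "\<And>x. linear (B x)" and j: "j < 2 * k"
  shows "linear (\<lambda>x. pfaff B k (v(j := x)))"
  unfolding pfaff_def
proof (rule linear_compose_sum, intro ballI)
  fix \<sigma> assume "\<sigma> \<in> {\<sigma>. \<sigma> permutes {..<2 * k}}"
  then have \<sigma>: "\<sigma> permutes {..<2 * k}" by simp
  define q where "q = inv \<sigma> j"
  have q: "\<sigma> m = j \<longleftrightarrow> m = q" for m
    using permutes_inv_eq[OF \<sigma>, of j m] q_def by auto
  have "q < 2 * k"
    using permutes_in_image[OF permutes_inv[OF \<sigma>], of j] j q_def by auto
  define a where "a = q div 2"
  have a: "a < k" using \<open>q < 2 * k\<close> a_def by auto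
  let ?f = "\<lambda>x i. B ((v(j := x)) (\<sigma> (2 * i))) ((v(j := x)) (\<sigma> (2 * i + 1)))"
  let ?c = "\<Prod>i\<in>{..<k} - {a}. B (v (\<sigma> (2 * i))) (v (\<sigma> (2 * i + 1)))"
  have "(\<Prod>i<k. ?f x i) = ?f x a * ?c" for x
  proof -
    have "(\<Prod>i<k. ?f x i) = ?f x a * (\<Prod>i\<in>{..<k} - {a}. ?f x i)"
      using a by (simp add: prod.remove)
    moreover have "(\<Prod>i\<in>{..<k} - {a}. ?f x i) = ?c"
      by (intro prod.cong refl) (auto simp: q a_def)
    ultimately show ?thesis by simp
  qed
  then have eq: "(\<lambda>x. pf_term B k (v(j := x)) \<sigma>) = (\<lambda>x. (of_int (sign \<sigma>) * ?c) *\<^sub>R ?f x a)"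
    unfolding pf_term_def by (simp add: mult_ac)
  have "linear (\<lambda>x. ?f x a)"
  proof (cases "even q")
    case True
    then have "2 * a = q" "2 * a + 1 \<noteq> q" by (auto simp: a_def)
    then have "(\<lambda>x. ?f x a) = (\<lambda>x. B x (v (\<sigma> (2 * a + 1))))"
      by (auto simp: q fun_eq_iff)
    then show ?thesis using l1 by simp
  next
    case False
    then have "2 * a + 1 = q" by (simp add: a_def)
    then have "2 * a \<noteq> q" by simp
    with \<open>2 * a + 1 = q\<close> have "(\<lambda>x. ?f x a) = (\<lambda>x. B (v (\<sigma> (2 * a))) x)"
      by (auto simp: q fun_eq_iff)
    then show ?thesis using l2 by simp
  qed
  then show "linear (\<lambda>x. pf_term B k (v(j := x)) \<sigma>)"
    unfolding eq by (rule linear_compose_scale_right)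
qed

text \<open>
  Either two of the vectors coincide, or one of them is a linear combination of the others.
\<close>

lemma pfaff_eq_0_if_dim_less:
  fixes B :: "'v::euclidean_space \<Rightarrow> 'v \<Rightarrow> real"
  assumes l1: "\<And>y. linear (\<lambda>x. B x y)" and l2: "\<And>x. linear (B x)"
    and W: "\<And>i. i < 2 * k \<Longrightarrow> v i \<in> W" and dim: "dim W < 2 * k"
  shows "pfaff B k v = 0"
proof (cases "inj_on v {..<2 * k}")
  case False
  then show ?thesis
    using pfaff_eq_0_if_repeated[of _ k _ v B] by (auto simp: inj_on_def)
next
  case True
  have "dependent (v ` {..<2 * k})"
  proof (rule ccontr)
    assume "independent (v ` {..<2 * k})"
    moreover have "v ` {..<2 * k} \<subseteq> W" using W by auto
    ultimately have "card (v ` {..<2 * k}) \<le> dim W"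
      by (metis dim_eq_card_independent dim_subset)
    then show False using dim card_image[OF True] by simp
  qed
  then obtain j where j: "j < 2 * k" "v j \<in> span (v ` {..<2 * k} - {v j})"
    by (auto simp: dependent_def)
  let ?L = "\<lambda>x. pfaff B k (v(j := x))"
  have "?L x = 0" if "x \<in> span (v ` {..<2 * k} - {v j})" for x
  proof (rule linear_eq_0_on_span[OF linear_pfaff[OF l1 l2 j(1)] _ that])
    fix y assume "y \<in> v ` {..<2 * k} - {v j}"
    then obtain i where i: "i < 2 * k" "i \<noteq> j" "y = v i" by auto
    then show "?L y = 0"
      by (intro pfaff_eq_0_if_repeated[of i k j]) (use j in auto)
  qed
  from this[OF j(2)] show ?thesis by simp
qed

section \<open>Kernels of forms of type (1,1)\<close>

text \<open>
  The inclusion of the tangent space of a fibre \<open>{s} \<times> X\<close>, and the vector that spans the directions of \<open>s\<close>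
  over the complex numbers.
\<close>

definition vert :: "complex ^ 'n::finite \<Rightarrow> complex ^ 'n option" where
  "vert \<eta> = (\<chi> i. case i of None \<Rightarrow> 0 | Some j \<Rightarrow> \<eta> $ j)"

abbreviation es :: "complex ^ ('n::finite) option" where
  "es \<equiv> axis None 1"

lemma vert_nth [simp]: "vert \<eta> $ None = 0" "vert \<eta> $ Some j = \<eta> $ j"
  by (simp_all add: vert_def)

lemma option_vec_eqI: "x $ None = y $ None \<Longrightarrow> (\<And>j. x $ Some j = y $ Some j) \<Longrightarrow> x = y"
  by (simp add: vec_eq_iff) (metis option.exhaust)

lemma es_nth [simp]: "es $ None = 1" "es $ Some j = 0"
  by (simp_all add: axis_def)

lemma linear_vert: "linear vert"
  by (rule linearI) (auto intro: option_vec_eqI)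

lemmas vert_add = linear_add[OF linear_vert]
  and vert_scale = linear_scale[OF linear_vert]
  and vert_0 = linear_0[OF linear_vert]

lemma vert_J: "vert (J \<eta>) = J (vert \<eta>)"
  by (auto intro: option_vec_eqI)

lemma vert_proj: "w = (w $ None) *s es + vert (proj_X w)"
  by (rule option_vec_eqI) (auto simp: proj_X_def)

lemma proj_vert [simp]: "proj_X (vert \<eta>) = \<eta>" "proj_X es = 0"
  by (auto simp: proj_X_def vec_eq_iff)

lemma smult_eq_real: "c *s x = Re c *\<^sub>R x + Im c *\<^sub>R J x"
  by (simp add: vec_eq_iff complex_eq_iff)

lemma J_J [simp]: "J (J x) = - x"
  by (simp add: vec_eq_iff)

lemma linear_J: "linear (J :: complex ^ 'm::finite \<Rightarrow> _)"
  by (rule linearI) (auto simp: vec_eq_iff algebra_simps scaleR_conv_of_real)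

lemmas J_add = linear_add[OF linear_J] and J_scale = linear_scale[OF linear_J]

text \<open>
  Real alternating forms of type (1,1) as functions of two vectors. Such a \<open>B\<close> is the imaginary part of a Hermitian
  form up to sign, and \<open>B x (J y)\<close> is the corresponding symmetric real form.
\<close>

definition J_form :: "(complex ^ 'm::finite \<Rightarrow> complex ^ 'm \<Rightarrow> real) \<Rightarrow> bool" where
  "J_form B \<longleftrightarrow> (\<forall>y. linear (\<lambda>x. B x y)) \<and> (\<forall>x. linear (B x)) \<and>
     (\<forall>x y. B x y = - B y x) \<and> (\<forall>x y. B (J x) (J y) = B x y)"

lemma J_formD:
  assumes "J_form B"
  shows "linear (\<lambda>x. B x y)" "linear (B x)" "B x y = - B y x" "B (J x) (J y) = B x y"
  using assms unfolding J_form_def by blast+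

lemma J_form_simps:
  assumes "J_form B"
  shows "B (x + x') y = B x y + B x' y" "B x (y + y') = B x y + B x y'"
    "B (r *\<^sub>R x) y = r * B x y" "B x (r *\<^sub>R y) = r * B x y"
    "B (- x) y = - B x y" "B x (- y) = - B x y" "B 0 y = 0" "B x 0 = 0" "B x x = 0"
    "B (J x) y = - B x (J y)"
proof -
  note D = J_formD[OF assms]
  show "B (x + x') y = B x y + B x' y" "B x (y + y') = B x y + B x y'"
    "B (r *\<^sub>R x) y = r * B x y" "B x (r *\<^sub>R y) = r * B x y"
    "B (- x) y = - B x y" "B x (- y) = - B x y" "B 0 y = 0" "B x 0 = 0"
    using linear_add[OF D(1)] linear_add[OF D(2)] linear_scale[OF D(1)] linear_scale[OF D(2)]
      linear_neg[OF D(1)] linear_neg[OF D(2)] linear_0[OF D(1)] linear_0[OF D(2)] by auto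
  show "B x x = 0" using D(3)[of x x] by simp
  show "B (J x) y = - B x (J y)"
    using D(4)[of x "J y"] linear_neg[OF D(2)] by simp
qed

lemma J_form_vert:
  assumes B: "J_form B"
  shows "J_form (\<lambda>x y. B (vert x) (vert y))"
  unfolding J_form_def
proof (intro conjI allI)
  show "linear (\<lambda>x. B (vert x) (vert y))" for y
    using linear_compose[OF linear_vert J_formD(1)[OF B]] by (simp add: o_def)
  show "linear (\<lambda>y. B (vert x) (vert y))" for x
    using linear_compose[OF linear_vert J_formD(2)[OF B]] by (simp add: o_def)
  show "B (vert x) (vert y) = - B (vert y) (vert x)" for x y
    by (rule J_formD(3)[OF B])
  show "B (vert (J x)) (vert (J y)) = B (vert x) (vert y)" for x y
    unfolding vert_J by (rule J_formD(4)[OF B])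
qed

text \<open>
  Fewer than \<open>n\<close> complex linear conditions have a common nonzero solution. They are encoded as the components of an
  endomorphism \<open>L\<close> with at least one component zero, which is not onto and hence not injective.
\<close>

lemma exists_orthogonal:
  fixes B :: "complex ^ 'n::finite \<Rightarrow> complex ^ 'n \<Rightarrow> real"
  assumes B: "J_form B" and m: "m < CARD('n)"
  shows "\<exists>w. w \<noteq> 0 \<and> (\<forall>a<m. B (h a) w = 0 \<and> B (h a) (J w) = 0)"
proof -
  obtain idx :: "'n \<Rightarrow> nat" where idx: "bij_betw idx UNIV {..<CARD('n)}"
    using ex_bij_betw_finite_nat[OF finite[of "UNIV :: 'n set"]] by (auto simp: atLeast0LessThan)
  define L where "L w = (\<chi> i. if idx i < m then Complex (B (h (idx i)) w) (B (h (idx i)) (J w)) else 0)" for w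
  note S = J_form_simps[OF B]
  have L: "linear L"
    by (rule linearI) (simp_all add: L_def J_add J_scale S(2,4) vec_eq_iff complex_eq_iff)
  have idx_ex: "\<exists>i. idx i = a" if "a < CARD('n)" for a
    using bij_betw_imp_surj_on[OF idx] that by (metis imageE lessThan_iff)
  obtain i0 where i0: "idx i0 = m"
    using idx_ex[OF m] by blast
  have "L w \<noteq> axis i0 1" for w
  proof
    assume "L w = axis i0 1"
    then have "L w $ i0 = 1" by (simp add: axis_def)
    then show False by (simp add: L_def i0)
  qed
  then have "\<not> surj L" by (metis surj_def)
  then have "\<not> inj L"
    using linear_injective_imp_surjective[OF L] by auto
  then obtain w where w: "w \<noteq> 0" "L w = 0"
    using linear_injective_0[OF L] by auto
  have "B (h a) w = 0 \<and> B (h a) (J w) = 0" if "a < m" for a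
  proof -
    have "a < CARD('n)" using that m by simp
    from idx_ex[OF this] obtain i where i: "idx i = a" by blast
    have "L w $ i = 0" using w by simp
    then show ?thesis by (simp add: L_def i that complex_eq_iff)
  qed
  with w show ?thesis by blast
qed

text \<open>
  Orthogonality for the Hermitian form that belongs to \<open>B\<close>; it asks for two real equations.
\<close>

definition orth_system :: "(complex ^ 'n::finite \<Rightarrow> complex ^ 'n \<Rightarrow> real) \<Rightarrow> nat \<Rightarrow> (nat \<Rightarrow> complex ^ 'n) \<Rightarrow> bool" where
  "orth_system B m h \<longleftrightarrow> (\<forall>a<m. h a \<noteq> 0) \<and>
     (\<forall>a<m. \<forall>b<m. a \<noteq> b \<longrightarrow> B (h a) (h b) = 0 \<and> B (h a) (J (h b)) = 0)"

lemma exists_orth_system: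
  fixes B :: "complex ^ 'n::finite \<Rightarrow> complex ^ 'n \<Rightarrow> real"
  assumes B: "J_form B" and "m \<le> CARD('n)"
  shows "\<exists>h. orth_system B m h"
  using assms(2)
proof (induction m)
  case 0
  then show ?case by (simp add: orth_system_def)
next
  case (Suc m)
  then obtain h where h: "orth_system B m h" by auto
  obtain w where w: "w \<noteq> 0" "\<And>a. a < m \<Longrightarrow> B (h a) w = 0 \<and> B (h a) (J w) = 0"
    using exists_orthogonal[OF B, of m h] Suc.prems by auto
  have w': "B w (h a) = 0 \<and> B w (J (h a)) = 0" if "a < m" for a
    using w(2)[OF that] J_formD(3)[OF B, of w "h a"] J_formD(3)[OF B, of w "J (h a)"]
      J_form_simps(10)[OF B, of "h a" w] by simp
  have "orth_system B (Suc m) (h(m := w))"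
    using h w w' unfolding orth_system_def by (auto simp: less_Suc_eq)
  then show ?case by blast
qed

text \<open>
  In the order \<open>h 0, J (h 0), h 1, J (h 1), \<dots>\<close>, an orthogonal system becomes a sequence in which each vector pairs
  only with its neighbour in the same block, as \<open>pfaff_contract\<close> requires.
\<close>

definition real_frame :: "(nat \<Rightarrow> complex ^ 'n::finite) \<Rightarrow> nat \<Rightarrow> complex ^ 'n" where
  "real_frame h i = (if even i then h (i div 2) else J (h (i div 2)))"

lemma pfaff_real_frame_nonzero:
  fixes B :: "complex ^ 'n::finite \<Rightarrow> complex ^ 'n \<Rightarrow> real"
  assumes B: "J_form B" and pos: "\<And>x. x \<noteq> 0 \<Longrightarrow> B x (J x) > 0" and "orth_system B m h"
  shows "pfaff B m (real_frame h) \<noteq> 0"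
  using assms(3)
proof (induction m arbitrary: h)
  case 0
  then show ?case by (simp add: pfaff_def pf_term_def)
next
  case (Suc m)
  have shift: "(\<lambda>i. real_frame h (i + 2)) = real_frame (\<lambda>a. h (Suc a))"
    by (auto simp: real_frame_def fun_eq_iff)
  have "pfaff B (Suc m) (real_frame h) =
    2 * real (m + 1) * B (real_frame h 0) (real_frame h 1) * pfaff B m (\<lambda>i. real_frame h (i + 2))"
  proof (rule pfaff_contract[OF J_formD(3)[OF B]])
    fix j assume j: "j < 2 * m + 2" "j \<noteq> 1"
    show "B (real_frame h 0) (real_frame h j) = 0"
    proof (cases "j = 0")
      case True
      then show ?thesis by (simp add: real_frame_def J_form_simps[OF B])
    next
      case False
      then have "j div 2 \<noteq> 0" "j div 2 < Suc m" using j by auto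
      then show ?thesis
        using Suc.prems unfolding orth_system_def real_frame_def by auto
    qed
  qed
  moreover have "B (real_frame h 0) (real_frame h 1) > 0"
    using pos[of "h 0"] Suc.prems unfolding orth_system_def real_frame_def by auto
  moreover have "pfaff B m (real_frame (\<lambda>a. h (Suc a))) \<noteq> 0"
    by (rule Suc.IH) (use Suc.prems in \<open>auto simp: orth_system_def\<close>)
  ultimately show ?case unfolding shift by simp
qed

text \<open>
  Positivity on the fibres makes the pairing of fibre vectors nondegenerate, so \<open>\<xi>\<close> can be chosen such that
  \<open>es + vert \<xi>\<close> is orthogonal to the fibre. On this vector, its image under \<open>J\<close> and an orthogonal frame of the fibre,
  the top power is a nonzero multiple of \<open>B (es + vert \<xi>) (J (es + vert \<xi>))\<close>. As the power vanishes, so does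
  this number, and then \<open>es + vert \<xi>\<close> is orthogonal to everything.
\<close>

lemma kernel_vector:
  fixes B :: "complex ^ ('n::finite) option \<Rightarrow> complex ^ 'n option \<Rightarrow> real"
  assumes B: "J_form B" and pos: "\<And>\<eta>. \<eta> \<noteq> 0 \<Longrightarrow> B (vert \<eta>) (J (vert \<eta>)) > 0"
    and deg: "\<And>v. pfaff B (CARD('n) + 1) v = 0"
  shows "\<exists>\<xi>. \<forall>w. B (es + vert \<xi>) w = 0"
proof -
  note S = J_form_simps[OF B]
  define L where "L \<xi> = (\<Sum>b\<in>Basis. B (vert \<xi>) (vert b) *\<^sub>R b)" for \<xi> :: "complex ^ 'n"
  have linL: "linear L"
    by (rule linearI)
      (simp_all add: L_def vert_add vert_scale S(1,3) scaleR_add_left sum.distrib scaleR_sum_right)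
  have Lb: "L \<xi> \<bullet> b = B (vert \<xi>) (vert b)" if "b \<in> Basis" for \<xi> b
    using that by (simp add: L_def inner_sum_left inner_Basis if_distrib sum.delta cong: if_cong)
  have ext: "B x (vert \<eta>) = 0" if "\<And>b. b \<in> Basis \<Longrightarrow> B x (vert b) = 0" for x and \<eta> :: "complex ^ 'n"
  proof -
    have "linear (\<lambda>\<eta>. B x (vert \<eta>))"
      using linear_compose[OF linear_vert J_formD(2)[OF B]] by (simp add: o_def)
    from linear_eq_0_on_span[OF this that, of Basis \<eta>] show ?thesis by (simp add: span_Basis)
  qed
  have "inj L"
  proof (subst linear_injective_0[OF linL], intro allI impI)
    fix \<xi> assume "L \<xi> = 0"
    then have "B (vert \<xi>) (vert b) = 0" if "b \<in> Basis" for b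
      using Lb[OF that, of \<xi>] by simp
    then have "B (vert \<xi>) (vert (J \<xi>)) = 0"
      by (rule ext)
    then show "\<xi> = 0" using pos[of \<xi>] by (auto simp: vert_J)
  qed
  then have "surj L" using linear_injective_imp_surjective[OF linL] by blast
  then obtain \<xi> where \<xi>: "(\<Sum>b\<in>Basis. (- B es (vert b)) *\<^sub>R b) = L \<xi>"
    unfolding surj_def by blast
  let ?z = "es + vert \<xi>"
  have fibre: "B ?z (vert \<eta>) = 0" for \<eta>
  proof (rule ext)
    fix b :: "complex ^ 'n" assume b: "b \<in> Basis"
    have "L \<xi> \<bullet> b = - B es (vert b)"
      using b unfolding \<xi>[symmetric] by (simp add: inner_sum_left inner_Basis if_distrib sum.delta cong: if_cong)
    then show "B ?z (vert b) = 0" using Lb[OF b, of \<xi>] by (simp add: S(1))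
  qed
  obtain h where h: "orth_system (\<lambda>x y. B (vert x) (vert y)) CARD('n) h"
    using exists_orth_system[OF J_form_vert[OF B]] by blast
  define v where "v i = (if i = 0 then ?z else if i = 1 then J ?z else vert (real_frame h (i - 2)))" for i
  have "pfaff B (Suc CARD('n)) v = 2 * real (CARD('n) + 1) * B (v 0) (v 1) * pfaff B CARD('n) (\<lambda>i. v (i + 2))"
    by (rule pfaff_contract[OF J_formD(3)[OF B]]) (simp add: v_def S(9) fibre)
  moreover have "pfaff B CARD('n) (\<lambda>i. v (i + 2)) = pfaff (\<lambda>x y. B (vert x) (vert y)) CARD('n) (real_frame h)"
    by (simp add: v_def pfaff_def pf_term_def)
  moreover have "pfaff (\<lambda>x y. B (vert x) (vert y)) CARD('n) (real_frame h) \<noteq> 0"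
    by (rule pfaff_real_frame_nonzero[OF J_form_vert[OF B] _ h]) (simp add: vert_J pos)
  ultimately have zz: "B ?z (J ?z) = 0"
    using deg[of v] by (simp add: v_def)
  have "B ?z w = 0" for w
  proof -
    have "w = (w $ None) *s ?z + vert (proj_X w - (w $ None) *s \<xi>)"
      by (rule option_vec_eqI) (auto simp: proj_X_def)
    from arg_cong[OF this, of "B ?z"]
    have "B ?z w = B ?z ((w $ None) *s ?z) + B ?z (vert (proj_X w - (w $ None) *s \<xi>))"
      by (simp only: S(2))
    also have "\<dots> = 0"
      by (simp only: smult_eq_real[of "w $ None" ?z] S(2,4,9) zz fibre mult_zero_right add_0)
    finally show ?thesis .
  qed
  then show ?thesis by blast
qed

text \<open>
  If both \<open>es\<close> and \<open>vert \<eta>\<close> with \<open>\<eta> \<noteq> 0\<close> were in the kernel, subtracting multiples of them would make two complex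
  coordinates of every argument vanish without changing \<open>B\<close>. The arguments would then lie in a space of real
  dimension \<open>2 (n - 1)\<close>, too small for \<open>2 n\<close> independent vectors.
\<close>

lemma kernel_transversal:
  fixes B :: "complex ^ ('n::finite) option \<Rightarrow> complex ^ 'n option \<Rightarrow> real"
  assumes B: "J_form B" and rank: "pfaff B CARD('n) v \<noteq> 0"
    and es: "\<And>w. B es w = 0" and \<eta>: "\<And>w. B (vert \<eta>) w = 0"
  shows "\<eta> = 0"
proof (rule ccontr)
  assume "\<eta> \<noteq> 0"
  then obtain j where j: "\<eta> $ j \<noteq> 0" by (auto simp: vec_eq_iff)
  note S = J_form_simps[OF B]
  have es': "B (c *s es) w = 0" and \<eta>': "B (c *s vert \<eta>) w = 0" for c w
    by (simp_all only: smult_eq_real[of c es] smult_eq_real[of c "vert \<eta>"] S es \<eta>)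
  \<comment> \<open>the projection along the kernel onto the vectors whose coordinates \<open>None\<close> and \<open>Some j\<close> vanish\<close>
  define \<pi> where "\<pi> w = w + ((- w $ None) *s es + (- w $ Some j / \<eta> $ j) *s vert \<eta>)" for w
  have left: "B (\<pi> x) y = B x y" for x y
    unfolding \<pi>_def by (simp only: S(1) es' \<eta>' add_0_right)
  have "B (\<pi> x) (\<pi> y) = B x y" for x y
    using left[of x "\<pi> y"] left[of y x] J_formD(3)[OF B, of x "\<pi> y"] J_formD(3)[OF B, of y x] by linarith
  then have "pfaff B CARD('n) v = pfaff B CARD('n) (\<lambda>i. \<pi> (v i))"
    by (simp add: pfaff_def pf_term_def)
  also have "\<dots> = 0"
  proof (rule pfaff_eq_0_if_dim_less[OF J_formD(1,2)[OF B]])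
    let ?b = "\<lambda>p. axis (Some (fst p)) (if snd p then 1 else \<i>) :: complex ^ 'n option"
    let ?X = "?b ` ((UNIV - {j}) \<times> UNIV)"
    show "\<pi> (v i) \<in> span ?X" for i
    proof -
      let ?w = "\<pi> (v i)"
      have 0: "?w $ None = 0" "?w $ Some j = 0"
        using j by (simp_all add: \<pi>_def)
      have "?w = (\<Sum>k\<in>UNIV - {j}. Re (?w $ Some k) *\<^sub>R ?b (k, True) + Im (?w $ Some k) *\<^sub>R ?b (k, False))"
      proof (rule option_vec_eqI)
        show "?w $ None = (\<Sum>k\<in>UNIV - {j}. Re (?w $ Some k) *\<^sub>R ?b (k, True) + Im (?w $ Some k) *\<^sub>R ?b (k, False)) $ None"
          using 0 by (simp add: axis_def)
        fix l
        have "(\<Sum>k\<in>UNIV - {j}. Re (?w $ Some k) *\<^sub>R ?b (k, True) + Im (?w $ Some k) *\<^sub>R ?b (k, False)) $ Some l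
          = (\<Sum>k\<in>UNIV - {j}. if k = l then ?w $ Some l else 0)"
          unfolding sum_component by (intro sum.cong refl) (auto simp: axis_def complex_eq_iff)
        also have "\<dots> = ?w $ Some l" using 0 by (auto simp: sum.delta)
        finally show "?w $ Some l = (\<Sum>k\<in>UNIV - {j}. Re (?w $ Some k) *\<^sub>R ?b (k, True) + Im (?w $ Some k) *\<^sub>R ?b (k, False)) $ Some l"
          by simp
      qed
      also have "\<dots> \<in> span ?X"
        by (intro span_sum span_add span_scale span_base) (rule imageI, simp)+
      finally show ?thesis .
    qed
    have "dim (span ?X) \<le> card ?X"
      unfolding dim_span by (rule dim_le_card') simp
    also have "\<dots> \<le> card ((UNIV - {j}) \<times> (UNIV :: bool set))"
      by (rule card_image_le) simp
    also have "\<dots> = 2 * (CARD('n) - 1)"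
      by (simp add: card_cartesian_product card_Diff_singleton mult.commute)
    also have "\<dots> < 2 * CARD('n)"
      by (simp add: card_gt_0_iff)
    finally show "dim (span ?X) < 2 * CARD('n)" .
  qed
  finally show False using rank by simp
qed

section \<open>Directional derivatives on sets with boundary\<close>

text \<open>
  A condition on \<open>D\<close> under which calculus within \<open>D\<close> works up to the boundary: from each point one can move along any
  two given directions, after changing their signs if necessary, through a small parallelogram in \<open>D\<close>. Open sets and
  the closed strip over an open set satisfy it. It ensures that derivatives within \<open>D\<close> are unique and that second derivatives
  commute.
\<close>

definition cornered :: "'v::real_normed_vector set \<Rightarrow> bool" where
  "cornered D \<longleftrightarrow> (\<forall>x\<in>D. \<forall>a b. \<exists>\<sigma> \<tau>::real. \<sigma> \<noteq> 0 \<and> \<tau> \<noteq> 0 \<and>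
     (\<forall>s\<in>{0..1}. \<forall>t\<in>{0..1}. x + s *\<^sub>R (\<sigma> *\<^sub>R a) + t *\<^sub>R (\<tau> *\<^sub>R b) \<in> D))"

definition dird :: "'v::real_normed_vector set \<Rightarrow> 'v \<Rightarrow> ('v \<Rightarrow> 'w::real_normed_vector) \<Rightarrow> 'v \<Rightarrow> 'w" where
  "dird D a f x = frechet_derivative f (at x within D) a"

lemma open_parallelogram:
  fixes a b :: "'v::real_normed_vector"
  assumes "open D" and "x \<in> D"
  shows "\<exists>h>0. \<forall>s t. \<bar>s\<bar> \<le> h \<longrightarrow> \<bar>t\<bar> \<le> h \<longrightarrow> x + s *\<^sub>R a + t *\<^sub>R b \<in> D"
proof -
  obtain r where r: "r > 0" "ball x r \<subseteq> D"
    using assms open_contains_ball by blast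
  define N where "N = norm a + norm b + 1"
  have N: "N > 0"
    using norm_ge_zero[of a] norm_ge_zero[of b] unfolding N_def by linarith
  have "x + s *\<^sub>R a + t *\<^sub>R b \<in> D" if "\<bar>s\<bar> \<le> r / (2 * N)" "\<bar>t\<bar> \<le> r / (2 * N)" for s t
  proof -
    have "norm (s *\<^sub>R a + t *\<^sub>R b) \<le> \<bar>s\<bar> * norm a + \<bar>t\<bar> * norm b"
      by (rule norm_triangle_le) simp
    also have "\<dots> \<le> r / (2 * N) * norm a + r / (2 * N) * norm b"
      by (intro add_mono mult_right_mono that) auto
    also have "\<dots> \<le> r / (2 * N) * N"
      unfolding N_def distrib_left using r(1) N[unfolded N_def] by simp
    also have "\<dots> < r" using N r(1) by simp
    finally have "x + (s *\<^sub>R a + t *\<^sub>R b) \<in> ball x r"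
      unfolding mem_ball dist_norm norm_minus_commute[of x] by simp
    then show ?thesis using r(2) by (auto simp: add.assoc)
  qed
  then show ?thesis
    using r(1) N by (intro exI[of _ "r / (2 * N)"]) auto
qed

lemma cornered_open:
  assumes "open D"
  shows "cornered D"
  unfolding cornered_def
proof (intro ballI allI)
  fix x and a b :: 'a
  assume "x \<in> D"
  from open_parallelogram[OF assms this, of a b] obtain h where h: "h > 0"
    "\<And>s t. \<bar>s\<bar> \<le> h \<Longrightarrow> \<bar>t\<bar> \<le> h \<Longrightarrow> x + s *\<^sub>R a + t *\<^sub>R b \<in> D" by blast
  have "x + s *\<^sub>R (h *\<^sub>R a) + t *\<^sub>R (h *\<^sub>R b) \<in> D" if "s \<in> {0..1}" "t \<in> {0..1}" for s t
    using h(2)[of "s * h" "t * h"] that h(1) by (simp add: abs_mult mult_left_le_one_le)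
  then show "\<exists>\<sigma> \<tau>::real. \<sigma> \<noteq> 0 \<and> \<tau> \<noteq> 0 \<and>
      (\<forall>s\<in>{0..1}. \<forall>t\<in>{0..1}. x + s *\<^sub>R (\<sigma> *\<^sub>R a) + t *\<^sub>R (\<tau> *\<^sub>R b) \<in> D)"
    using h(1) by (intro exI[of _ h]) auto
qed

lemma frechet_derivative_eqI:
  fixes f :: "'v::euclidean_space \<Rightarrow> 'w::real_normed_vector"
  assumes D: "cornered D" and x: "x \<in> D" and f: "(f has_derivative f') (at x within D)"
  shows "frechet_derivative f (at x within D) = f'"
proof (rule frechet_derivative_unique_within[OF _ f])
  show "(f has_derivative frechet_derivative f (at x within D)) (at x within D)"
    using f by (metis differentiableI frechet_derivative_works)
  fix i :: 'v and e :: real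
  assume "i \<in> Basis" "e > 0"
  obtain \<sigma> \<tau> :: real where s: "\<sigma> \<noteq> 0"
    "\<And>s t. s \<in> {0..1} \<Longrightarrow> t \<in> {0..1} \<Longrightarrow> x + s *\<^sub>R (\<sigma> *\<^sub>R i) + t *\<^sub>R (\<tau> *\<^sub>R i) \<in> D"
    using D x unfolding cornered_def by meson
  define h where "h = min 1 (e / (2 * \<bar>\<sigma>\<bar>))"
  have h: "0 < h" "h \<le> 1" "h * \<bar>\<sigma>\<bar> < e"
    using \<open>e > 0\<close> s(1) by (auto simp: h_def min_def field_simps)
  then show "\<exists>d. 0 < \<bar>d\<bar> \<and> \<bar>d\<bar> < e \<and> x + d *\<^sub>R i \<in> D"
    using s(2)[of h 0] s(1) by (intro exI[of _ "h * \<sigma>"]) (auto simp: abs_mult)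
qed

lemma dird_eqI:
  fixes f :: "'v::euclidean_space \<Rightarrow> 'w::real_normed_vector"
  shows "cornered D \<Longrightarrow> x \<in> D \<Longrightarrow> (f has_derivative f') (at x within D) \<Longrightarrow> dird D a f x = f' a"
  unfolding dird_def by (simp add: frechet_derivative_eqI)

lemma Ck_on_cong:
  assumes "\<And>x. x \<in> D \<Longrightarrow> f x = g x"
  shows "Ck_on k D f \<longleftrightarrow> Ck_on k D g"
proof (cases k)
  case 0
  then show ?thesis using continuous_on_cong[OF refl assms] by simp
next
  case (Suc k)
  have "(f has_derivative f') (at x within D) \<longleftrightarrow> (g has_derivative f') (at x within D)" if "x \<in> D" for x f'
    using has_derivative_transform[OF that, of f g f'] has_derivative_transform[OF that, of g f f'] assms by auto
  then show ?thesis unfolding Suc Ck_on.simps by auto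
qed

lemma Ck_on_Suc_imp: "Ck_on (Suc k) D f \<Longrightarrow> Ck_on k D f"
proof (induction k arbitrary: f)
  case 0
  then show ?case
    by (auto simp: continuous_on_eq_continuous_within intro: has_derivative_continuous)
next
  case (Suc k)
  then obtain f' where "\<forall>x\<in>D. (f has_derivative f' x) (at x within D)" "\<forall>v. Ck_on (Suc k) D (\<lambda>x. f' x v)"
    by (metis Ck_on.simps(2))
  with Suc.IH show ?case unfolding Ck_on.simps(2)[of k] by blast
qed

lemma Ck_on_le: "Ck_on m D f \<Longrightarrow> k \<le> m \<Longrightarrow> Ck_on k D f"
  by (induction m) (auto simp: le_Suc_eq dest: Ck_on_Suc_imp simp del: Ck_on.simps)

lemma Ck_on_imp_continuous: "Ck_on k D f \<Longrightarrow> continuous_on D f"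
  using Ck_on_le[of k D f 0] by simp

lemma Ck_on_dird:
  fixes f :: "'v::euclidean_space \<Rightarrow> 'w::real_normed_vector"
  assumes D: "cornered D" and f: "Ck_on (Suc k) D f"
  shows "x \<in> D \<Longrightarrow> (f has_derivative (\<lambda>a. dird D a f x)) (at x within D)" and "Ck_on k D (dird D a f)"
proof -
  from f obtain f' where f': "\<And>x. x \<in> D \<Longrightarrow> (f has_derivative f' x) (at x within D)"
    and k: "\<And>v. Ck_on k D (\<lambda>x. f' x v)" by auto
  have eq: "f' x a = dird D a f x" if "x \<in> D" for x a
    using dird_eqI[OF D that f'[OF that]] by simp
  show "(f has_derivative (\<lambda>a. dird D a f x)) (at x within D)" if "x \<in> D"
  proof -
    have "f' x = (\<lambda>a. dird D a f x)" using eq[OF that] by (rule ext)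
    then show ?thesis using f'[OF that] by simp
  qed
  show "Ck_on k D (dird D a f)"
    using k[of a] Ck_on_cong[of D "\<lambda>x. f' x a" "dird D a f" k] eq by simp
qed

lemma dird_cong:
  assumes "\<And>y. y \<in> D \<Longrightarrow> f y = g y" and "x \<in> D"
  shows "dird D a f x = dird D a g x"
proof -
  have "(f has_derivative f') (at x within D) \<longleftrightarrow> (g has_derivative f') (at x within D)" for f'
    using has_derivative_transform[OF assms(2), of f g f'] has_derivative_transform[OF assms(2), of g f f'] assms(1) by auto
  then show ?thesis unfolding dird_def frechet_derivative_def by simp
qed

lemma linear_dird:
  fixes f :: "'v::euclidean_space \<Rightarrow> 'w::real_normed_vector"
  assumes "cornered D" "Ck_on (Suc k) D f" "x \<in> D"
  shows "linear (\<lambda>a. dird D a f x)"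
  using Ck_on_dird(1)[OF assms] by (rule has_derivative_linear)

lemma dird_scaled_function:
  fixes f :: "'v::euclidean_space \<Rightarrow> real"
  assumes "cornered D" "Ck_on (Suc k) D f" "x \<in> D"
  shows "dird D a (\<lambda>y. c * f y) x = c * dird D a f x"
  by (rule dird_eqI[OF assms(1,3)]) (intro has_derivative_mult_right Ck_on_dird(1)[OF assms])

lemma has_vector_derivative_along_line:
  fixes f :: "'v::euclidean_space \<Rightarrow> 'w::real_normed_vector"
  assumes D: "cornered D" and f: "Ck_on (Suc k) D f"
    and S: "\<And>s. s \<in> S \<Longrightarrow> x + s *\<^sub>R a \<in> D" and s: "s \<in> S"
  shows "((\<lambda>s. f (x + s *\<^sub>R a)) has_vector_derivative dird D a f (x + s *\<^sub>R a)) (at s within S)"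
proof -
  let ?l = "\<lambda>s. x + s *\<^sub>R a"
  have "(?l has_derivative (\<lambda>h. h *\<^sub>R a)) (at s within S)"
    by (auto intro!: derivative_eq_intros)
  moreover have "(f has_derivative (\<lambda>a. dird D a f (?l s))) (at (?l s) within ?l ` S)"
    by (rule has_derivative_subset[OF Ck_on_dird(1)[OF D f S[OF s]]]) (use S in auto)
  ultimately have "((\<lambda>s. f (?l s)) has_derivative (\<lambda>h. dird D (h *\<^sub>R a) f (?l s))) (at s within S)"
    by (rule has_derivative_in_compose)
  moreover have "dird D (h *\<^sub>R a) f (?l s) = h *\<^sub>R dird D a f (?l s)" for h
    by (rule linear_scale[OF linear_dird[OF D f S[OF s]]])
  ultimately show ?thesis
    unfolding has_vector_derivative_def by simp
qed

text \<open>
  The mean value theorem for segments that may lie on the boundary of \<open>D\<close>.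
\<close>

lemma mvt_along_line:
  fixes f :: "'v::euclidean_space \<Rightarrow> real"
  assumes D: "cornered D" and f: "Ck_on (Suc k) D f" and "0 \<le> h"
    and S: "\<And>s. s \<in> {0..h} \<Longrightarrow> x + s *\<^sub>R a \<in> D"
  shows "\<exists>s\<in>{0..h}. f (x + h *\<^sub>R a) - f x = h * dird D a f (x + s *\<^sub>R a)"
proof -
  have "\<exists>s\<in>{0..h}. f (x + h *\<^sub>R a) - f (x + 0 *\<^sub>R a) = (\<lambda>k. k *\<^sub>R dird D a f (x + s *\<^sub>R a)) (h - 0)"
  proof (rule mvt_very_simple[OF \<open>0 \<le> h\<close>])
    fix s assume "0 \<le> s" "s \<le> h"
    then have "s \<in> {0..h}" by simp
    from has_vector_derivative_along_line[OF D f S this]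
    show "((\<lambda>s. f (x + s *\<^sub>R a)) has_derivative (\<lambda>k. k *\<^sub>R dird D a f (x + s *\<^sub>R a))) (at s within {0..h})"
      unfolding has_vector_derivative_def .
  qed
  then show ?thesis by simp
qed

text \<open>
  Two applications of the mean value theorem, first along \<open>a\<close> and then along \<open>b\<close>. The left-hand side is symmetric in
  \<open>a\<close> and \<open>b\<close>, whence the symmetry of second derivatives.
\<close>

lemma second_difference:
  fixes f :: "'v::euclidean_space \<Rightarrow> real"
  assumes D: "cornered D" and f: "Ck_on 2 D f" and h: "0 \<le> h" "h \<le> 1"
    and box: "\<And>s t. s \<in> {0..1} \<Longrightarrow> t \<in> {0..1} \<Longrightarrow> x + s *\<^sub>R a + t *\<^sub>R b \<in> D"
  shows "\<exists>s\<in>{0..h}. \<exists>t\<in>{0..h}. f (x + h *\<^sub>R a + h *\<^sub>R b) - f (x + h *\<^sub>R a) - f (x + h *\<^sub>R b) + f x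
     = h * h * dird D b (dird D a f) (x + s *\<^sub>R a + t *\<^sub>R b)"
proof -
  have f2: "Ck_on (Suc (Suc 0)) D f" using f by (simp add: numeral_2_eq_2)
  let ?q = "\<lambda>s. f ((x + h *\<^sub>R b) + s *\<^sub>R a) - f (x + s *\<^sub>R a)"
  have in1: "(x + h *\<^sub>R b) + s *\<^sub>R a \<in> D" "x + s *\<^sub>R a \<in> D" if "s \<in> {0..h}" for s
    using box[of s h] box[of s 0] that h by (auto simp: add_ac)
  have "\<exists>s\<in>{0..h}. ?q h - ?q 0 = (\<lambda>k. k *\<^sub>R (dird D a f ((x + h *\<^sub>R b) + s *\<^sub>R a) - dird D a f (x + s *\<^sub>R a))) (h - 0)"
  proof (rule mvt_very_simple[OF h(1)])
    fix s assume "0 \<le> s" "s \<le> h"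
    then have s: "s \<in> {0..h}" by simp
    have "(?q has_vector_derivative (dird D a f ((x + h *\<^sub>R b) + s *\<^sub>R a) - dird D a f (x + s *\<^sub>R a))) (at s within {0..h})"
      by (intro has_vector_derivative_diff has_vector_derivative_along_line[OF D f2 _ s] in1)
    then show "(?q has_derivative (\<lambda>k. k *\<^sub>R (dird D a f ((x + h *\<^sub>R b) + s *\<^sub>R a) - dird D a f (x + s *\<^sub>R a)))) (at s within {0..h})"
      unfolding has_vector_derivative_def .
  qed
  then obtain s where s: "s \<in> {0..h}"
    and eq: "?q h - ?q 0 = h * (dird D a f ((x + s *\<^sub>R a) + h *\<^sub>R b) - dird D a f (x + s *\<^sub>R a))"
    by (auto simp: add_ac)
  obtain t where t: "t \<in> {0..h}"
    "dird D a f ((x + s *\<^sub>R a) + h *\<^sub>R b) - dird D a f (x + s *\<^sub>R a) = h * dird D b (dird D a f) ((x + s *\<^sub>R a) + t *\<^sub>R b)"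
    using mvt_along_line[OF D Ck_on_dird(2)[OF D f2] h(1), of "x + s *\<^sub>R a" b a] box s h by auto
  show ?thesis
    by (rule bexI[OF _ s], rule bexI[OF _ t(1)]) (use eq t(2) in \<open>simp add: algebra_simps\<close>)
qed

lemma dird_commute_box:
  fixes f :: "'v::euclidean_space \<Rightarrow> real"
  assumes D: "cornered D" and f: "Ck_on 2 D f"
    and box: "\<And>s t. s \<in> {0..1} \<Longrightarrow> t \<in> {0..1} \<Longrightarrow> x + s *\<^sub>R a + t *\<^sub>R b \<in> D"
  shows "dird D a (dird D b f) x = dird D b (dird D a f) x"
proof (rule ccontr)
  let ?P = "dird D a (dird D b f)" and ?Q = "dird D b (dird D a f)"
  assume ne: "?P x \<noteq> ?Q x"
  define d where "d = \<bar>?P x - ?Q x\<bar> / 2"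
  have d: "d > 0" using ne by (simp add: d_def)
  have f2: "Ck_on (Suc (Suc 0)) D f" using f by (simp add: numeral_2_eq_2)
  have x: "x \<in> D" using box[of 0 0] by simp
  have cont: "continuous_on D ?P" "continuous_on D ?Q"
    using Ck_on_dird(2)[OF D Ck_on_dird(2)[OF D f2]] by simp_all
  obtain r1 where r1: "r1 > 0" "\<And>y. y \<in> D \<Longrightarrow> dist y x < r1 \<Longrightarrow> dist (?P y) (?P x) < d"
    using cont(1) x d unfolding continuous_on_iff by meson
  obtain r2 where r2: "r2 > 0" "\<And>y. y \<in> D \<Longrightarrow> dist y x < r2 \<Longrightarrow> dist (?Q y) (?Q x) < d"
    using cont(2) x d unfolding continuous_on_iff by meson
  define N where "N = norm a + norm b + 1"
  have N: "N > 0" unfolding N_def by (smt (verit) norm_ge_zero)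
  define h where "h = min 1 (min r1 r2 / (2 * N))"
  have h: "0 < h" "h \<le> 1" using r1 r2 N by (auto simp: h_def)
  have "h * N \<le> min r1 r2 / 2"
    using N by (auto simp: h_def min_def field_simps)
  then have hN: "h * N < r1" "h * N < r2" using r1(1) r2(1) by auto
  have near: "x + s *\<^sub>R a + t *\<^sub>R b \<in> D" "dist (x + s *\<^sub>R a + t *\<^sub>R b) x < r1" "dist (x + s *\<^sub>R a + t *\<^sub>R b) x < r2"
    if "s \<in> {0..h}" "t \<in> {0..h}" for s t
  proof -
    show "x + s *\<^sub>R a + t *\<^sub>R b \<in> D" using box that h by auto
    have "dist (x + s *\<^sub>R a + t *\<^sub>R b) x = norm (s *\<^sub>R a + t *\<^sub>R b)"
      by (simp add: dist_norm add.assoc)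
    also have "\<dots> \<le> s * norm a + t * norm b"
      by (rule norm_triangle_le) (use that in simp)
    also have "\<dots> \<le> h * norm a + h * norm b"
      by (intro add_mono mult_right_mono) (use that in auto)
    also have "\<dots> \<le> h * N" using h by (simp add: N_def algebra_simps)
    finally show "dist (x + s *\<^sub>R a + t *\<^sub>R b) x < r1" "dist (x + s *\<^sub>R a + t *\<^sub>R b) x < r2"
      using hN by linarith+
  qed
  have box': "x + s *\<^sub>R b + t *\<^sub>R a \<in> D" if "s \<in> {0..1}" "t \<in> {0..1}" for s t
    using box[OF that(2,1)] by (simp add: add_ac)
  obtain s t where st: "s \<in> {0..h}" "t \<in> {0..h}" and
    1: "f (x + h *\<^sub>R a + h *\<^sub>R b) - f (x + h *\<^sub>R a) - f (x + h *\<^sub>R b) + f x = h * h * ?Q (x + s *\<^sub>R a + t *\<^sub>R b)"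
    using second_difference[OF D f less_imp_le[OF h(1)] h(2) box] by blast
  obtain s' t' where st': "s' \<in> {0..h}" "t' \<in> {0..h}" and
    2: "f (x + h *\<^sub>R b + h *\<^sub>R a) - f (x + h *\<^sub>R b) - f (x + h *\<^sub>R a) + f x = h * h * ?P (x + s' *\<^sub>R b + t' *\<^sub>R a)"
    using second_difference[OF D f less_imp_le[OF h(1)] h(2) box'] by blast
  have "h * h * ?P (x + t' *\<^sub>R a + s' *\<^sub>R b) = h * h * ?Q (x + s *\<^sub>R a + t *\<^sub>R b)"
  proof -
    have "x + h *\<^sub>R b + h *\<^sub>R a = x + h *\<^sub>R a + h *\<^sub>R b"
      and "x + s' *\<^sub>R b + t' *\<^sub>R a = x + t' *\<^sub>R a + s' *\<^sub>R b" by (simp_all add: add_ac)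
    with 2 have "f (x + h *\<^sub>R a + h *\<^sub>R b) - f (x + h *\<^sub>R b) - f (x + h *\<^sub>R a) + f x
      = h * h * ?P (x + t' *\<^sub>R a + s' *\<^sub>R b)" by simp
    with 1 show ?thesis by linarith
  qed
  then have "?P (x + t' *\<^sub>R a + s' *\<^sub>R b) = ?Q (x + s *\<^sub>R a + t *\<^sub>R b)"
    using h(1) by simp
  moreover have "dist (?P (x + t' *\<^sub>R a + s' *\<^sub>R b)) (?P x) < d"
    by (rule r1(2)) (use near[OF st'(2,1)] in auto)
  moreover have "dist (?Q (x + s *\<^sub>R a + t *\<^sub>R b)) (?Q x) < d"
    by (rule r2(2)) (use near[OF st] in auto)
  moreover have "\<bar>?P x - ?Q x\<bar> = 2 * d" by (simp add: d_def)
  moreover have "False" if "p = q" "dist p P < d" "dist q Q < d" "\<bar>P - Q\<bar> = 2 * d" for p q P Q :: real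
    using that unfolding dist_real_def by linarith
  ultimately show False by blast
qed

text \<open>
  A parallelogram on one side of the point suffices, so that this holds at boundary points too. Changing the signs of \<open>a\<close> and \<open>b\<close> is harmless, since both sides are
  homogeneous in each of them.
\<close>

lemma dird_commute:
  fixes f :: "'v::euclidean_space \<Rightarrow> real"
  assumes D: "cornered D" and f: "Ck_on 2 D f" and x: "x \<in> D"
  shows "dird D a (dird D b f) x = dird D b (dird D a f) x"
proof -
  have f2: "Ck_on (Suc (Suc 0)) D f" using f by (simp add: numeral_2_eq_2)
  obtain \<sigma> \<tau> :: real where s: "\<sigma> \<noteq> 0" "\<tau> \<noteq> 0"
    "\<And>s t. s \<in> {0..1} \<Longrightarrow> t \<in> {0..1} \<Longrightarrow> x + s *\<^sub>R (\<sigma> *\<^sub>R a) + t *\<^sub>R (\<tau> *\<^sub>R b) \<in> D"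
    using D x unfolding cornered_def by meson
  have scale: "dird D (c *\<^sub>R a) (dird D (c' *\<^sub>R b) f) x = c * c' * dird D a (dird D b f) x" for c c' a b
  proof -
    have "dird D (c *\<^sub>R a) (dird D (c' *\<^sub>R b) f) x = c *\<^sub>R dird D a (dird D (c' *\<^sub>R b) f) x"
      by (rule linear_scale[OF linear_dird[OF D Ck_on_dird(2)[OF D f2] x]])
    also have "dird D a (dird D (c' *\<^sub>R b) f) x = dird D a (\<lambda>y. c' * dird D b f y) x"
      by (rule dird_cong[OF _ x]) (use linear_scale[OF linear_dird[OF D f2]] in simp)
    also have "\<dots> = c' * dird D a (dird D b f) x"
      by (rule dird_scaled_function[OF D Ck_on_dird(2)[OF D f2] x])
    finally show ?thesis by simp
  qed
  have "dird D (\<sigma> *\<^sub>R a) (dird D (\<tau> *\<^sub>R b) f) x = dird D (\<tau> *\<^sub>R b) (dird D (\<sigma> *\<^sub>R a) f) x"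
    by (rule dird_commute_box[OF D f s(3)])
  then show ?thesis using s(1,2) unfolding scale by simp
qed

lemma linear_dird_inner:
  fixes f :: "'v::euclidean_space \<Rightarrow> real"
  assumes "cornered D" "Ck_on 2 D f" "x \<in> D"
  shows "linear (\<lambda>a. dird D a (dird D b f) x)" and "linear (\<lambda>b. dird D a (dird D b f) x)"
proof -
  have f2: "Ck_on (Suc (Suc 0)) D f" using assms(2) by (simp add: numeral_2_eq_2)
  show 1: "linear (\<lambda>a. dird D a (dird D b f) x)" for b
    by (rule linear_dird[OF assms(1) Ck_on_dird(2)[OF assms(1) f2] assms(3)])
  show "linear (\<lambda>b. dird D a (dird D b f) x)"
    unfolding dird_commute[OF assms, of a] by (rule 1)
qed

lemma Ck_on_affine:
  fixes f :: "'v::euclidean_space \<Rightarrow> 'w::real_normed_vector" and L :: "'u::euclidean_space \<Rightarrow> 'v"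
  assumes L: "linear L" and DE: "\<And>z. z \<in> D \<Longrightarrow> p + L z \<in> E" and f: "Ck_on k E f"
  shows "Ck_on k D (\<lambda>z. f (p + L z))"
  using f
proof (induction k arbitrary: f)
  case 0
  then have "continuous_on E f" by simp
  moreover have "continuous_on D (\<lambda>z. p + L z)"
    by (intro continuous_intros linear_continuous_on linear_conv_bounded_linear[THEN iffD1] L)
  ultimately show ?case using DE by (auto intro: continuous_on_compose2)
next
  case (Suc k)
  then obtain f' where f': "\<And>x. x \<in> E \<Longrightarrow> (f has_derivative f' x) (at x within E)"
    and k: "\<And>v. Ck_on k E (\<lambda>x. f' x v)" by auto
  have "((\<lambda>z. f (p + L z)) has_derivative (\<lambda>v. f' (p + L z) (L v))) (at z within D)" if "z \<in> D" for z
  proof -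
    have 1: "((\<lambda>z. p + L z) has_derivative L) (at z within D)"
      using has_derivative_add[OF has_derivative_const linear_imp_has_derivative[OF L], of p] by simp
    have "(f has_derivative f' (p + L z)) (at (p + L z) within (\<lambda>z. p + L z) ` D)"
      by (rule has_derivative_subset[OF f'[OF DE[OF that]]]) (use DE in auto)
    from has_derivative_in_compose[OF 1 this] show ?thesis .
  qed
  with Suc.IH[OF k] show ?case
    unfolding Ck_on.simps by (intro exI[of _ "\<lambda>z v. f' (p + L z) (L v)"]) auto
qed

lemma dird_affine:
  fixes f :: "'v::euclidean_space \<Rightarrow> 'w::real_normed_vector" and L :: "'u::euclidean_space \<Rightarrow> 'v"
  assumes D: "cornered D" and E: "cornered E" and L: "linear L"
    and DE: "\<And>z. z \<in> D \<Longrightarrow> p + L z \<in> E" and f: "Ck_on (Suc k) E f" and z: "z \<in> D"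
  shows "dird D v (\<lambda>z. f (p + L z)) z = dird E (L v) f (p + L z)"
proof -
  have 1: "((\<lambda>z. p + L z) has_derivative L) (at z within D)"
    using has_derivative_add[OF has_derivative_const linear_imp_has_derivative[OF L], of p] by simp
  have "(f has_derivative (\<lambda>a. dird E a f (p + L z))) (at (p + L z) within (\<lambda>z. p + L z) ` D)"
    by (rule has_derivative_subset[OF Ck_on_dird(1)[OF E f DE[OF z]]]) (use DE in auto)
  from dird_eqI[OF D z has_derivative_in_compose[OF 1 this]] show ?thesis .
qed

text \<open>
  The function \<open>|g|\<^sup>2 exp (- 2 C t)\<close> is nonincreasing.
\<close>

lemma gronwall_norm:
  fixes g :: "real \<Rightarrow> 'a::real_inner"
  assumes g: "\<And>t. t \<in> {0..T} \<Longrightarrow> (g has_vector_derivative g' t) (at t within {0..T})"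
    and C: "\<And>t. t \<in> {0..T} \<Longrightarrow> norm (g' t) \<le> C * norm (g t)"
    and t: "t \<in> {0..T}"
  shows "norm (g t) \<le> exp (C * t) * norm (g 0)"
proof -
  let ?\<phi> = "\<lambda>t. (g t \<bullet> g t) * exp (- (2 * C * t))"
  have d: "(?\<phi> has_real_derivative (2 * (g s \<bullet> g' s) - 2 * C * (g s \<bullet> g s)) * exp (- (2 * C * s))) (at s within {0..T})"
    if "s \<in> {0..T}" for s
  proof -
    have g1: "(g has_derivative (\<lambda>h. h *\<^sub>R g' s)) (at s within {0..T})"
      using g[OF that] unfolding has_vector_derivative_def .
    have "((\<lambda>t. g t \<bullet> g t) has_real_derivative 2 * (g s \<bullet> g' s)) (at s within {0..T})"
      unfolding has_field_derivative_def
      by (rule has_derivative_eq_rhs[OF has_derivative_inner[OF g1 g1]])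
        (simp add: fun_eq_iff inner_commute)
    moreover have "((\<lambda>t. exp (- (2 * C * t))) has_real_derivative exp (- (2 * C * s)) * (- (2 * C))) (at s within {0..T})"
      by (auto intro!: derivative_eq_intros)
    ultimately have "(?\<phi> has_real_derivative 2 * (g s \<bullet> g' s) * exp (- (2 * C * s))
        + exp (- (2 * C * s)) * (- (2 * C)) * (g s \<bullet> g s)) (at s within {0..T})"
      by (rule DERIV_mult)
    then show ?thesis by (simp add: algebra_simps)
  qed
  have "?\<phi> t \<le> ?\<phi> 0"
  proof (rule DERIV_nonpos_imp_decreasing_open[of 0 t ?\<phi>])
    show "0 \<le> t" using t by simp
    have "continuous_on {0..T} ?\<phi>"
      using d by (rule DERIV_continuous_on)
    then show "continuous_on {0..t} ?\<phi>"
      by (rule continuous_on_subset) (use t in auto)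
    fix s assume s: "0 < s" "s < t"
    then have "s \<in> {0..T}" "at s within {0..T} = at s"
      using t by (auto intro!: at_within_interior)
    with d[of s] have "DERIV ?\<phi> s :> (2 * (g s \<bullet> g' s) - 2 * C * (g s \<bullet> g s)) * exp (- (2 * C * s))"
      by simp
    moreover have "g s \<bullet> g' s \<le> C * (g s \<bullet> g s)"
    proof -
      have "g s \<bullet> g' s \<le> norm (g s) * norm (g' s)" by (rule norm_cauchy_schwarz)
      also have "\<dots> \<le> norm (g s) * (C * norm (g s))"
        by (rule mult_left_mono[OF C]) (use \<open>s \<in> {0..T}\<close> in auto)
      finally show ?thesis by (simp add: power2_norm_eq_inner[symmetric] power2_eq_square mult_ac)
    qed
    then have "(2 * (g s \<bullet> g' s) - 2 * C * (g s \<bullet> g s)) * exp (- (2 * C * s)) \<le> 0"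
      by (intro mult_nonpos_nonneg) auto
    ultimately show "\<exists>y. DERIV ?\<phi> s :> y \<and> y \<le> 0"
      by blast
  qed
  then have "(norm (g t))\<^sup>2 \<le> exp (2 * C * t) * (norm (g 0))\<^sup>2"
  proof -
    assume "?\<phi> t \<le> ?\<phi> 0"
    then have "(norm (g t))\<^sup>2 * exp (- (2 * C * t)) * exp (2 * C * t) \<le> (norm (g 0))\<^sup>2 * exp (2 * C * t)"
      by (intro mult_right_mono) (auto simp: power2_norm_eq_inner)
    moreover have "exp (- (2 * C * t)) * exp (2 * C * t) = 1"
      by (simp add: exp_minus)
    ultimately have "(norm (g t))\<^sup>2 * 1 \<le> (norm (g 0))\<^sup>2 * exp (2 * C * t)"
      by (simp only: mult.assoc)
    then show ?thesis by (simp only: mult_1_right mult.commute)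
  qed
  also have "\<dots> = (exp (C * t) * norm (g 0))\<^sup>2"
    using exp_double[of "C * t"] by (simp add: power_mult_distrib mult.assoc)
  finally show ?thesis
    by (rule power2_le_imp_le) simp
qed

lemma linear_bound_compact:
  fixes L :: "'k::topological_space \<Rightarrow> 'a::euclidean_space \<Rightarrow> real"
  assumes K: "compact K" and L: "\<And>y. y \<in> K \<Longrightarrow> linear (L y)"
    and cont: "\<And>b. b \<in> Basis \<Longrightarrow> continuous_on K (\<lambda>y. L y b)"
  shows "\<exists>C\<ge>0. \<forall>y\<in>K. \<forall>a. \<bar>L y a\<bar> \<le> C * norm a"
proof -
  have "\<exists>c. \<forall>y\<in>K. \<bar>L y b\<bar> \<le> c" if "b \<in> Basis" for b
    using compact_imp_bounded[OF compact_continuous_image[OF cont[OF that] K]]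
    unfolding bounded_iff by auto
  then obtain c where c: "\<And>b y. b \<in> Basis \<Longrightarrow> y \<in> K \<Longrightarrow> \<bar>L y b\<bar> \<le> c b"
    by metis
  have "\<bar>L y a\<bar> \<le> (\<Sum>b\<in>Basis. \<bar>c b\<bar>) * norm a" if y: "y \<in> K" for y a
  proof -
    have "L y a = L y (\<Sum>b\<in>Basis. (a \<bullet> b) *\<^sub>R b)" by (simp add: euclidean_representation)
    also have "\<dots> = (\<Sum>b\<in>Basis. (a \<bullet> b) * L y b)"
      by (simp add: linear_sum[OF L[OF y]] linear_scale[OF L[OF y]])
    finally have "\<bar>L y a\<bar> \<le> (\<Sum>b\<in>Basis. \<bar>(a \<bullet> b) * L y b\<bar>)" by simp
    also have "\<dots> \<le> (\<Sum>b\<in>Basis. \<bar>c b\<bar> * norm a)"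
    proof (rule sum_mono)
      fix b :: 'a assume b: "b \<in> Basis"
      have "\<bar>(a \<bullet> b) * L y b\<bar> \<le> norm a * \<bar>c b\<bar>"
        unfolding abs_mult by (rule mult_mono) (use c[OF b y] Basis_le_norm[OF b, of a] in auto)
      then show "\<bar>(a \<bullet> b) * L y b\<bar> \<le> \<bar>c b\<bar> * norm a" by (simp add: mult.commute)
    qed
    finally show ?thesis by (simp add: sum_distrib_right)
  qed
  then show ?thesis by (intro exI[of _ "\<Sum>b\<in>Basis. \<bar>c b\<bar>"]) (auto intro: sum_nonneg)
qed

lemma bilinear_bound_compact:
  fixes B :: "'k::topological_space \<Rightarrow> 'a::euclidean_space \<Rightarrow> 'a \<Rightarrow> real"
  assumes K: "compact K" and B: "\<And>y x. y \<in> K \<Longrightarrow> linear (B y x)" "\<And>y x. y \<in> K \<Longrightarrow> linear (\<lambda>x'. B y x' x)"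
    and cont: "\<And>b b'. b \<in> Basis \<Longrightarrow> b' \<in> Basis \<Longrightarrow> continuous_on K (\<lambda>y. B y b b')"
  shows "\<exists>C\<ge>0. \<forall>y\<in>K. \<forall>a a'. \<bar>B y a a'\<bar> \<le> C * norm a * norm a'"
proof -
  have "\<exists>c\<ge>0. \<forall>y\<in>K. \<forall>a. \<bar>B y a b\<bar> \<le> c * norm a" if "b \<in> Basis" for b
    by (rule linear_bound_compact[OF K]) (use B cont that in auto)
  then obtain c where c: "\<And>b y a. b \<in> Basis \<Longrightarrow> y \<in> K \<Longrightarrow> \<bar>B y a b\<bar> \<le> c b * norm a" "\<And>b. b \<in> Basis \<Longrightarrow> c b \<ge> 0"
    by metis
  have "\<bar>B y a a'\<bar> \<le> (\<Sum>b\<in>Basis. c b) * norm a * norm a'" if y: "y \<in> K" for y a a'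
  proof -
    have "B y a a' = B y a (\<Sum>b\<in>Basis. (a' \<bullet> b) *\<^sub>R b)" by (simp add: euclidean_representation)
    also have "\<dots> = (\<Sum>b\<in>Basis. (a' \<bullet> b) * B y a b)"
      by (simp add: linear_sum[OF B(1)[OF y]] linear_scale[OF B(1)[OF y]])
    finally have "\<bar>B y a a'\<bar> \<le> (\<Sum>b\<in>Basis. \<bar>(a' \<bullet> b) * B y a b\<bar>)" by simp
    also have "\<dots> \<le> (\<Sum>b\<in>Basis. c b * norm a * norm a')"
    proof (rule sum_mono)
      fix b :: 'a assume b: "b \<in> Basis"
      have "\<bar>(a' \<bullet> b) * B y a b\<bar> \<le> norm a' * (c b * norm a)"
        unfolding abs_mult by (rule mult_mono) (use c(1)[OF b y, of a] Basis_le_norm[OF b, of a'] in auto)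
      then show "\<bar>(a' \<bullet> b) * B y a b\<bar> \<le> c b * norm a * norm a'" by (simp add: mult_ac)
    qed
    finally show ?thesis by (simp add: sum_distrib_right)
  qed
  then show ?thesis using c(2) by (intro exI[of _ "\<Sum>b\<in>Basis. c b"]) (auto intro: sum_nonneg)
qed

section \<open>The complex Hessian\<close>

lemma wedge_dz_dzbar:
  "wedge 1 1 (dz j) (dzbar k) v = v 0 $ j * cnj (v 1 $ k) - v 1 $ j * cnj (v 0 $ k)"
proof -
  have set: "{..<1 + 1 :: nat} = insert 0 {1}" by auto
  show ?thesis
    unfolding wedge_def set
    by (subst sum_over_permutations_insert) (auto simp: dz_def dzbar_def permutes_sing sign_swap_id)
qed

lemma vec_eq_sum_axis:
  fixes x :: "complex ^ 'm::finite"
  shows "x = (\<Sum>j\<in>UNIV. Re (x $ j) *\<^sub>R axis j 1 + Im (x $ j) *\<^sub>R axis j \<i>)"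
proof (subst vec_eq_iff, intro allI)
  fix l
  have "(\<Sum>j\<in>UNIV. Re (x $ j) *\<^sub>R axis j 1 + Im (x $ j) *\<^sub>R axis j \<i>) $ l
      = (\<Sum>j\<in>UNIV. if j = l then x $ l else 0)"
    unfolding sum_component by (intro sum.cong refl) (auto simp: axis_def complex_eq_iff)
  then show "x $ l = (\<Sum>j\<in>UNIV. Re (x $ j) *\<^sub>R axis j 1 + Im (x $ j) *\<^sub>R axis j \<i>) $ l"
    by simp
qed

lemma bilinear_axis:
  fixes B :: "complex ^ 'm::finite \<Rightarrow> complex ^ 'm \<Rightarrow> real"
  assumes l1: "\<And>y. linear (\<lambda>x. B x y)" and l2: "\<And>x. linear (B x)"
  shows "B x y = (\<Sum>j\<in>UNIV. \<Sum>k\<in>UNIV.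
      Re (x $ j) * (Re (y $ k) * B (axis j 1) (axis k 1) + Im (y $ k) * B (axis j 1) (axis k \<i>))
    + Im (x $ j) * (Re (y $ k) * B (axis j \<i>) (axis k 1) + Im (y $ k) * B (axis j \<i>) (axis k \<i>)))"
proof -
  have left: "B x y = (\<Sum>j\<in>UNIV. Re (x $ j) * B (axis j 1) y + Im (x $ j) * B (axis j \<i>) y)" for y
    by (subst vec_eq_sum_axis[of x])
      (simp add: linear_sum[OF l1] linear_add[OF l1] linear_scale[OF l1])
  have right: "B z y = (\<Sum>k\<in>UNIV. Re (y $ k) * B z (axis k 1) + Im (y $ k) * B z (axis k \<i>))" for z
    by (subst vec_eq_sum_axis[of y])
      (simp add: linear_sum[OF l2] linear_add[OF l2] linear_scale[OF l2])
  show ?thesis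
    unfolding left by (subst (1 2) right) (simp add: sum_distrib_left sum.distrib distrib_left)
qed

lemma wirtbar_of_real:
  fixes f :: "complex ^ 'm::finite \<Rightarrow> real"
  assumes D: "cornered D" and f: "Ck_on (Suc n) D f" and y: "y \<in> D"
  shows "wirtbar D k (\<lambda>y. complex_of_real (f y)) y
    = (complex_of_real (dird D (axis k 1) f y) + \<i> * complex_of_real (dird D (axis k \<i>) f y)) / 2"
proof -
  have "frechet_derivative (\<lambda>y. complex_of_real (f y)) (at y within D) = (\<lambda>a. complex_of_real (dird D a f y))"
    by (rule frechet_derivative_eqI[OF D y]) (intro has_derivative_of_real Ck_on_dird(1)[OF D f y])
  then show ?thesis by (simp add: wirtbar_def)
qed

lemma wirt_wirtbar_of_real:
  fixes f :: "complex ^ 'm::finite \<Rightarrow> real"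
  assumes D: "cornered D" and f: "Ck_on 2 D f" and z: "z \<in> D"
  shows "wirt D j (wirtbar D k (\<lambda>y. complex_of_real (f y))) z
    = (complex_of_real (dird D (axis j 1) (dird D (axis k 1) f) z + dird D (axis j \<i>) (dird D (axis k \<i>) f) z)
      + \<i> * complex_of_real (dird D (axis j 1) (dird D (axis k \<i>) f) z - dird D (axis j \<i>) (dird D (axis k 1) f) z)) / 4"
proof -
  have f2: "Ck_on (Suc (Suc 0)) D f" using f by (simp add: numeral_2_eq_2)
  let ?g = "\<lambda>y. (complex_of_real (dird D (axis k 1) f y) + \<i> * complex_of_real (dird D (axis k \<i>) f y)) / 2"
  let ?g' = "\<lambda>a. (complex_of_real (dird D a (dird D (axis k 1) f) z) + \<i> * complex_of_real (dird D a (dird D (axis k \<i>) f) z)) / 2"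
  have "(?g has_derivative ?g') (at z within D)"
    by (intro bounded_linear.has_derivative[OF bounded_linear_divide] has_derivative_add has_derivative_mult_right has_derivative_of_real
        Ck_on_dird(1)[OF D Ck_on_dird(2)[OF D f2] z])
  then have "(wirtbar D k (\<lambda>y. complex_of_real (f y)) has_derivative ?g') (at z within D)"
    by (rule has_derivative_transform[OF z, rotated]) (rule wirtbar_of_real[OF D f2])
  then have "frechet_derivative (wirtbar D k (\<lambda>y. complex_of_real (f y))) (at z within D) = ?g'"
    by (rule frechet_derivative_eqI[OF D z])
  then show ?thesis
    unfolding wirt_def by (simp add: complex_eq_iff field_simps)
qed

text \<open>
  With \<open>B\<close> the real Hessian, the coefficients of \<open>\<partial>\<partial>bar f\<close> are those of the sesquilinear form
  \<open>S(x, y) = (B x y + B (J x) (J y) + \<i> (B x (J y) - B (J x) y)) / 4\<close>. It is Hermitian because \<open>B\<close> is symmetric, and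
  so \<open>\<i> (S(x, y) - S(y, x)) = - 2 Im S(x, y)\<close>.
\<close>

lemma i_ddbar_eq_hessian:
  fixes f :: "complex ^ 'm::finite \<Rightarrow> real"
  assumes D: "cornered D" and f: "Ck_on 2 D f" and z: "z \<in> D"
  shows "\<i> * ddbar D (\<lambda>y. complex_of_real (f y)) z v =
    complex_of_real ((dird D (J (v 0)) (dird D (v 1) f) z - dird D (v 0) (dird D (J (v 1)) f) z) / 2)"
proof -
  define B where "B a b = dird D a (dird D b f) z" for a b
  define c where "c j k = wirt D j (wirtbar D k (\<lambda>y. complex_of_real (f y))) z" for j k
  have sym: "B a b = B b a" for a b
    unfolding B_def by (rule dird_commute[OF D f z])
  have lin: "linear (\<lambda>x. B x y)" "linear (B x)" for x y
    unfolding B_def using linear_dird_inner[OF D f z] by auto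
  have c: "c j k = (complex_of_real (B (axis j 1) (axis k 1) + B (axis j \<i>) (axis k \<i>))
      + \<i> * complex_of_real (B (axis j 1) (axis k \<i>) - B (axis j \<i>) (axis k 1))) / 4" for j k
    unfolding c_def B_def by (rule wirt_wirtbar_of_real[OF D f z])
  have Re_c: "Re (c j k) = (B (axis j 1) (axis k 1) + B (axis j \<i>) (axis k \<i>)) / 4"
    and Im_c: "Im (c j k) = (B (axis j 1) (axis k \<i>) - B (axis j \<i>) (axis k 1)) / 4" for j k
    unfolding c by simp_all
  have c_sym: "c k j = cnj (c j k)" for j k
    unfolding complex_eq_iff cnj.sel Re_c Im_c
      sym[of "axis k 1" "axis j 1"] sym[of "axis k 1" "axis j \<i>"]
      sym[of "axis k \<i>" "axis j 1"] sym[of "axis k \<i>" "axis j \<i>"]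
    by (intro conjI refl) (simp only: minus_divide_left minus_diff_eq)
  let ?x = "v 0" and ?y = "v 1"
  define S where "S = (\<Sum>j\<in>UNIV. \<Sum>k\<in>UNIV. c j k * (?x $ j * cnj (?y $ k)))"
  have "ddbar D (\<lambda>y. complex_of_real (f y)) z v
      = S - (\<Sum>j\<in>UNIV. \<Sum>k\<in>UNIV. c j k * (?y $ j * cnj (?x $ k)))"
    unfolding ddbar_def wedge_dz_dzbar c_def[symmetric] S_def
    by (simp add: right_diff_distrib sum_subtractf)
  also have "(\<Sum>j\<in>UNIV. \<Sum>k\<in>UNIV. c j k * (?y $ j * cnj (?x $ k)))
      = (\<Sum>j\<in>UNIV. \<Sum>k\<in>UNIV. c k j * (?y $ k * cnj (?x $ j)))"
    by (rule sum.swap)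
  also have "\<dots> = cnj S"
    unfolding S_def cnj_sum
  proof (intro sum.cong refl)
    fix j k
    show "c k j * (?y $ k * cnj (?x $ j)) = cnj (c j k * (?x $ j * cnj (?y $ k)))"
      unfolding c_sym[of k j] by (simp add: mult_ac)
  qed
  finally have "\<i> * ddbar D (\<lambda>y. complex_of_real (f y)) z v = complex_of_real (- 2 * Im S)"
    by (simp add: complex_eq_iff)
  moreover have "- 2 * Im S = (B (J ?x) ?y - B ?x (J ?y)) / 2"
  proof -
    have key: "((0 * a - 1 * b) * (r * B11 + s * B12) + (0 * b + 1 * a) * (r * B21 + s * B22)
        - (a * ((0 * r - 1 * s) * B11 + (0 * s + 1 * r) * B12) + b * ((0 * r - 1 * s) * B21 + (0 * s + 1 * r) * B22))) / 2
      = - 2 * ((B11 + B22) / 4 * (a * - s + b * r) + (B12 - B21) / 4 * (a * r - b * - s))"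
      for a b r s B11 B12 B21 B22 :: real
      by (simp add: field_simps)
    have "(B (J ?x) ?y - B ?x (J ?y)) / 2 = (\<Sum>j\<in>UNIV. \<Sum>k\<in>UNIV. - 2 * Im (c j k * (?x $ j * cnj (?y $ k))))"
      unfolding bilinear_axis[OF lin, of "J ?x" ?y] bilinear_axis[OF lin, of ?x "J ?y"]
        sum_subtractf[symmetric] sum_divide_distrib
    proof (intro sum.cong refl)
      fix j k
      show "(Re ((J ?x) $ j) * (Re (?y $ k) * B (axis j 1) (axis k 1) + Im (?y $ k) * B (axis j 1) (axis k \<i>))
          + Im ((J ?x) $ j) * (Re (?y $ k) * B (axis j \<i>) (axis k 1) + Im (?y $ k) * B (axis j \<i>) (axis k \<i>))
          - (Re (?x $ j) * (Re ((J ?y) $ k) * B (axis j 1) (axis k 1) + Im ((J ?y) $ k) * B (axis j 1) (axis k \<i>))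
          + Im (?x $ j) * (Re ((J ?y) $ k) * B (axis j \<i>) (axis k 1) + Im ((J ?y) $ k) * B (axis j \<i>) (axis k \<i>)))) / 2
        = - 2 * Im (c j k * (?x $ j * cnj (?y $ k)))"
        unfolding vector_smult_component times_complex.sel cnj.sel imaginary_unit.sel Re_c Im_c
        by (rule key)
    qed
    then show ?thesis by (simp add: S_def sum_distrib_left)
  qed
  ultimately show ?thesis unfolding B_def by (simp only:)
qed

section \<open>The form over the strip, in a chart\<close>

definition strip_dom :: "(complex ^ 'n::finite) set \<Rightarrow> (complex ^ 'n option) set" where
  "strip_dom D = {w. Im (w $ None) \<in> {0..1} \<and> proj_X w \<in> D}"

text \<open>
  The point of the strip with \<open>Re s = 0\<close> over \<open>z\<close> at time \<open>t\<close>.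
\<close>

definition emb :: "real \<Rightarrow> complex ^ 'n::finite \<Rightarrow> complex ^ 'n option" where
  "emb t z = t *\<^sub>R J es + vert z"

lemma linear_proj: "linear proj_X"
  by (rule linearI) (auto simp: proj_X_def vec_eq_iff)

lemma proj_J: "proj_X (J w) = J (proj_X w)"
  by (simp add: proj_X_def vec_eq_iff)

lemma proj_emb [simp]: "proj_X (emb t z) = z" and emb_None: "emb t z $ None = \<i> * complex_of_real t"
  by (simp_all add: emb_def proj_X_def vec_eq_iff complex_eq_iff)

lemma emb_in_strip: "emb t z \<in> strip_dom D \<longleftrightarrow> t \<in> {0..1} \<and> z \<in> D"
  by (simp add: strip_dom_def emb_None)

lemma emb_add: "emb t (z + s *\<^sub>R v) = emb t z + s *\<^sub>R vert v"
  by (simp add: emb_def vert_add vert_scale)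

lemma norm_J: "norm (J x) = norm x"
  by (simp add: norm_vec_def norm_mult)

text \<open>
  The direction of \<open>Im s\<close> has to point towards the middle line of the strip: this is what the signs are for.
\<close>

lemma cornered_strip_dom:
  assumes "open D"
  shows "cornered (strip_dom D)"
  unfolding cornered_def
proof (intro ballI allI)
  fix w a b :: "complex ^ 'a option"
  assume w: "w \<in> strip_dom D"
  then have pw: "proj_X w \<in> D" and Iw: "Im (w $ None) \<in> {0..1}" by (auto simp: strip_dom_def)
  from open_parallelogram[OF assms pw, of "proj_X a" "proj_X b"] obtain h where h: "h > 0"
    "\<And>s t. \<bar>s\<bar> \<le> h \<Longrightarrow> \<bar>t\<bar> \<le> h \<Longrightarrow> proj_X w + s *\<^sub>R proj_X a + t *\<^sub>R proj_X b \<in> D" by blast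
  \<comment> \<open>\<open>e\<close> is the sign of the direction in which \<open>Im s\<close> can move by up to one half\<close>
  define e :: real where "e = (if Im (w $ None) \<le> 1 / 2 then 1 else - 1)"
  have scale: "\<exists>\<sigma>. \<sigma> \<noteq> 0 \<and> \<bar>\<sigma>\<bar> \<le> h \<and> 0 \<le> e * (\<sigma> * y) \<and> e * (\<sigma> * y) \<le> 1 / 4" for y :: real
  proof -
    define k where "k = min h (1 / (4 * (\<bar>y\<bar> + 1)))"
    have k: "k > 0" "k \<le> h" using h(1) by (auto simp: k_def)
    have "k * \<bar>y\<bar> \<le> 1 / (4 * (\<bar>y\<bar> + 1)) * \<bar>y\<bar>" by (intro mult_right_mono) (auto simp: k_def)
    also have "\<dots> \<le> 1 / 4" by (simp add: field_simps)
    finally have ky: "k * \<bar>y\<bar> \<le> 1 / 4" .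
    have e: "e = 1 \<or> e = -1" by (simp add: e_def)
    define \<sigma> where "\<sigma> = e * (if y \<ge> 0 then k else - k)"
    have "e * (\<sigma> * y) = k * \<bar>y\<bar>" using e by (auto simp: \<sigma>_def)
    moreover have "\<sigma> \<noteq> 0" "\<bar>\<sigma>\<bar> \<le> h" using e k by (auto simp: \<sigma>_def)
    ultimately show ?thesis using ky k(1) by (intro exI[of _ \<sigma>]) auto
  qed
  obtain \<sigma> where \<sigma>: "\<sigma> \<noteq> 0" "\<bar>\<sigma>\<bar> \<le> h" "0 \<le> e * (\<sigma> * Im (a $ None))" "e * (\<sigma> * Im (a $ None)) \<le> 1 / 4"
    using scale by blast
  obtain \<tau> where \<tau>: "\<tau> \<noteq> 0" "\<bar>\<tau>\<bar> \<le> h" "0 \<le> e * (\<tau> * Im (b $ None))" "e * (\<tau> * Im (b $ None)) \<le> 1 / 4"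
    using scale by blast
  have "w + s *\<^sub>R (\<sigma> *\<^sub>R a) + t *\<^sub>R (\<tau> *\<^sub>R b) \<in> strip_dom D" if s: "s \<in> {0..1}" and t: "t \<in> {0..1}" for s t
  proof -
    have "\<bar>s * \<sigma>\<bar> \<le> h" "\<bar>t * \<tau>\<bar> \<le> h"
      using mult_mono[of "\<bar>s\<bar>" 1 "\<bar>\<sigma>\<bar>" h] mult_mono[of "\<bar>t\<bar>" 1 "\<bar>\<tau>\<bar>" h] s t \<sigma> \<tau>
      by (auto simp: abs_mult)
    from h(2)[OF this] have 1: "proj_X (w + s *\<^sub>R (\<sigma> *\<^sub>R a) + t *\<^sub>R (\<tau> *\<^sub>R b)) \<in> D"
      by (simp add: linear_add[OF linear_proj] linear_scale[OF linear_proj])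
    have frac: "0 \<le> c * x \<and> c * x \<le> 1 / 4" if "c \<in> {0..1}" "0 \<le> x" "x \<le> 1 / 4" for c x :: real
      using that mult_mono[of c 1 x "1/4"] by auto
    have eq: "e * (s * (\<sigma> * Im (a $ None))) = s * (e * (\<sigma> * Im (a $ None)))"
      "e * (t * (\<tau> * Im (b $ None))) = t * (e * (\<tau> * Im (b $ None)))" by simp_all
    from frac[OF s \<sigma>(3,4)] frac[OF t \<tau>(3,4)]
    have st: "0 \<le> e * (s * (\<sigma> * Im (a $ None)))" "e * (s * (\<sigma> * Im (a $ None))) \<le> 1 / 4"
      "0 \<le> e * (t * (\<tau> * Im (b $ None)))" "e * (t * (\<tau> * Im (b $ None))) \<le> 1 / 4"
      unfolding eq by blast+
    have "Im (w $ None) + s * (\<sigma> * Im (a $ None)) + t * (\<tau> * Im (b $ None)) \<in> {0..1}"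
    proof (cases "Im (w $ None) \<le> 1 / 2")
      case True
      then show ?thesis using st Iw by (simp add: e_def)
    next
      case False
      then show ?thesis using st Iw by (simp add: e_def)
    qed
    with 1 show ?thesis by (simp add: strip_dom_def)
  qed
  then show "\<exists>\<sigma> \<tau>::real. \<sigma> \<noteq> 0 \<and> \<tau> \<noteq> 0 \<and>
      (\<forall>s\<in>{0..1}. \<forall>t\<in>{0..1}. w + s *\<^sub>R (\<sigma> *\<^sub>R a) + t *\<^sub>R (\<tau> *\<^sub>R b) \<in> strip_dom D)"
    using \<sigma>(1) \<tau>(1) by blast
qed

text \<open>
  The geometry over the coordinate domain \<open>D\<close> of a chart of \<open>X\<close>: \<open>F\<close> is the potential \<open>u\<close> in the coordinates of
  \<open>strip_dom D\<close>, and \<open>\<omega>\<close> is the Kaehler form of \<open>X\<close>.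
\<close>

locale strip_potential =
  fixes D :: "(complex ^ 'n::finite) set" and F :: "complex ^ 'n option \<Rightarrow> real"
    and \<omega> :: "complex ^ 'n \<Rightarrow> complex ^ 'n \<Rightarrow> complex ^ 'n \<Rightarrow> real"
  assumes open_D: "open D" and F: "Ck_on 3 (strip_dom D) F"
    and inv: "\<And>w r. w \<in> strip_dom D \<Longrightarrow> F (w + r *\<^sub>R es) = F w"
    and \<omega>_J: "\<And>z. z \<in> D \<Longrightarrow> J_form (\<omega> z)"
    and \<omega>_C1: "\<And>x y. Ck_on 1 D (\<lambda>z. \<omega> z x y)"
begin

abbreviation E where "E \<equiv> strip_dom D"

definition hess :: "complex ^ 'n option \<Rightarrow> complex ^ 'n option \<Rightarrow> complex ^ 'n option \<Rightarrow> real" where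
  "hess w a b = dird E a (dird E b F) w"

text \<open>
  The form \<open>\<omega> + \<i> \<partial>\<partial>bar F\<close>, written with the real Hessian as in \<open>i_ddbar_eq_hessian\<close>.
\<close>

definition \<Omega> :: "complex ^ 'n option \<Rightarrow> complex ^ 'n option \<Rightarrow> complex ^ 'n option \<Rightarrow> real" where
  "\<Omega> w x y = \<omega> (proj_X w) (proj_X x) (proj_X y) + (hess w (J x) y - hess w x (J y)) / 2"

definition Ft :: "complex ^ 'n option \<Rightarrow> real" where
  "Ft = dird E (J es) F"

definition grad_vel :: "real \<Rightarrow> complex ^ 'n \<Rightarrow> complex ^ 'n" where
  "grad_vel t z = (\<Sum>b\<in>Basis. dird E (vert b) Ft (emb t z) *\<^sub>R b)"

lemma E: "cornered E" by (rule cornered_strip_dom[OF open_D])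

lemma D: "cornered D" by (rule cornered_open[OF open_D])

lemma F3: "Ck_on (Suc (Suc (Suc 0))) E F" using F by (simp add: numeral_3_eq_3)

lemma F2: "Ck_on 2 E F" by (rule Ck_on_le[OF F]) simp

lemma Ck_on_dird_F: "Ck_on 2 E (dird E a F)"
  using Ck_on_dird(2)[OF E F3, of a] by (simp only: numeral_2_eq_2)

lemma Ft2: "Ck_on 2 E Ft" unfolding Ft_def by (rule Ck_on_dird_F)

lemma Ck_on_dird_dird_F: "Ck_on (Suc 0) E (dird E a (dird E b F))"
  using Ck_on_dird(2)[OF E, of "Suc 0" "dird E b F"] Ck_on_dird_F[of b] by (simp only: numeral_2_eq_2)

lemma dird_commute_F: "w \<in> E \<Longrightarrow> dird E a (dird E b F) w = dird E b (dird E a F) w"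
  by (rule dird_commute[OF E F2])

lemma hess_sym: "w \<in> E \<Longrightarrow> hess w a b = hess w b a"
  unfolding hess_def by (rule dird_commute_F)

lemma hess_linear: assumes "w \<in> E" shows "linear (\<lambda>a. hess w a b)" "linear (hess w a)"
  unfolding hess_def using linear_dird_inner[OF E F2 assms] by auto

lemmas hess_add = linear_add[OF hess_linear(1)] linear_add[OF hess_linear(2)]
  and hess_scale = linear_scale[OF hess_linear(1)] linear_scale[OF hess_linear(2)]
  and hess_neg = linear_neg[OF hess_linear(1)] linear_neg[OF hess_linear(2)]

lemma dird_es_F: assumes w: "w \<in> E" shows "dird E es F w = 0"
proof -
  have l: "w + s *\<^sub>R es \<in> E" for s
  proof -
    have "proj_X (w + s *\<^sub>R es) = proj_X w"
      by (simp add: linear_add[OF linear_proj] linear_scale[OF linear_proj])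
    then show ?thesis using w by (simp add: strip_dom_def)
  qed
  have "((\<lambda>s. F (w + s *\<^sub>R es)) has_vector_derivative dird E es F (w + 0 *\<^sub>R es)) (at 0 within UNIV)"
    by (rule has_vector_derivative_along_line[OF E F3]) (use l in auto)
  then have "((\<lambda>s::real. F w) has_vector_derivative dird E es F w) (at 0)"
    using inv[OF w] by simp
  from vector_derivative_at[OF this] show ?thesis by simp
qed

text \<open>
  This is the translation invariance of \<open>F\<close> in the direction \<open>es\<close>.
\<close>

lemma hess_es: assumes w: "w \<in> E" shows "hess w x es = 0" "hess w es x = 0"
proof -
  have "hess w x es = dird E x (\<lambda>_. 0) w"
    unfolding hess_def by (rule dird_cong[OF dird_es_F w])
  also have "\<dots> = 0" by (rule dird_eqI[OF E w has_derivative_const])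
  finally show "hess w x es = 0" .
  then show "hess w es x = 0" using hess_sym[OF w] by simp
qed

lemma E_proj: "w \<in> E \<Longrightarrow> proj_X w \<in> D" by (simp add: strip_dom_def)

lemma J_form_\<Omega>: assumes w: "w \<in> E" shows "J_form (\<Omega> w)"
  unfolding J_form_def
proof (intro conjI allI)
  note lo = J_formD[OF \<omega>_J[OF E_proj[OF w]]]
  note S = J_form_simps[OF \<omega>_J[OF E_proj[OF w]]]
  note lp = linear_add[OF linear_proj] linear_scale[OF linear_proj]
  show "linear (\<lambda>x. \<Omega> w x y)" for y
    by (rule linearI) (simp_all add: \<Omega>_def lp S(1,3) J_add J_scale hess_add[OF w] hess_scale[OF w] algebra_simps add_divide_distrib diff_divide_distrib)
  show "linear (\<Omega> w x)" for x
    by (rule linearI) (simp_all add: \<Omega>_def lp S(2,4) J_add J_scale hess_add[OF w] hess_scale[OF w] algebra_simps add_divide_distrib diff_divide_distrib)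
  show "\<Omega> w x y = - \<Omega> w y x" for x y
    unfolding \<Omega>_def using lo(3)[of "proj_X x" "proj_X y"] hess_sym[OF w, of "J x" y] hess_sym[OF w, of x "J y"] by argo
  show "\<Omega> w (J x) (J y) = \<Omega> w x y" for x y
    unfolding \<Omega>_def proj_J lo(4) J_J hess_neg[OF w] by simp
qed

text \<open>
  The quadratic form of the metric that \<open>\<Omega>\<close> induces on the fibre over time \<open>t\<close>, at the point \<open>z\<close>.
\<close>

definition fibre_form :: "real \<Rightarrow> complex ^ 'n \<Rightarrow> complex ^ 'n \<Rightarrow> real" where
  "fibre_form t z \<eta> = \<Omega> (emb t z) (vert \<eta>) (J (vert \<eta>))"

lemma grad_vel_inner: assumes t: "t \<in> {0..1}" and z: "z \<in> D"
  shows "grad_vel t z \<bullet> v = dird E (vert v) Ft (emb t z)"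
proof -
  have "linear (\<lambda>v. dird E (vert v) Ft (emb t z))"
    using linear_compose[OF linear_vert linear_dird[OF E, of "Suc 0" Ft "emb t z"]] Ft2 t z
    by (simp add: o_def emb_in_strip numeral_2_eq_2 del: Ck_on.simps)
  note L = this
  have "dird E (vert v) Ft (emb t z) = (\<Sum>b\<in>Basis. (v \<bullet> b) * dird E (vert b) Ft (emb t z))"
    using linear_sum[OF L, of "\<lambda>b. (v \<bullet> b) *\<^sub>R b" Basis] linear_scale[OF L]
    by (simp add: euclidean_representation)
  also have "\<dots> = grad_vel t z \<bullet> v"
    unfolding grad_vel_def inner_sum_left by (intro sum.cong refl) (simp add: inner_commute)
  finally show ?thesis by simp
qed

lemma hess_vert_Jes: assumes t: "t \<in> {0..1}" and z: "z \<in> D"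
  shows "hess (emb t z) (vert v) (J es) = grad_vel t z \<bullet> v"
  unfolding grad_vel_inner[OF assms] hess_def Ft_def ..

text \<open>
  By translation invariance the only mixed second derivatives in \<open>\<Omega>\<close> are those of the velocity along the fibre.
\<close>

lemma \<Omega>_es_vert: assumes t: "t \<in> {0..1}" and z: "z \<in> D"
  shows "\<Omega> (emb t z) es (vert v) = (grad_vel t z \<bullet> v) / 2"
proof -
  have w: "emb t z \<in> E" using assms by (simp add: emb_in_strip)
  show ?thesis
    using hess_sym[OF w, of "J es" "vert v"] hess_vert_Jes[OF assms] J_form_simps(7)[OF \<omega>_J[OF z]]
    by (simp add: \<Omega>_def hess_es[OF w])
qed

lemma \<Omega>_es_Jes: assumes "t \<in> {0..1}" and "z \<in> D"
  shows "\<Omega> (emb t z) es (J es) = hess (emb t z) (J es) (J es) / 2"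
proof -
  have w: "emb t z \<in> E" using assms by (simp add: emb_in_strip)
  show ?thesis
    using J_form_simps(7)[OF \<omega>_J[OF assms(2)]] by (simp add: \<Omega>_def hess_es[OF w] hess_neg[OF w] )
qed

lemma \<Omega>_quadratic: assumes t: "t \<in> {0..1}" and z: "z \<in> D"
  shows "\<Omega> (emb t z) (es + vert \<xi>) (J (es + vert \<xi>)) =
    \<omega> z \<xi> (J \<xi>) + dird E (J es) Ft (emb t z) / 2 + dird E (vert (J \<xi>)) Ft (emb t z)
    + dird E (vert (J \<xi>)) (dird E (vert (J \<xi>)) F) (emb t z) / 2 + dird E (vert \<xi>) (dird E (vert \<xi>) F) (emb t z) / 2"
proof -
  have w: "emb t z \<in> E" using assms by (simp add: emb_in_strip)
  have p: "proj_X (es + vert \<xi>) = \<xi>" "proj_X (J (es + vert \<xi>)) = J \<xi>"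
    by (simp_all only: proj_J linear_add[OF linear_proj] proj_vert add_0)
  have "\<Omega> (emb t z) (es + vert \<xi>) (J (es + vert \<xi>)) = \<omega> z \<xi> (J \<xi>)
    + (hess (emb t z) (J (es + vert \<xi>)) (J (es + vert \<xi>)) + hess (emb t z) (es + vert \<xi>) (es + vert \<xi>)) / 2"
    unfolding \<Omega>_def p proj_emb J_J hess_neg(2)[OF w] by simp
  also have "\<dots> = \<omega> z \<xi> (J \<xi>) + (hess (emb t z) (J es) (J es) + 2 * hess (emb t z) (vert (J \<xi>)) (J es)
     + hess (emb t z) (vert (J \<xi>)) (vert (J \<xi>)) + hess (emb t z) (vert \<xi>) (vert \<xi>)) / 2"
    using hess_sym[OF w, of "J es" "vert (J \<xi>)"]
    by (simp add: J_add vert_J[symmetric] hess_add[OF w] hess_es[OF w])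
  finally show ?thesis unfolding hess_def Ft_def by (simp add: add_divide_distrib)
qed

lemma fibre_form_linear: assumes t: "t \<in> {0..1}" and z: "z \<in> D"
  shows "linear (\<lambda>x. \<Omega> (emb t z) (vert x) (J (vert y)))" "linear (\<lambda>y. \<Omega> (emb t z) (vert x) (J (vert y)))"
proof -
  have w: "emb t z \<in> E" using assms by (simp add: emb_in_strip)
  note S = J_form_simps[OF J_form_\<Omega>[OF w]]
  show "linear (\<lambda>x. \<Omega> (emb t z) (vert x) (J (vert y)))" "linear (\<lambda>y. \<Omega> (emb t z) (vert x) (J (vert y)))"
    by (rule linearI; simp add: vert_add vert_scale J_add J_scale S(1-4))+
qed

lemma fibre_form_scale: assumes "t \<in> {0..1}" "z \<in> D" shows "fibre_form t z (r *\<^sub>R \<eta>) = r\<^sup>2 * fibre_form t z \<eta>"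
  unfolding fibre_form_def using linear_scale[OF fibre_form_linear(1)[OF assms]] linear_scale[OF fibre_form_linear(2)[OF assms]]
  by (simp add: power2_eq_square)

lemma continuous_emb: "continuous_on S (\<lambda>p. emb (fst p) (snd p))"
  unfolding emb_def
  by (intro continuous_intros linear_continuous_on_compose[OF _ linear_vert])

lemma continuous_on_emb: assumes "continuous_on E f"
  shows "continuous_on ({0..1} \<times> D) (\<lambda>p. f (emb (fst p) (snd p)))"
  by (rule continuous_on_compose2[OF assms continuous_emb]) (auto simp: emb_in_strip)

lemma continuous_\<Omega>: "continuous_on ({0..1} \<times> D) (\<lambda>p. \<Omega> (emb (fst p) (snd p)) x y)"
proof -
  have "continuous_on E (\<lambda>w. hess w a b)" for a b
    unfolding hess_def by (rule Ck_on_imp_continuous[OF Ck_on_dird_dird_F])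
  note hess = continuous_on_emb[OF this]
  have "continuous_on ({0..1} \<times> D) (\<lambda>p. \<omega> (snd p) a b)" for a b
    by (rule continuous_on_compose2[OF Ck_on_imp_continuous[OF \<omega>_C1]]) (auto intro: continuous_intros)
  then show ?thesis unfolding \<Omega>_def by (simp, intro continuous_intros hess) auto
qed

lemma fibre_form_expand: assumes t: "t \<in> {0..1}" and z: "z \<in> D"
  shows "fibre_form t z \<eta> = (\<Sum>b\<in>Basis. \<Sum>b'\<in>Basis. (\<eta> \<bullet> b) * (\<eta> \<bullet> b') * \<Omega> (emb t z) (vert b) (J (vert b')))"
proof -
  let ?G = "\<lambda>x y. \<Omega> (emb t z) (vert x) (J (vert y))"
  have l1: "linear (\<lambda>x. ?G x y)" and l2: "linear (?G x)" for x y
    using fibre_form_linear[OF assms] by auto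
  have right: "?G x \<eta> = (\<Sum>b'\<in>Basis. (\<eta> \<bullet> b') * ?G x b')" for x
    using linear_sum[OF l2[of x], of "\<lambda>b. (\<eta> \<bullet> b) *\<^sub>R b" Basis] linear_scale[OF l2]
    by (simp add: euclidean_representation)
  have left: "?G \<eta> y = (\<Sum>b\<in>Basis. (\<eta> \<bullet> b) * ?G b y)" for y
    using linear_sum[OF l1[of y], of "\<lambda>b. (\<eta> \<bullet> b) *\<^sub>R b" Basis] linear_scale[OF l1]
    by (simp add: euclidean_representation)
  show ?thesis
    unfolding fibre_form_def by (subst left) (simp only: right sum_distrib_left mult.assoc)
qed

lemma continuous_fibre_form: "continuous_on (({0..1} \<times> D) \<times> UNIV) (\<lambda>q. fibre_form (fst (fst q)) (snd (fst q)) (snd q))"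
proof -
  have "continuous_on (({0..1} \<times> D) \<times> UNIV) (\<lambda>q. \<Omega> (emb (fst (fst q)) (snd (fst q))) x y)" for x y
    by (rule continuous_on_compose2[OF continuous_\<Omega>, of _ fst x y]) (auto intro: continuous_intros)
  then have "continuous_on (({0..1} \<times> D) \<times> UNIV) (\<lambda>q. \<Sum>b\<in>Basis. \<Sum>b'\<in>Basis.
    (snd q \<bullet> b) * (snd q \<bullet> b') * \<Omega> (emb (fst (fst q)) (snd (fst q))) (vert b) (J (vert b')))"
    by (intro continuous_on_sum continuous_on_mult continuous_on_inner continuous_on_snd continuous_on_id continuous_on_const)
  then show ?thesis
    by (rule continuous_on_eq) (simp only: mem_Times_iff fibre_form_expand)
qed

end

section \<open>The estimate for the fibre gradient of the velocity\<close>

context strip_potential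
begin

lemma emb_E: "t \<in> {0..1} \<Longrightarrow> z \<in> D \<Longrightarrow> emb t z \<in> E"
  by (simp add: emb_in_strip)

lemma J_form_emb: "t \<in> {0..1} \<Longrightarrow> z \<in> D \<Longrightarrow> J_form (\<Omega> (emb t z))"
  by (rule J_form_\<Omega>[OF emb_E])

text \<open>
  Pairing the kernel vector with \<open>J \<xi>\<close>. It bounds \<open>\<xi>\<close> by the gradient of the velocity once the fibre is
  positive.
\<close>

lemma fibre_form_kernel:
  assumes t: "t \<in> {0..1}" and z: "z \<in> D" and \<xi>: "\<And>w. \<Omega> (emb t z) (es + vert \<xi>) w = 0"
  shows "fibre_form t z \<xi> = - (grad_vel t z \<bullet> J \<xi>) / 2"
proof -
  have "\<Omega> (emb t z) es (vert (J \<xi>)) + \<Omega> (emb t z) (vert \<xi>) (vert (J \<xi>)) = 0"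
    using \<xi>[of "vert (J \<xi>)"] J_form_simps(1)[OF J_form_emb[OF t z]] by simp
  then show ?thesis
    unfolding fibre_form_def vert_J[symmetric] \<Omega>_es_vert[OF t z] by simp
qed

text \<open>
  Modulo the complex line of the kernel vector, every vector is tangent to the fibre.
\<close>

lemma form_nonneg:
  assumes t: "t \<in> {0..1}" and z: "z \<in> D" and \<xi>: "\<And>w. \<Omega> (emb t z) (es + vert \<xi>) w = 0"
    and pos: "\<And>\<eta>. \<eta> \<noteq> 0 \<Longrightarrow> fibre_form t z \<eta> > 0"
  shows "\<Omega> (emb t z) x (J x) \<ge> 0"
proof -
  let ?B = "\<Omega> (emb t z)" and ?z = "es + vert \<xi>"
  note B = J_form_emb[OF t z]
  note S = J_form_simps[OF B]
  have Jz: "?B (J ?z) w = 0" for w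
    unfolding S(10)[of ?z w] \<xi>[of "J w"] by simp
  have k1: "?B (c *s ?z) w = 0" for c w
  proof -
    have "?B (c *s ?z) w = ?B (Re c *\<^sub>R ?z) w + ?B (Im c *\<^sub>R J ?z) w"
      unfolding smult_eq_real[of c ?z] by (rule S(1))
    then show ?thesis unfolding S(3) \<xi> Jz by simp
  qed
  then have k2: "?B w (c *s ?z) = 0" for c w
    unfolding J_formD(3)[OF B, of w "c *s ?z"] by simp
  note k = k1 k2
  define \<eta> where "\<eta> = proj_X x - (x $ None) *s \<xi>"
  have x: "x = (x $ None) *s ?z + vert \<eta>"
    by (rule option_vec_eqI) (auto simp: proj_X_def \<eta>_def)
  have Jx: "J x = (\<i> * (x $ None)) *s ?z + J (vert \<eta>)"
    by (subst x) (simp only: vector_add_ldistrib vector_smult_assoc)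
  have "?B x (J x) = ?B (vert \<eta>) (J x)"
    by (subst (1) x) (simp only: S(1) k add_0)
  also have "\<dots> = fibre_form t z \<eta>"
    unfolding Jx fibre_form_def by (simp only: S(2) k add_0)
  also have "\<dots> \<ge> 0"
    using pos[of \<eta>] S(7) by (cases "\<eta> = 0") (auto simp: fibre_form_def vert_0)
  finally show ?thesis .
qed

text \<open>
  The vector \<open>es + vert \<xi>\<close> is kept fixed while the point moves along the fibre in the direction \<open>v\<close>. The function
  obtained from \<open>\<Omega>_quadratic\<close> is nonnegative and vanishes at \<open>z\<close>, so its derivative is zero there. Solving
  for the derivative of \<open>u\<^sub>t\<^sub>t\<close> leaves terms that are at least linear in \<open>\<xi>\<close>.
\<close>

lemma Ft_second_derivative:
  assumes t: "t \<in> {0..1}" and U: "open U" "U \<subseteq> D" and z: "z \<in> U"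
    and \<xi>: "\<And>w. \<Omega> (emb t z) (es + vert \<xi>) w = 0"
    and nonneg: "\<And>y. y \<in> U \<Longrightarrow> \<Omega> (emb t y) (es + vert \<xi>) (J (es + vert \<xi>)) \<ge> 0"
  shows "dird E (vert v) (dird E (J es) Ft) (emb t z) = - 2 * (dird D v (\<lambda>z. \<omega> z \<xi> (J \<xi>)) z
    + dird E (vert v) (dird E (vert (J \<xi>)) Ft) (emb t z)
    + dird E (vert v) (dird E (vert (J \<xi>)) (dird E (vert (J \<xi>)) F)) (emb t z) / 2
    + dird E (vert v) (dird E (vert \<xi>) (dird E (vert \<xi>) F)) (emb t z) / 2)"
proof -
  obtain h where h: "h > 0" "\<And>s t. \<bar>s\<bar> \<le> h \<Longrightarrow> \<bar>t\<bar> \<le> h \<Longrightarrow> z + s *\<^sub>R v + t *\<^sub>R v \<in> U"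
    using open_parallelogram[OF U(1) z, of v v] by blast
  have inU: "z + s *\<^sub>R v \<in> U" if "s \<in> {-h<..<h}" for s
    using h(2)[of s 0] that h(1) by auto
  then have inD: "z + s *\<^sub>R v \<in> D" if "s \<in> {-h<..<h}" for s using U(2) that by blast
  have inE: "emb t z + s *\<^sub>R vert v \<in> E" if "s \<in> {-h<..<h}" for s
    using emb_E[OF t inD[OF that]] by (simp add: emb_add)
  have 0: "0 \<in> {-h<..<h}" using h(1) by simp
  have at0: "at 0 within {-h<..<h} = at 0"
    by (rule at_within_open[OF 0]) simp
  have lineE: "((\<lambda>s. f (emb t (z + s *\<^sub>R v))) has_real_derivative dird E (vert v) f (emb t z)) (at 0)"
    if f: "Ck_on (Suc 0) E f" for f :: "complex ^ 'n option \<Rightarrow> real"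
    using has_vector_derivative_along_line[OF E f inE 0]
    by (simp add: at0 emb_add has_real_derivative_iff_has_vector_derivative)
  have lineD: "((\<lambda>s. f (z + s *\<^sub>R v)) has_real_derivative dird D v f z) (at 0)"
    if f: "Ck_on (Suc 0) D f" for f :: "complex ^ 'n \<Rightarrow> real"
    using has_vector_derivative_along_line[OF D f inD 0]
    by (simp add: at0 has_real_derivative_iff_has_vector_derivative)
  define \<phi> where "\<phi> s = \<Omega> (emb t (z + s *\<^sub>R v)) (es + vert \<xi>) (J (es + vert \<xi>))" for s
  define \<psi> where "\<psi> s = (let w = emb t (z + s *\<^sub>R v) in
      \<omega> (z + s *\<^sub>R v) \<xi> (J \<xi>) + dird E (J es) Ft w / 2 + dird E (vert (J \<xi>)) Ft w
    + dird E (vert (J \<xi>)) (dird E (vert (J \<xi>)) F) w / 2 + dird E (vert \<xi>) (dird E (vert \<xi>) F) w / 2)" for s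
  let ?l = "dird D v (\<lambda>z. \<omega> z \<xi> (J \<xi>)) z + dird E (vert v) (dird E (J es) Ft) (emb t z) / 2
    + dird E (vert v) (dird E (vert (J \<xi>)) Ft) (emb t z)
    + dird E (vert v) (dird E (vert (J \<xi>)) (dird E (vert (J \<xi>)) F)) (emb t z) / 2
    + dird E (vert v) (dird E (vert \<xi>) (dird E (vert \<xi>) F)) (emb t z) / 2"
  have "(\<psi> has_real_derivative ?l) (at 0)"
    unfolding \<psi>_def Let_def
    using \<omega>_C1[of \<xi> "J \<xi>"] Ck_on_dird_dird_F[of "J es" "J es"] Ck_on_dird_dird_F[of "vert (J \<xi>)" "J es"]
    by (intro DERIV_add DERIV_cdivide lineE lineD Ck_on_dird_dird_F) (simp_all only: Ft_def One_nat_def)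
  moreover have "\<phi> s = \<psi> s" if "s \<in> {-h<..<h}" for s
    unfolding \<phi>_def \<psi>_def Let_def by (rule \<Omega>_quadratic[OF t inD[OF that]])
  ultimately have "(\<phi> has_real_derivative ?l) (at 0)"
    using has_field_derivative_transform_within_open[of \<psi> ?l 0 "{-h<..<h}" \<phi>] 0 by force
  moreover have "\<forall>y. \<bar>0 - y\<bar> < h \<longrightarrow> \<phi> 0 \<le> \<phi> y"
  proof (intro allI impI)
    fix y assume "\<bar>0 - y\<bar> < h"
    then have "\<phi> y \<ge> 0" unfolding \<phi>_def by (intro nonneg inU) auto
    moreover have "\<phi> 0 = 0" unfolding \<phi>_def using \<xi> by simp
    ultimately show "\<phi> 0 \<le> \<phi> y" by simp
  qed
  ultimately have "?l = 0"
    using DERIV_local_min[OF _ h(1)] by blast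
  then show ?thesis by (simp add: field_simps)
qed

lemma bound_mixed:
  assumes K: "compact K" "K \<subseteq> D"
  shows "\<exists>C\<ge>0. \<forall>t\<in>{0..1}. \<forall>z\<in>K. \<forall>v a. \<bar>dird E (vert v) (dird E (vert a) Ft) (emb t z)\<bar> \<le> C * norm v * norm a"
proof -
  have "\<exists>C\<ge>0. \<forall>y\<in>{0..1} \<times> K. \<forall>v a. \<bar>dird E (vert v) (dird E (vert a) Ft) (emb (fst y) (snd y))\<bar> \<le> C * norm v * norm a"
  proof (rule bilinear_bound_compact)
    show "compact ({0..1::real} \<times> K)" by (intro compact_Times K) simp
    fix y :: "real \<times> (complex ^ 'n)" and x
    assume y: "y \<in> {0..1} \<times> K"
    then have w: "emb (fst y) (snd y) \<in> E" using K by (intro emb_E) auto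
    show "linear (\<lambda>a. dird E (vert x) (dird E (vert a) Ft) (emb (fst y) (snd y)))"
      using linear_compose[OF linear_vert linear_dird_inner(2)[OF E Ft2 w]] by (simp add: o_def)
    show "linear (\<lambda>v. dird E (vert v) (dird E (vert x) Ft) (emb (fst y) (snd y)))"
      using linear_compose[OF linear_vert linear_dird_inner(1)[OF E Ft2 w]] by (simp add: o_def)
  next
    fix b b' :: "complex ^ 'n"
    have "continuous_on E (dird E (vert b) (dird E (vert b') Ft))"
      using Ck_on_imp_continuous[OF Ck_on_dird(2)[OF E Ck_on_dird(2)[OF E]]] Ft2[unfolded numeral_2_eq_2] .
    from continuous_on_emb[OF this]
    show "continuous_on ({0..1} \<times> K) (\<lambda>y. dird E (vert b) (dird E (vert b') Ft) (emb (fst y) (snd y)))"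
      by (rule continuous_on_subset) (use K in auto)
  qed
  then show ?thesis by fastforce
qed

text \<open>
  The bilinear form in the last two arguments is symmetric on the whole domain, and this can be differentiated once
  more even though fourth derivatives need not exist.
\<close>

lemma bound_third:
  assumes K: "compact K" "K \<subseteq> D"
  shows "\<exists>C\<ge>0. \<forall>t\<in>{0..1}. \<forall>z\<in>K. \<forall>a. \<bar>dird E x (dird E (vert a) (dird E (vert a) F)) (emb t z)\<bar> \<le> C * norm a * norm a"
proof -
  have "\<exists>C\<ge>0. \<forall>y\<in>{0..1} \<times> K. \<forall>a a'. \<bar>dird E x (dird E (vert a) (dird E (vert a') F)) (emb (fst y) (snd y))\<bar> \<le> C * norm a * norm a'"
  proof (rule bilinear_bound_compact)
    show "compact ({0..1::real} \<times> K)" by (intro compact_Times K) simp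
    fix y :: "real \<times> (complex ^ 'n)" and c
    assume y: "y \<in> {0..1} \<times> K"
    then have w: "emb (fst y) (snd y) \<in> E" using K by (intro emb_E) auto
    show 1: "linear (\<lambda>a. dird E x (dird E (vert a) (dird E (vert c) F)) (emb (fst y) (snd y)))" for c
      using linear_compose[OF linear_vert linear_dird_inner(2)[OF E Ck_on_dird_F w]] by (simp add: o_def)
    have "dird E x (dird E (vert c) (dird E (vert a) F)) (emb (fst y) (snd y))
       = dird E x (dird E (vert a) (dird E (vert c) F)) (emb (fst y) (snd y))" for a
      by (rule dird_cong[OF dird_commute_F w])
    then show "linear (\<lambda>a. dird E x (dird E (vert c) (dird E (vert a) F)) (emb (fst y) (snd y)))"
      using 1 by simp
  next
    fix b b' :: "complex ^ 'n"
    have "continuous_on E (dird E x (dird E (vert b) (dird E (vert b') F)))"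
      using Ck_on_dird(2)[OF E Ck_on_dird_dird_F] by simp
    from continuous_on_emb[OF this]
    show "continuous_on ({0..1} \<times> K) (\<lambda>y. dird E x (dird E (vert b) (dird E (vert b') F)) (emb (fst y) (snd y)))"
      by (rule continuous_on_subset) (use K in auto)
  qed
  then show ?thesis by fastforce
qed

lemma bound_\<omega>:
  assumes K: "compact K" "K \<subseteq> D"
  shows "\<exists>C\<ge>0. \<forall>z\<in>K. \<forall>a. \<bar>dird D x (\<lambda>z. \<omega> z a (J a)) z\<bar> \<le> C * norm a * norm a"
proof -
  have C1: "Ck_on (Suc 0) D (\<lambda>z. \<omega> z a b)" for a b using \<omega>_C1[of a b] by (simp only: One_nat_def)
  note hd = Ck_on_dird(1)[OF D C1]
  have "\<exists>C\<ge>0. \<forall>z\<in>K. \<forall>a a'. \<bar>dird D x (\<lambda>z. \<omega> z a (J a')) z\<bar> \<le> C * norm a * norm a'"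
  proof (rule bilinear_bound_compact[OF K(1)])
    fix z c assume "z \<in> K"
    then have z: "z \<in> D" using K by blast
    have eqI: "dird D x (\<lambda>z. \<omega> z a b) z = r" if "((\<lambda>z. \<omega> z a b) has_derivative f') (at z within D)" "f' x = r" for a b r f'
      using dird_eqI[OF D z that(1)] that(2) by simp
    show "linear (\<lambda>a. dird D x (\<lambda>z. \<omega> z c (J a)) z)"
    proof (rule linearI)
      fix a a' and r :: real
      have "((\<lambda>z. \<omega> z c (J (a + a'))) has_derivative (\<lambda>v. dird D v (\<lambda>z. \<omega> z c (J a)) z + dird D v (\<lambda>z. \<omega> z c (J a')) z)) (at z within D)"
        by (rule has_derivative_transform[OF z _ has_derivative_add[OF hd[OF z] hd[OF z]]])
          (simp only: J_add J_form_simps(2)[OF \<omega>_J])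
      then show "dird D x (\<lambda>z. \<omega> z c (J (a + a'))) z = dird D x (\<lambda>z. \<omega> z c (J a)) z + dird D x (\<lambda>z. \<omega> z c (J a')) z"
        by (rule eqI) simp
      have "((\<lambda>z. \<omega> z c (J (r *\<^sub>R a))) has_derivative (\<lambda>v. r * dird D v (\<lambda>z. \<omega> z c (J a)) z)) (at z within D)"
        by (rule has_derivative_transform[OF z _ has_derivative_mult_right[OF hd[OF z]]])
          (simp only: J_scale J_form_simps(4)[OF \<omega>_J])
      then show "dird D x (\<lambda>z. \<omega> z c (J (r *\<^sub>R a))) z = r *\<^sub>R dird D x (\<lambda>z. \<omega> z c (J a)) z"
        by (rule eqI) simp
    qed
    show "linear (\<lambda>a. dird D x (\<lambda>z. \<omega> z a (J c)) z)"
    proof (rule linearI)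
      fix a a' and r :: real
      have "((\<lambda>z. \<omega> z (a + a') (J c)) has_derivative (\<lambda>v. dird D v (\<lambda>z. \<omega> z a (J c)) z + dird D v (\<lambda>z. \<omega> z a' (J c)) z)) (at z within D)"
        by (rule has_derivative_transform[OF z _ has_derivative_add[OF hd[OF z] hd[OF z]]])
          (simp only: J_form_simps(1)[OF \<omega>_J])
      then show "dird D x (\<lambda>z. \<omega> z (a + a') (J c)) z = dird D x (\<lambda>z. \<omega> z a (J c)) z + dird D x (\<lambda>z. \<omega> z a' (J c)) z"
        by (rule eqI) simp
      have "((\<lambda>z. \<omega> z (r *\<^sub>R a) (J c)) has_derivative (\<lambda>v. r * dird D v (\<lambda>z. \<omega> z a (J c)) z)) (at z within D)"
        by (rule has_derivative_transform[OF z _ has_derivative_mult_right[OF hd[OF z]]])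
          (simp only: J_form_simps(3)[OF \<omega>_J])
      then show "dird D x (\<lambda>z. \<omega> z (r *\<^sub>R a) (J c)) z = r *\<^sub>R dird D x (\<lambda>z. \<omega> z a (J c)) z"
        by (rule eqI) simp
    qed
  next
    fix b b' :: "complex ^ 'n"
    show "continuous_on K (\<lambda>z. dird D x (\<lambda>z. \<omega> z b (J b')) z)"
      using continuous_on_subset[OF Ck_on_imp_continuous[OF Ck_on_dird(2)[OF D C1]] K(2)] by simp
  qed
  then show ?thesis by blast
qed

lemma bound_grad_vel:
  assumes K: "compact K" "K \<subseteq> D"
  shows "\<exists>C\<ge>0. \<forall>t\<in>{0..1}. \<forall>z\<in>K. norm (grad_vel t z) \<le> C"
proof -
  have Ft1: "Ck_on (Suc 0) E (dird E a F)" for a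
    using Ck_on_Suc_imp[of "Suc 0" E "dird E a F"] Ck_on_dird_F[of a] by (simp only: numeral_2_eq_2)
  have "\<exists>C\<ge>0. \<forall>y\<in>{0..1} \<times> K. \<forall>a. \<bar>grad_vel (fst y) (snd y) \<bullet> a\<bar> \<le> C * norm a"
  proof (rule linear_bound_compact)
    show "compact ({0..1::real} \<times> K)" by (intro compact_Times K) simp
    fix y :: "real \<times> (complex ^ 'n)"
    show "linear (\<lambda>a. grad_vel (fst y) (snd y) \<bullet> a)"
      by (rule linearI) (auto simp: inner_add_right)
  next
    fix b :: "complex ^ 'n"
    have "continuous_on E (dird E (vert b) Ft)"
      using Ck_on_imp_continuous[OF Ck_on_dird_dird_F] unfolding Ft_def .
    from continuous_on_emb[OF this]
    have "continuous_on ({0..1} \<times> D) (\<lambda>y. grad_vel (fst y) (snd y) \<bullet> b)"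
      by (rule continuous_on_eq) (simp only: mem_Times_iff grad_vel_inner)
    then show "continuous_on ({0..1} \<times> K) (\<lambda>y. grad_vel (fst y) (snd y) \<bullet> b)"
      by (rule continuous_on_subset) (use K in auto)
  qed
  then obtain C where C: "C \<ge> 0" "\<And>t z a. t \<in> {0..1} \<Longrightarrow> z \<in> K \<Longrightarrow> \<bar>grad_vel t z \<bullet> a\<bar> \<le> C * norm a"
    by fastforce
  have "norm (grad_vel t z) \<le> C" if "t \<in> {0..1}" "z \<in> K" for t z
    using C(2)[OF that, of "grad_vel t z"] C(1)
    by (cases "grad_vel t z = 0") (auto simp: power2_norm_eq_inner[symmetric] power2_eq_square)
  with C(1) show ?thesis by blast
qed

text \<open>
  By compactness the form is bounded below on the unit sphere over \<open>[0, T] \<times> {z0}\<close>, and uniform continuity extends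
  half of the bound to a neighbourhood of \<open>z0\<close> that works for all times.
\<close>

lemma fibre_form_lower_bound:
  assumes T: "T \<in> {0..1}" and z0: "z0 \<in> D" and pos: "\<And>t \<eta>. t \<in> {0..T} \<Longrightarrow> \<eta> \<noteq> 0 \<Longrightarrow> fibre_form t z0 \<eta> > 0"
  shows "\<exists>R>0. \<exists>\<kappa>>0. cball z0 R \<subseteq> D \<and> (\<forall>t\<in>{0..T}. \<forall>z\<in>cball z0 R. \<forall>\<eta>. fibre_form t z \<eta> \<ge> \<kappa> * (norm \<eta>)\<^sup>2)"
proof -
  obtain R0 where R0: "R0 > 0" "cball z0 R0 \<subseteq> D"
    using open_D z0 open_contains_cball by blast
  let ?f = "\<lambda>q. fibre_form (fst (fst q)) (snd (fst q)) (snd q)"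
  let ?S = "sphere (0 :: complex ^ 'n) 1"
  let ?K = "({0..T} \<times> cball z0 R0) \<times> ?S"
  have cK: "continuous_on ?K ?f"
    by (rule continuous_on_subset[OF continuous_fibre_form]) (use T R0 in auto)
  have "compact ?K" by (intro compact_Times) auto
  then have uc: "uniformly_continuous_on ?K ?f"
    by (rule compact_uniformly_continuous[OF cK])
  let ?Kz = "({0..T} \<times> {z0}) \<times> ?S"
  have sub: "?Kz \<subseteq> ?K" using R0 by auto
  have comp: "compact ?Kz" by (intro compact_Times) auto
  have "((0, z0), axis undefined 1) \<in> ?Kz"
    using T by (simp add: norm_axis_1)
  then have ne: "?Kz \<noteq> {}" by blast
  from continuous_attains_inf[OF comp ne continuous_on_subset[OF cK sub]]
  obtain q0 where q00: "q0 \<in> ?Kz" and q01: "\<forall>q\<in>?Kz. ?f q0 \<le> ?f q"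
    by (elim bexE) (rule that)
  have q0: "q0 \<in> ?Kz" "\<And>q. q \<in> ?Kz \<Longrightarrow> ?f q0 \<le> ?f q"
    using q00 q01[rule_format] by simp_all
  define \<mu> where "\<mu> = ?f q0"
  have \<mu>: "\<mu> > 0"
  proof -
    have "snd q0 \<noteq> 0" using q0(1) by auto
    then show ?thesis unfolding \<mu>_def using q0(1) pos by auto
  qed
  from uc[unfolded uniformly_continuous_on_def, THEN spec, THEN mp, OF half_gt_zero[OF \<mu>]]
  obtain d where d0: "d > 0" and d1: "\<forall>q\<in>?K. \<forall>q'\<in>?K. dist q' q < d \<longrightarrow> dist (?f q') (?f q) < \<mu> / 2"
    by (elim exE conjE) (rule that)
  have d: "d > 0" "\<And>q q'. q \<in> ?K \<Longrightarrow> q' \<in> ?K \<Longrightarrow> dist q' q < d \<Longrightarrow> dist (?f q') (?f q) < \<mu> / 2"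
    using d0 d1[rule_format] by simp_all
  define R where "R = min R0 (d / 2)"
  have R: "R > 0" "R \<le> R0" "R < d" using R0(1) d(1) by (auto simp: R_def)
  have unit: "fibre_form t z \<eta> \<ge> \<mu> / 2" if "t \<in> {0..T}" "z \<in> cball z0 R" "norm \<eta> = 1" for t z \<eta>
  proof -
    have "((t, z), \<eta>) \<in> ?K" "((t, z0), \<eta>) \<in> ?K" "((t, z0), \<eta>) \<in> ?Kz" using that R R0 by auto
    moreover have "dist ((t, z), \<eta>) ((t, z0), \<eta>) < d"
      using that R by (simp add: dist_Pair_Pair dist_commute)
    ultimately have "dist (fibre_form t z \<eta>) (fibre_form t z0 \<eta>) < \<mu> / 2" "\<mu> \<le> fibre_form t z0 \<eta>"
      using d(2)[of "((t, z0), \<eta>)" "((t, z), \<eta>)"] q0(2)[of "((t, z0), \<eta>)"] by (auto simp: \<mu>_def)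
    then show ?thesis unfolding dist_real_def by linarith
  qed
  have cb: "cball z0 R \<subseteq> D" using R(2) R0(2) subset_cball by blast
  have "fibre_form t z \<eta> \<ge> \<mu> / 2 * (norm \<eta>)\<^sup>2" if t: "t \<in> {0..T}" and z: "z \<in> cball z0 R" for t z \<eta>
  proof (cases "\<eta> = 0")
    case True
    have "t \<in> {0..1}" "z \<in> D" using t z T cb by auto
    from J_form_simps(7)[OF J_form_emb[OF this]] show ?thesis
      using True by (simp add: fibre_form_def vert_0)
  next
    case False
    have tD: "t \<in> {0..1}" "z \<in> D" using t z T cb by auto
    let ?e = "(1 / norm \<eta>) *\<^sub>R \<eta>"
    have "fibre_form t z (norm \<eta> *\<^sub>R ?e) = (norm \<eta>)\<^sup>2 * fibre_form t z ?e"
      by (rule fibre_form_scale[OF tD])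
    moreover have "norm \<eta> *\<^sub>R ?e = \<eta>" using False by simp
    moreover have "fibre_form t z ?e \<ge> \<mu> / 2" by (rule unit[OF t z]) (use False in simp)
    ultimately show ?thesis
      using mult_left_mono[of "\<mu> / 2" "fibre_form t z ?e" "(norm \<eta>)\<^sup>2"] by (simp add: mult.commute)
  qed
  then show ?thesis using R(1) \<mu> cb by (intro exI[of _ R] conjI exI[of _ "\<mu> / 2"]) auto
qed

text \<open>
  Here a third derivative of \<open>F\<close> is reordered as a second derivative of the velocity, which is only of class
  \<open>C\<^sup>2\<close>.
\<close>

lemma grad_vel_derivative_in_time:
  assumes T: "T \<in> {0..1}" and t: "t \<in> {0..T}" and z: "z \<in> D"
  shows "((\<lambda>t. grad_vel t z) has_vector_derivative (\<Sum>b\<in>Basis. dird E (vert b) (dird E (J es) Ft) (emb t z) *\<^sub>R b)) (at t within {0..T})"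
proof -
  have eq: "emb s z = vert z + s *\<^sub>R J es" for s by (simp add: emb_def)
  have in_E: "vert z + s *\<^sub>R J es \<in> E" if "s \<in> {0..T}" for s
    unfolding eq[symmetric] by (rule emb_E) (use that T z in auto)
  have "((\<lambda>t. dird E (vert b) Ft (emb t z)) has_vector_derivative dird E (vert b) (dird E (J es) Ft) (emb t z)) (at t within {0..T})" for b
  proof -
    have "Ck_on (Suc 0) E (dird E (vert b) Ft)" unfolding Ft_def by (rule Ck_on_dird_dird_F)
    from has_vector_derivative_along_line[OF E this in_E t]
    show ?thesis
      unfolding eq[symmetric] dird_commute[OF E Ft2 in_E[OF t, folded eq], of "J es" "vert b"] .
  qed
  then show ?thesis
    unfolding grad_vel_def
    by (intro has_vector_derivative_sum has_vector_derivative_scaleR[of _ _ _ _ "\<lambda>_. _" 0, simplified])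
      (auto simp: has_real_derivative_iff_has_vector_derivative)
qed

end

text \<open>
  The two conditions on the powers of \<open>\<Omega>\<close> are stated in terms of Pfaffians. The fibre over \<open>t = 0\<close> is positive since
  the initial potential is Kaehler.
\<close>

locale strip_geodesic = strip_potential D F \<omega>
  for D :: "(complex ^ 'n::finite) set" and F and \<omega> +
  assumes deg: "\<And>w v. w \<in> E \<Longrightarrow> pfaff (\<Omega> w) (CARD('n) + 1) v = 0"
    and rank: "\<And>w. w \<in> E \<Longrightarrow> \<exists>v. pfaff (\<Omega> w) CARD('n) v \<noteq> 0"
    and pos0: "\<And>z \<eta>. z \<in> D \<Longrightarrow> \<eta> \<noteq> 0 \<Longrightarrow> fibre_form 0 z \<eta> > 0"
begin

lemma kernel_exists:
  assumes "t \<in> {0..1}" "z \<in> D" "\<And>\<eta>. \<eta> \<noteq> 0 \<Longrightarrow> fibre_form t z \<eta> > 0"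
  shows "\<exists>\<xi>. \<forall>w. \<Omega> (emb t z) (es + vert \<xi>) w = 0"
  by (rule kernel_vector[OF J_form_emb[OF assms(1,2)] _ deg[OF emb_E[OF assms(1,2)]]])
    (use assms(3) in \<open>simp add: fibre_form_def\<close>)

lemma abs_combination_bound:
  fixes x :: real
  assumes "x = - 2 * (p + q + r / 2 + s / 2)" "\<bar>p\<bar> \<le> a" "\<bar>q\<bar> \<le> b" "\<bar>r\<bar> \<le> c" "\<bar>s\<bar> \<le> c"
  shows "\<bar>x\<bar> \<le> 2 * (a + b + c)"
proof -
  have x: "x = - 2 * p - 2 * q - r - s" using assms(1) by (simp add: algebra_simps)
  show ?thesis
    using assms(2-5) unfolding x abs_le_iff by auto
qed

text \<open>
  As long as the fibre over \<open>z0\<close> is positive, the vector \<open>\<xi>\<close> is bounded by the gradient of the velocity, and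
  \<open>Ft_second_derivative\<close> bounds the time derivative of that gradient by the gradient itself, uniformly near
  \<open>z0\<close>. Gronwall's lemma applies.
\<close>

lemma grad_vel_estimate:
  assumes T: "T \<in> {0..1}" and z0: "z0 \<in> D" and pos: "\<And>t \<eta>. t \<in> {0..T} \<Longrightarrow> \<eta> \<noteq> 0 \<Longrightarrow> fibre_form t z0 \<eta> > 0"
  shows "\<exists>R>0. \<exists>C\<ge>0. ball z0 R \<subseteq> D \<and> (\<forall>t\<in>{0..T}. \<forall>z\<in>ball z0 R. norm (grad_vel t z) \<le> C * norm (grad_vel 0 z))"
proof -
  obtain R \<kappa> where R: "R > 0" "cball z0 R \<subseteq> D" and \<kappa>: "\<kappa> > 0"
    and low: "\<And>t z \<eta>. t \<in> {0..T} \<Longrightarrow> z \<in> cball z0 R \<Longrightarrow> fibre_form t z \<eta> \<ge> \<kappa> * (norm \<eta>)\<^sup>2"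
    using fibre_form_lower_bound[OF T z0 pos] by blast
  let ?K = "cball z0 R"
  have K: "compact ?K" "?K \<subseteq> D" using R by auto
  obtain C1 where C1: "C1 \<ge> 0" "\<And>t z v a. t \<in> {0..1} \<Longrightarrow> z \<in> ?K \<Longrightarrow>
      \<bar>dird E (vert v) (dird E (vert a) Ft) (emb t z)\<bar> \<le> C1 * norm v * norm a"
    using bound_mixed[OF K] by blast
  have "\<forall>b. \<exists>C\<ge>0. \<forall>t\<in>{0..1}. \<forall>z\<in>?K. \<forall>a. \<bar>dird E (vert b) (dird E (vert a) (dird E (vert a) F)) (emb t z)\<bar> \<le> C * norm a * norm a"
    using bound_third[OF K] by blast
  then obtain C3 where C3: "\<And>b. C3 b \<ge> 0" "\<And>b t z a. t \<in> {0..1} \<Longrightarrow> z \<in> ?K \<Longrightarrow>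
      \<bar>dird E (vert b) (dird E (vert a) (dird E (vert a) F)) (emb t z)\<bar> \<le> C3 b * norm a * norm a"
    by metis
  have "\<forall>b. \<exists>C\<ge>0. \<forall>z\<in>?K. \<forall>a. \<bar>dird D b (\<lambda>z. \<omega> z a (J a)) z\<bar> \<le> C * norm a * norm a"
    using bound_\<omega>[OF K] by blast
  then obtain C0 where C0: "\<And>b. C0 b \<ge> 0" "\<And>b z a. z \<in> ?K \<Longrightarrow>
      \<bar>dird D b (\<lambda>z. \<omega> z a (J a)) z\<bar> \<le> C0 b * norm a * norm a"
    by metis
  obtain M where M: "M \<ge> 0" "\<And>t z. t \<in> {0..1} \<Longrightarrow> z \<in> ?K \<Longrightarrow> norm (grad_vel t z) \<le> M"
    using bound_grad_vel[OF K] by blast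
  \<comment> \<open>\<open>X\<close> bounds the vectors \<open>\<xi>\<close>, so that their squares can be estimated linearly.\<close>
  define X where "X = M / (2 * \<kappa>)"
  define A where "A b = 2 * (C0 b * X + C1 * norm b + C3 b * X)" for b
  have X: "X \<ge> 0" using M(1) \<kappa> by (simp add: X_def)
  have A: "A b \<ge> 0" for b
    unfolding A_def using X C0(1)[of b] C1(1) C3(1)[of b] by simp
  define C where "C = (\<Sum>b\<in>Basis. A b / (2 * \<kappa>))"
  have C: "C \<ge> 0" unfolding C_def using A \<kappa> by (intro sum_nonneg) simp
  let ?g' = "\<lambda>t z. \<Sum>b\<in>Basis. dird E (vert b) (dird E (J es) Ft) (emb t z) *\<^sub>R b"
  have g': "norm (?g' t z) \<le> C * norm (grad_vel t z)" if t: "t \<in> {0..T}" and z: "z \<in> ball z0 R" for t z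
  proof -
    have t1: "t \<in> {0..1}" using t T by auto
    have zK: "z \<in> ?K" using z by auto
    have zD: "z \<in> D" using zK K by blast
    have posU: "fibre_form t y \<eta> > 0" if "y \<in> ball z0 R" "\<eta> \<noteq> 0" for y \<eta>
    proof -
      have "\<kappa> * (norm \<eta>)\<^sup>2 > 0" using \<kappa> that by simp
      moreover have "fibre_form t y \<eta> \<ge> \<kappa> * (norm \<eta>)\<^sup>2" using low[OF t] that by auto
      ultimately show ?thesis by linarith
    qed
    obtain \<xi> where \<xi>: "\<And>w. \<Omega> (emb t z) (es + vert \<xi>) w = 0"
      using kernel_exists[OF t1 zD posU[OF z]] by blast
    have \<xi>grad_vel: "norm \<xi> \<le> norm (grad_vel t z) / (2 * \<kappa>)"
    proof (cases "\<xi> = 0")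
      case False
      have "\<kappa> * (norm \<xi>)\<^sup>2 \<le> - (grad_vel t z \<bullet> J \<xi>) / 2"
        using low[OF t zK, of \<xi>] fibre_form_kernel[OF t1 zD \<xi>] by simp
      also have "\<dots> \<le> norm (grad_vel t z) * norm \<xi> / 2"
        using Cauchy_Schwarz_ineq2[of "grad_vel t z" "J \<xi>"] by (simp add: norm_J)
      finally have "norm \<xi> * (2 * \<kappa> * norm \<xi>) \<le> norm \<xi> * norm (grad_vel t z)"
        by (simp add: power2_eq_square mult_ac)
      then have "2 * \<kappa> * norm \<xi> \<le> norm (grad_vel t z)" using False by simp
      then show ?thesis using \<kappa> by (simp add: field_simps)
    qed (use \<kappa> in simp)
    also have "\<dots> \<le> X" unfolding X_def using M(2)[OF t1 zK] \<kappa> by (simp add: divide_right_mono)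
    finally have \<xi>X: "norm \<xi> \<le> X" .
    have nonneg: "\<Omega> (emb t y) x (J x) \<ge> 0" if y: "y \<in> ball z0 R" for y x
    proof -
      have yD: "y \<in> D" using y K by auto
      obtain \<xi>' where "\<And>w. \<Omega> (emb t y) (es + vert \<xi>') w = 0"
        using kernel_exists[OF t1 yD posU[OF y]] by blast
      from form_nonneg[OF t1 yD this posU[OF y]] show ?thesis .
    qed
    have comp: "\<bar>dird E (vert b) (dird E (J es) Ft) (emb t z)\<bar> \<le> A b / (2 * \<kappa>) * norm (grad_vel t z)" for b
    proof -
      have "dird E (vert b) (dird E (J es) Ft) (emb t z) = - 2 * (dird D b (\<lambda>z. \<omega> z \<xi> (J \<xi>)) z
          + dird E (vert b) (dird E (vert (J \<xi>)) Ft) (emb t z)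
          + dird E (vert b) (dird E (vert (J \<xi>)) (dird E (vert (J \<xi>)) F)) (emb t z) / 2
          + dird E (vert b) (dird E (vert \<xi>) (dird E (vert \<xi>) F)) (emb t z) / 2)"
        by (rule Ft_second_derivative[OF t1 open_ball _ z \<xi> nonneg]) (use K ball_subset_cball in blast)
      then have "\<bar>dird E (vert b) (dird E (J es) Ft) (emb t z)\<bar> \<le> 2 * (C0 b * norm \<xi> * norm \<xi>
          + C1 * norm b * norm \<xi> + C3 b * norm \<xi> * norm \<xi>)"
        using C0(2)[OF zK, of b \<xi>] C1(2)[OF t1 zK, of b "J \<xi>"] C3(2)[OF t1 zK, of b "J \<xi>"]
          C3(2)[OF t1 zK, of b \<xi>] unfolding norm_J by (rule abs_combination_bound)
      also have "\<dots> \<le> 2 * (C0 b * X * norm \<xi> + C1 * norm b * norm \<xi> + C3 b * X * norm \<xi>)"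
        by (intro mult_left_mono add_mono mult_right_mono \<xi>X C0(1) C3(1) order_refl) auto
      also have "\<dots> = A b * norm \<xi>" unfolding A_def by (simp add: algebra_simps)
      also have "\<dots> \<le> A b * (norm (grad_vel t z) / (2 * \<kappa>))"
        by (rule mult_left_mono[OF \<xi>grad_vel A])
      finally show ?thesis by simp
    qed
    have "norm (?g' t z) \<le> (\<Sum>b\<in>Basis. norm (dird E (vert b) (dird E (J es) Ft) (emb t z) *\<^sub>R b))"
      by (rule norm_sum)
    also have "\<dots> \<le> (\<Sum>b\<in>Basis. A b / (2 * \<kappa>) * norm (grad_vel t z))"
      by (rule sum_mono) (use comp in simp)
    also have "\<dots> = C * norm (grad_vel t z)" by (simp add: C_def sum_distrib_right)
    finally show ?thesis .
  qed
  have "norm (grad_vel t z) \<le> exp C * norm (grad_vel 0 z)" if t: "t \<in> {0..T}" and z: "z \<in> ball z0 R" for t z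
  proof -
    have zD: "z \<in> D" using z K by auto
    have "norm (grad_vel t z) \<le> exp (C * t) * norm (grad_vel 0 z)"
      by (rule gronwall_norm[OF grad_vel_derivative_in_time[OF T _ zD] g'[OF _ z] t])
    also have "\<dots> \<le> exp C * norm (grad_vel 0 z)"
      by (intro mult_right_mono) (use t T C in \<open>auto simp: mult_left_le\<close>)
    finally show ?thesis .
  qed
  then show ?thesis
    using R(1) K by (intro exI[of _ R] conjI exI[of _ "exp C"]) auto
qed

end

section \<open>Positivity of the fibres over a critical point\<close>

text \<open>
  Applied below to \<open>f\<close> and \<open>- f\<close> in order to carry equations to the first time at which positivity might fail.
\<close>

lemma left_limit_nonneg:
  fixes f :: "real \<Rightarrow> real"
  assumes "continuous_on {0..1} f" "0 < t" "t \<le> 1" "\<And>\<tau>. 0 \<le> \<tau> \<Longrightarrow> \<tau> < t \<Longrightarrow> f \<tau> \<ge> 0"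
  shows "f t \<ge> 0"
proof (rule continuous_ge_on_closure[of "{0..<t}" f t 0])
  show "continuous_on (closure {0..<t}) f"
    by (rule continuous_on_subset[OF assms(1)]) (use assms(2,3) in auto)
qed (use assms in auto)

context strip_potential
begin

lemma continuous_line:
  assumes "continuous_on E f" "z \<in> D"
  shows "continuous_on {0..1} (\<lambda>t. f (emb t z))"
proof (rule continuous_on_compose2[OF assms(1)])
  show "continuous_on {0..1} (\<lambda>t. emb t z)"
    unfolding emb_def by (intro continuous_intros)
qed (use assms(2) emb_E in auto)

end

context strip_geodesic
begin

text \<open>
  When the gradient of the velocity vanishes, \<open>\<xi> = 0\<close>, so \<open>es\<close> itself is in the kernel.
\<close>

lemma acceleration_eq_0:
  assumes t: "t \<in> {0..1}" and z: "z \<in> D" and pos: "\<And>\<eta>. \<eta> \<noteq> 0 \<Longrightarrow> fibre_form t z \<eta> > 0" and g0: "grad_vel t z = 0"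
  shows "hess (emb t z) (J es) (J es) = 0"
proof -
  obtain \<xi> where \<xi>: "\<And>w. \<Omega> (emb t z) (es + vert \<xi>) w = 0"
    using kernel_exists[OF t z pos] by blast
  have "fibre_form t z \<xi> = 0" using fibre_form_kernel[OF t z \<xi>] g0 by simp
  then have "\<xi> = 0" using pos[of \<xi>] by auto
  then have "\<Omega> (emb t z) es (J es) = 0" using \<xi>[of "J es"] by (simp add: vert_0)
  then show ?thesis using \<Omega>_es_Jes[OF t z] by simp
qed

text \<open>
  The hypotheses say that \<open>es\<close> is in the kernel. A null vector of a semipositive form is orthogonal to the whole
  fibre, hence it is in the kernel of \<open>\<Omega>\<close> as well, and \<open>kernel_transversal\<close> applies.
\<close>

lemma semipositive_positive:
  assumes t: "t \<in> {0..1}" and z: "z \<in> D" and semi: "\<And>\<eta>. fibre_form t z \<eta> \<ge> 0"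
    and g0: "grad_vel t z = 0" and acc: "hess (emb t z) (J es) (J es) = 0" and q0: "fibre_form t z \<eta> = 0"
  shows "\<eta> = 0"
proof -
  let ?B = "\<Omega> (emb t z)"
  note B = J_form_emb[OF t z]
  note S = J_form_simps[OF B]
  have es_vert: "?B es (vert y) = 0" for y
    using \<Omega>_es_vert[OF t z, of y] g0 by simp
  have es_J: "?B es (J es) = 0" using \<Omega>_es_Jes[OF t z] acc by simp
  have split: "?B x w = Re (w $ None) * ?B x es + Im (w $ None) * ?B x (J es) + ?B x (vert (proj_X w))" for x w
  proof -
    have "?B x w = ?B x (Re (w $ None) *\<^sub>R es + Im (w $ None) *\<^sub>R J es + vert (proj_X w))"
      unfolding smult_eq_real[of "w $ None" es, symmetric] vert_proj[symmetric] ..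
    then show ?thesis by (simp only: S(2,4))
  qed
  have es: "?B es w = 0" for w
    by (subst split) (simp add: S(9) es_J es_vert)
  have sym: "?B (vert y) (J (vert x)) = ?B (vert x) (J (vert y))" for x y
    using J_formD(3)[OF B, of "vert y" "J (vert x)"] S(10)[of "vert x" "vert y"] by simp
  have "?B (vert \<eta>) (J (vert y)) = 0" for y
  proof -
    define b where "b = ?B (vert \<eta>) (J (vert y))"
    define c where "c = fibre_form t z y"
    have quad: "2 * s * b + s\<^sup>2 * c \<ge> 0" for s :: real
    proof -
      have "fibre_form t z (\<eta> + s *\<^sub>R y) = fibre_form t z \<eta> + s * b + s * ?B (vert y) (J (vert \<eta>)) + s * (s * c)"
        unfolding fibre_form_def b_def c_def vert_add vert_scale J_add J_scale S(1-4) by (simp add: algebra_simps)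
      also have "\<dots> = 2 * s * b + s\<^sup>2 * c"
        using q0 sym[of y \<eta>] by (simp add: b_def power2_eq_square)
      finally show ?thesis using semi[of "\<eta> + s *\<^sub>R y"] by simp
    qed
    have c: "c \<ge> 0" unfolding c_def by (rule semi)
    \<comment> \<open>The minimum of the quadratic is at \<open>- b / c\<close>; the denominator \<open>c + 1\<close> covers \<open>c = 0\<close> as well.\<close>
    define r where "r = - b / (c + 1)"
    have b: "b = - r * (c + 1)" using c by (simp add: r_def)
    have "2 * r * b + r\<^sup>2 * c = - (r\<^sup>2 * (c + 2))"
      unfolding b by (simp add: algebra_simps power2_eq_square)
    with quad[of r] have "r\<^sup>2 * (c + 2) \<le> 0" by simp
    then have "r = 0" using c by (auto simp: mult_le_0_iff)
    then have "b = 0" using b by simp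
    then show ?thesis unfolding b_def[symmetric] by simp
  qed
  from this[of "- J y" for y] have "?B (vert \<eta>) (vert y) = 0" for y
    by (simp add: linear_neg[OF linear_vert] linear_neg[OF linear_J] vert_J)
  moreover have "?B (vert \<eta>) es = 0" "?B (vert \<eta>) (J es) = 0"
    using J_formD(3)[OF B, of "vert \<eta>" es] es S(10)[of "vert \<eta>" es] J_formD(3)[OF B, of "J (vert \<eta>)" es] by simp_all
  ultimately have "?B (vert \<eta>) w = 0" for w
    by (subst split) simp
  moreover obtain v where "pfaff ?B CARD('n) v \<noteq> 0"
    using rank[OF emb_E[OF t z]] by blast
  ultimately show "\<eta> = 0"
    using kernel_transversal[OF B _ es] by blast
qed

text \<open>
  The pairs of a time and a unit vector at which positivity fails form a compact set. At the earliest such time, the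
  equations that hold before it persist by continuity and contradict \<open>semipositive_positive\<close>.
\<close>

lemma positive_along_critical:
  assumes z: "z \<in> D" and g0: "grad_vel 0 z = 0" and t: "t \<in> {0..1}" and \<eta>: "\<eta> \<noteq> 0"
  shows "fibre_form t z \<eta> > 0"
proof (rule ccontr)
  assume neg: "\<not> fibre_form t z \<eta> > 0"
  let ?K = "{0..1::real} \<times> sphere (0 :: complex ^ 'n) 1"
  let ?f = "\<lambda>p. fibre_form (fst p) z (snd p)"
  let ?Z = "{p \<in> ?K. ?f p \<le> 0}"
  have "continuous_on ?K (\<lambda>p. ((fst p, z), snd p))" by (intro continuous_intros)
  moreover have "(\<lambda>p. ((fst p, z), snd p)) ` ?K \<subseteq> ({0..1} \<times> D) \<times> UNIV" using z by auto
  ultimately have cont: "continuous_on ?K ?f"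
    using continuous_on_compose2[OF continuous_fibre_form, of ?K "\<lambda>p. ((fst p, z), snd p)"] by simp
  have "compact ?K" by (intro compact_Times) auto
  moreover have "closed ?Z"
    by (rule continuous_on_closed_Collect_le[OF cont continuous_on_const])
      (intro compact_imp_closed compact_Times, auto)
  ultimately have "compact (?K \<inter> ?Z)" by (rule compact_Int_closed)
  moreover have "?K \<inter> ?Z = ?Z" by blast
  ultimately have compZ: "compact ?Z" by simp
  have normalise: "(\<tau>, (1 / norm y) *\<^sub>R y) \<in> ?Z" if "\<tau> \<in> {0..1}" "y \<noteq> 0" "\<not> fibre_form \<tau> z y > 0" for \<tau> y
    using that fibre_form_scale[OF that(1) z, of "1 / norm y" y]
    by (auto simp: zero_less_mult_iff mult_le_0_iff)
  have "?Z \<noteq> {}" using normalise[OF t \<eta> neg] by blast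
  from continuous_attains_inf[OF compZ this continuous_on_fst[OF continuous_on_id]]
  obtain p where p: "p \<in> ?Z" and pmin: "\<forall>q\<in>?Z. fst p \<le> fst q"
    by (elim bexE) (rule that)
  define T where "T = fst p"
  define y where "y = snd p"
  have T: "T \<in> {0..1}" and y: "norm y = 1" and Qy: "fibre_form T z y \<le> 0"
    using p by (auto simp: T_def y_def)
  have pos: "fibre_form \<tau> z x > 0" if "0 \<le> \<tau>" "\<tau> < T" "x \<noteq> 0" for \<tau> x
  proof (rule ccontr)
    assume "\<not> fibre_form \<tau> z x > 0"
    with normalise[of \<tau> x] that T have "(\<tau>, (1 / norm x) *\<^sub>R x) \<in> ?Z" by auto
    from pmin[rule_format, OF this] show False using that by (simp add: T_def)
  qed
  have "y \<noteq> 0" using y by (metis norm_zero zero_neq_one)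
  from pos0[OF z this] have "T \<noteq> 0" using Qy by auto
  then have T0: "0 < T" "T \<le> 1" using T by auto
  have gz: "grad_vel \<tau> z = 0" if \<tau>: "0 \<le> \<tau>" "\<tau> < T" for \<tau>
  proof -
    have "\<tau> \<in> {0..1}" using \<tau> T0 by auto
    moreover have "\<And>t \<eta>. t \<in> {0..\<tau>} \<Longrightarrow> \<eta> \<noteq> 0 \<Longrightarrow> fibre_form t z \<eta> > 0"
      using pos \<tau> by auto
    ultimately obtain R C where RC: "R > 0"
      "\<forall>t\<in>{0..\<tau>}. \<forall>x\<in>ball z R. norm (grad_vel t x) \<le> C * norm (grad_vel 0 x)"
      using grad_vel_estimate[OF _ z] by meson
    then have "norm (grad_vel \<tau> z) \<le> C * norm (grad_vel 0 z)" using \<tau>(1) by simp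
    then show ?thesis using g0 by simp
  qed
  have lim0: "f (emb T z) = 0" if "continuous_on E f" "\<And>\<tau>. 0 \<le> \<tau> \<Longrightarrow> \<tau> < T \<Longrightarrow> f (emb \<tau> z) = 0"
    for f :: "complex ^ 'n option \<Rightarrow> real"
  proof -
    note c = continuous_line[OF that(1) z]
    have "f (emb T z) \<ge> 0" using left_limit_nonneg[OF c T0] that(2) by simp
    moreover have "- f (emb T z) \<ge> 0"
      using left_limit_nonneg[OF continuous_on_minus[OF c] T0] that(2) by simp
    ultimately show ?thesis by simp
  qed
  have "dird E (vert b) Ft (emb T z) = 0" for b
  proof (rule lim0)
    show "continuous_on E (dird E (vert b) Ft)"
      unfolding Ft_def by (rule Ck_on_imp_continuous[OF Ck_on_dird_dird_F])
    show "dird E (vert b) Ft (emb \<tau> z) = 0" if "0 \<le> \<tau>" "\<tau> < T" for \<tau>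
      using grad_vel_inner[of \<tau> z b] gz[OF that] that T0 z by simp
  qed
  then have gT: "grad_vel T z = 0" by (simp add: grad_vel_def)
  have accT: "hess (emb T z) (J es) (J es) = 0"
  proof (rule lim0)
    show "continuous_on E (\<lambda>w. hess w (J es) (J es))"
      unfolding hess_def by (rule Ck_on_imp_continuous[OF Ck_on_dird_dird_F])
    show "hess (emb \<tau> z) (J es) (J es) = 0" if "0 \<le> \<tau>" "\<tau> < T" for \<tau>
      by (rule acceleration_eq_0[OF _ z pos[OF that] gz[OF that]]) (use that T0 in auto)
  qed
  have semi: "fibre_form T z x \<ge> 0" for x
  proof (rule left_limit_nonneg[OF _ T0])
    have "continuous_on {0..1} (\<lambda>\<tau>. ((\<tau>, z), x))" by (intro continuous_intros)
    moreover have "(\<lambda>\<tau>. ((\<tau>, z), x)) ` {0..1} \<subseteq> ({0..1} \<times> D) \<times> UNIV" using z by auto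
    ultimately show "continuous_on {0..1} (\<lambda>\<tau>. fibre_form \<tau> z x)"
      using continuous_on_compose2[OF continuous_fibre_form, of "{0..1}" "\<lambda>\<tau>. ((\<tau>, z), x)"] by simp
    show "fibre_form \<tau> z x \<ge> 0" if "0 \<le> \<tau>" "\<tau> < T" for \<tau>
    proof (cases "x = 0")
      case True
      have "\<tau> \<in> {0..1}" using that T0 by auto
      from J_form_simps(7)[OF J_form_emb[OF this z]] True show ?thesis by (simp add: fibre_form_def vert_0)
    qed (use pos[OF that] in \<open>simp add: less_imp_le\<close>)
  qed
  have "fibre_form T z y = 0" using Qy semi[of y] by simp
  from semipositive_positive[OF T z semi gT accT this] y show False by simp
qed

text \<open>
  The mean value theorem in \<open>t\<close> turns the difference into the gradient of the velocity at an intermediate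
  time.
\<close>

lemma endpoint_difference_bound:
  assumes z0: "z0 \<in> D" and crit: "\<And>v. dird E (vert v) Ft (emb 0 z0) = 0"
  shows "\<exists>R>0. \<exists>C\<ge>0. ball z0 R \<subseteq> D \<and> (\<forall>z\<in>ball z0 R. \<forall>v.
    \<bar>dird E (vert v) F (emb 1 z) - dird E (vert v) F (emb 0 z)\<bar> \<le> C * norm (grad_vel 0 z) * norm v)"
proof -
  have g0: "grad_vel 0 z0 = 0" by (simp add: grad_vel_def crit)
  obtain R C where R: "R > 0" "C \<ge> 0" "ball z0 R \<subseteq> D"
    and est: "\<forall>t\<in>{0..1}. \<forall>z\<in>ball z0 R. norm (grad_vel t z) \<le> C * norm (grad_vel 0 z)"
    using grad_vel_estimate[OF _ z0 positive_along_critical[OF z0 g0], of 1] by auto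
  have "\<bar>dird E (vert v) F (emb 1 z) - dird E (vert v) F (emb 0 z)\<bar> \<le> C * norm (grad_vel 0 z) * norm v"
    if z: "z \<in> ball z0 R" for z v
  proof -
    have zD: "z \<in> D" using z R(3) by blast
    have eq: "emb s z = emb 0 z + s *\<^sub>R J es" for s by (simp add: emb_def)
    have in_E: "emb 0 z + s *\<^sub>R J es \<in> E" if "s \<in> {0..1}" for s
      unfolding eq[symmetric] by (rule emb_E[OF that zD])
    have "Ck_on (Suc 0) E (dird E (vert v) F)"
      using Ck_on_dird_F[of "vert v"] by (simp only: numeral_2_eq_2 Ck_on_Suc_imp)
    from mvt_along_line[OF E this _ in_E, of 1]
    obtain s where s: "s \<in> {0..1}" and
      diff: "dird E (vert v) F (emb 1 z) - dird E (vert v) F (emb 0 z) = dird E (J es) (dird E (vert v) F) (emb s z)"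
      unfolding eq[symmetric] by auto
    note diff
    also have "dird E (J es) (dird E (vert v) F) (emb s z) = grad_vel s z \<bullet> v"
      unfolding grad_vel_inner[OF s zD] Ft_def by (rule dird_commute_F[OF emb_E[OF s zD]])
    finally have "\<bar>dird E (vert v) F (emb 1 z) - dird E (vert v) F (emb 0 z)\<bar> \<le> norm (grad_vel s z) * norm v"
      by (simp add: Cauchy_Schwarz_ineq2)
    also have "\<dots> \<le> C * norm (grad_vel 0 z) * norm v"
      by (intro mult_right_mono est[rule_format] s z) simp
    finally show ?thesis .
  qed
  then show ?thesis using R by blast
qed

end

section \<open>Passage to the manifold\<close>

lemma Ck_on_Re: "Ck_on k D f \<Longrightarrow> Ck_on k D (\<lambda>x. Re (f x))"
proof (induction k arbitrary: f)
  case 0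
  then show ?case by (auto intro: continuous_intros)
next
  case (Suc k)
  then obtain f' where "\<forall>x\<in>D. (f has_derivative f' x) (at x within D)" "\<forall>v. Ck_on k D (\<lambda>x. f' x v)" by auto
  with Suc.IH show ?case
    unfolding Ck_on.simps by (intro exI[of _ "\<lambda>x v. Re (f' x v)"]) (auto intro: has_derivative_Re)
qed

lemma has_derivative_0_dominated:
  fixes h :: "real \<Rightarrow> real" and \<gamma> :: "real \<Rightarrow> 'a::real_normed_vector"
  assumes \<gamma>: "(\<gamma> has_vector_derivative 0) (at 0)" and "\<gamma> 0 = 0" and "h 0 = 0"
    and bound: "\<And>s. \<bar>s\<bar> < e \<Longrightarrow> \<bar>h s\<bar> \<le> K * norm (\<gamma> s)" and "e > 0"
  shows "(h has_vector_derivative 0) (at 0)"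
proof -
  have lim: "((\<lambda>s. norm (\<gamma> s) / norm s) \<longlongrightarrow> 0) (at 0)"
    using \<gamma> \<open>\<gamma> 0 = 0\<close> unfolding has_vector_derivative_def has_derivative_iff_norm by simp
  have "((\<lambda>s. norm (h s) / norm s) \<longlongrightarrow> 0) (at 0)"
  proof (rule Lim_null_comparison)
    show "((\<lambda>s. K * (norm (\<gamma> s) / norm s)) \<longlongrightarrow> 0) (at 0)"
      using tendsto_mult_right_zero[OF lim] .
    show "\<forall>\<^sub>F s in at 0. norm (norm (h s) / norm s) \<le> K * (norm (\<gamma> s) / norm s)"
      unfolding eventually_at
      by (rule exI[of _ e]) (use bound \<open>e > 0\<close> in \<open>auto simp: dist_norm divide_right_mono\<close>)
  qed
  then show ?thesis
    unfolding has_vector_derivative_def has_derivative_iff_norm using \<open>h 0 = 0\<close> by simp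
qed

text \<open>
  Along the line through \<open>z0\<close> in the direction \<open>v\<close>, the gradient of \<open>f0\<close> vanishes to first order by symmetry of the
  Hessian; therefore so does the derivative of \<open>f1\<close>, which it dominates.
\<close>

lemma second_derivative_dominated:
  fixes f0 f1 :: "'v::euclidean_space \<Rightarrow> real"
  assumes D: "open D" and f0: "Ck_on 2 D f0" and f1: "Ck_on 2 D f1" and z0: "z0 \<in> D"
    and R: "R > 0" "ball z0 R \<subseteq> D"
    and bound: "\<And>z w. z \<in> ball z0 R \<Longrightarrow> \<bar>dird D w f1 z\<bar> \<le> C * norm (\<Sum>b\<in>Basis. dird D b f0 z *\<^sub>R b) * norm w"
    and crit: "\<And>w. dird D w f0 z0 = 0" and hess: "\<And>w. dird D w (dird D v f0) z0 = 0"
  shows "dird D w (dird D v f1) z0 = 0"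
proof -
  note cD = cornered_open[OF D]
  define e where "e = R / (norm v + 1)"
  have nv: "norm v + 1 > 0" using norm_ge_zero[of v] by linarith
  have e: "e > 0" using R(1) nv by (simp add: e_def)
  have ball: "z0 + s *\<^sub>R v \<in> ball z0 R" if "\<bar>s\<bar> < e" for s
  proof -
    have "\<bar>s\<bar> * norm v \<le> \<bar>s\<bar> * (norm v + 1)" by (rule mult_left_mono) auto
    also have "\<dots> < e * (norm v + 1)" by (rule mult_strict_right_mono[OF that nv])
    also have "\<dots> = R" using nv by (simp add: e_def)
    finally show ?thesis by (simp add: dist_norm)
  qed
  let ?S = "{-e<..<e}"
  have inD: "z0 + s *\<^sub>R v \<in> D" if "s \<in> ?S" for s
    using ball[of s] R(2) that by auto
  have 0: "0 \<in> ?S" using e by simp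
  have at0: "at 0 within ?S = at 0" by (rule at_within_open[OF 0]) simp
  have line: "((\<lambda>s. dird D b f (z0 + s *\<^sub>R v)) has_vector_derivative dird D b (dird D v f) z0) (at 0)"
    if f: "Ck_on 2 D f" for f :: "'v \<Rightarrow> real" and b
  proof -
    have "Ck_on (Suc 0) D (dird D b f)"
      using Ck_on_dird(2)[OF cD] f by (simp only: numeral_2_eq_2)
    from has_vector_derivative_along_line[OF cD this inD 0] show ?thesis
      unfolding at0 dird_commute[OF cD f z0, of b v] by simp
  qed
  let ?\<gamma> = "\<lambda>s. \<Sum>b\<in>Basis. dird D b f0 (z0 + s *\<^sub>R v) *\<^sub>R b"
  have "(?\<gamma> has_vector_derivative (\<Sum>b\<in>Basis. dird D b (dird D v f0) z0 *\<^sub>R b)) (at 0)"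
    using line[OF f0]
    by (intro has_vector_derivative_sum has_vector_derivative_scaleR[of _ _ _ _ "\<lambda>_. _" 0, simplified])
      (auto simp: has_real_derivative_iff_has_vector_derivative)
  then have \<gamma>: "(?\<gamma> has_vector_derivative 0) (at 0)" by (simp add: hess)
  have "\<bar>dird D w f1 (z0 + s *\<^sub>R v)\<bar> \<le> (C * norm w) * norm (?\<gamma> s)" if "\<bar>s\<bar> < e" for s
    using bound[OF ball[OF that], of w] by (simp add: mult_ac)
  moreover have "dird D w f1 (z0 + 0 *\<^sub>R v) = 0"
    using bound[of z0 w] R(1) by (simp add: crit)
  moreover have "?\<gamma> 0 = 0" by (simp add: crit)
  ultimately have "((\<lambda>s. dird D w f1 (z0 + s *\<^sub>R v)) has_vector_derivative 0) (at 0)"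
    using e by (intro has_derivative_0_dominated[OF \<gamma>, of _ e "C * norm w"])
  from vector_derivative_unique_at[OF line[OF f1, of w] this] show ?thesis .
qed

lemma dird_open: "open D \<Longrightarrow> y \<in> D \<Longrightarrow> dird D v f y = frechet_derivative f (at y) v"
  unfolding dird_def by (subst at_within_open) simp_all

lemma hessian_eq_dird:
  assumes "open D" "z \<in> D"
  shows "hessian f z v w = dird D w (dird D v f) z"
proof -
  have "dird D w (dird D v f) z = dird D w (\<lambda>y. frechet_derivative f (at y) v) z"
    by (rule dird_cong[OF dird_open[OF assms(1)] assms(2)])
  then show ?thesis by (simp add: hessian_def dird_open[OF assms])
qed

text \<open>
  A point of the closed strip is approximated by points moved slightly towards the middle line.
\<close>

lemma closure_strip: "closure strip = {s. Im s \<in> {0..1}}"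
proof
  have "closed {s. Im s \<in> {0..1}}"
    using closed_Collect_conj[OF closed_halfspace_Im_ge[of 0] closed_halfspace_Im_le[of 1]] by simp
  moreover have "strip \<subseteq> {s. Im s \<in> {0..1}}" by (auto simp: strip_def)
  ultimately show "closure strip \<subseteq> {s. Im s \<in> {0..1}}" by (rule closure_minimal[rotated])
  show "{s. Im s \<in> {0..1}} \<subseteq> closure strip"
  proof
    fix s :: complex assume "s \<in> {s. Im s \<in> {0..1}}"
    then have s: "0 \<le> Im s" "Im s \<le> 1" by auto
    show "s \<in> closure strip"
      unfolding closure_approachable
    proof (intro allI impI)
      fix e :: real assume "e > 0"
      define h where "h = min (e / 2) 1"
      have h: "0 < h" "h \<le> 1" "h < e" using \<open>e > 0\<close> by (auto simp: h_def)
      define s' where "s' = s + complex_of_real (h * (1 / 2 - Im s)) * \<i>"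
      have Im: "Im s' = (1 - h) * Im s + h * (1 / 2)" by (simp add: s'_def algebra_simps)
      have "(1 - h) * Im s \<ge> 0" using h s by simp
      moreover have "(1 - h) * Im s \<le> (1 - h) * 1" using h s by (intro mult_left_mono) auto
      ultimately have "0 < Im s'" "Im s' < 1" unfolding Im using h by auto
      then have "s' \<in> strip" by (simp add: strip_def)
      moreover have "dist s' s < e"
      proof -
        have "dist s' s = \<bar>h * (1 / 2 - Im s)\<bar>" 
          unfolding s'_def dist_norm add_diff_cancel_left' norm_mult norm_of_real by simp
        also have "\<dots> \<le> h * 1" unfolding abs_mult using h s by (intro mult_mono) auto
        finally show ?thesis using h by simp
      qed
      ultimately show "\<exists>y\<in>strip. dist y s < e" by blast
    qed
  qed
qed

lemma is_ext_formD:
  assumes "is_ext_form k \<alpha>"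
  shows "(\<And>i. i < k \<Longrightarrow> v i = w i) \<Longrightarrow> \<alpha> v = \<alpha> w"
    and "i < k \<Longrightarrow> linear (\<lambda>x. \<alpha> (v(i := x)))"
    and "i < k \<Longrightarrow> j < k \<Longrightarrow> i \<noteq> j \<Longrightarrow> v i = v j \<Longrightarrow> \<alpha> v = 0"
proof -
  note d = assms[unfolded is_ext_form_def]
  show "(\<And>i. i < k \<Longrightarrow> v i = w i) \<Longrightarrow> \<alpha> v = \<alpha> w"
    by (rule d[THEN conjunct1, rule_format])
  show "i < k \<Longrightarrow> linear (\<lambda>x. \<alpha> (v(i := x)))"
    by (rule d[THEN conjunct2, THEN conjunct1, rule_format])
  show "i < k \<Longrightarrow> j < k \<Longrightarrow> i \<noteq> j \<Longrightarrow> v i = v j \<Longrightarrow> \<alpha> v = 0"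
    using d[THEN conjunct2, THEN conjunct2, THEN spec, of v] by simp
qed

lemma ext_form_pair_args:
  assumes "is_ext_form 2 \<alpha>"
  shows "\<alpha> v = \<alpha> (pair_args (v 0) (v 1))"
  by (rule is_ext_formD(1)[OF assms]) (auto simp: less_2_cases_iff pair_args_def)

lemma J_form_ext_form:
  fixes \<alpha> :: "(complex ^ 'm::finite) ext_form"
  assumes ext: "is_ext_form 2 \<alpha>" and J: "type_1_1 \<alpha>"
  shows "J_form (\<lambda>x y. Re (\<alpha> (pair_args x y)))"
proof -
  have dep: "\<alpha> v = \<alpha> w" if "v 0 = w 0" "v 1 = w 1" for v w
    by (rule is_ext_formD(1)[OF ext]) (use that in \<open>auto simp: less_2_cases_iff\<close>)
  note lin = is_ext_formD(2)[OF ext]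
  have "\<alpha> (pair_args x y) = \<alpha> ((pair_args y y)(0 := x))" for x y
    by (rule dep) (auto simp: pair_args_def)
  then have l1: "linear (\<lambda>x. \<alpha> (pair_args x y))" for y
    using lin[of 0 "pair_args y y"] by simp
  have "\<alpha> (pair_args x y) = \<alpha> ((pair_args x x)(1 := y))" for x y
    by (rule dep) (auto simp: pair_args_def)
  then have l2: "linear (\<lambda>y. \<alpha> (pair_args x y))" for x
    using lin[of 1 "pair_args x x"] by simp
  have alt: "\<alpha> (pair_args x x) = 0" for x
    by (rule is_ext_formD(3)[OF ext, of 0 1]) (auto simp: pair_args_def)
  have anti: "\<alpha> (pair_args x y) = - \<alpha> (pair_args y x)" for x y
  proof -
    have "\<alpha> (pair_args (x + y) (x + y)) = \<alpha> (pair_args x x) + \<alpha> (pair_args x y) + (\<alpha> (pair_args y x) + \<alpha> (pair_args y y))"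
      unfolding linear_add[OF l1] linear_add[OF l2] by (simp add: algebra_simps)
    then show ?thesis unfolding alt by (simp add: eq_neg_iff_add_eq_0)
  qed
  show ?thesis
    unfolding J_form_def
  proof (intro conjI allI)
    show "linear (\<lambda>x. Re (\<alpha> (pair_args x y)))" for y
      by (rule linearI) (simp_all add: linear_add[OF l1] linear_scale[OF l1])
    show "linear (\<lambda>y. Re (\<alpha> (pair_args x y)))" for x
      by (rule linearI) (simp_all add: linear_add[OF l2] linear_scale[OF l2])
    show "Re (\<alpha> (pair_args x y)) = - Re (\<alpha> (pair_args y x))" for x y
      by (subst anti) simp
    show "Re (\<alpha> (pair_args (J x) (J y))) = Re (\<alpha> (pair_args x y))" for x y
      using J unfolding type_1_1_def by simp
  qed
qed

lemma pullback_proj: "pullback proj_X \<alpha> w v = \<alpha> (proj_X w) (\<lambda>i. proj_X (v i))"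
  unfolding pullback_def
  using frechet_derivative_at[OF linear_imp_has_derivative[OF linear_proj], of w] by simp

lemma chart_image_strip_chart: "chart_image (strip_chart c) = strip_dom (chart_image c)"
proof
  show "chart_image (strip_chart c) \<subseteq> strip_dom (chart_image c)"
    by (auto simp: strip_chart_def strip_dom_def closure_strip proj_X_def)
  show "strip_dom (chart_image c) \<subseteq> chart_image (strip_chart c)"
  proof
    fix w assume "w \<in> strip_dom (chart_image c)"
    then obtain x where x: "x \<in> fst c" "proj_X w = snd c x" and s: "w $ None \<in> closure strip"
      by (auto simp: strip_dom_def closure_strip)
    have "w = snd (strip_chart c) (w $ None, x)"
      unfolding strip_chart_def by (rule option_vec_eqI) (auto simp: x(2)[symmetric] proj_X_def)
    moreover have "(w $ None, x) \<in> fst (strip_chart c)"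
      using x s by (simp add: strip_chart_def)
    ultimately show "w \<in> chart_image (strip_chart c)" by blast
  qed
qed

text \<open>
  It frees the local representative of \<open>u\<close> from the choice of a preimage in \<open>inv_into\<close>.
\<close>

lemma local_rep_strip_chart:
  assumes inj: "inj_on (snd c) (fst c)" and w: "w \<in> strip_dom (chart_image c)"
  shows "local_rep (strip_chart c) u w = u (w $ None, chart_inv c (proj_X w))"
proof -
  let ?x = "chart_inv c (proj_X w)"
  have x: "?x \<in> fst c" "snd c ?x = proj_X w" and s: "w $ None \<in> closure strip"
    using w by (auto simp: strip_dom_def closure_strip inv_into_into f_inv_into_f)
  have "inj_on (snd (strip_chart c)) (fst (strip_chart c))"
  proof (rule inj_onI, clarsimp simp: strip_chart_def vec_eq_iff)
    fix s x s' x'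
    assume "x \<in> fst c" "x' \<in> fst c" and eq: "\<forall>i. (case i of None \<Rightarrow> s | Some j \<Rightarrow> snd c x $ j) =
          (case i of None \<Rightarrow> s' | Some j \<Rightarrow> snd c x' $ j)"
    moreover have "s = s'" using eq[rule_format, of None] by simp
    moreover have "snd c x = snd c x'"
      by (subst vec_eq_iff, intro allI) (use eq[rule_format, of "Some _"] in simp)
    ultimately show "s = s' \<and> x = x'" using inj by (auto dest: inj_onD)
  qed
  then have "chart_inv (strip_chart c) w = (w $ None, ?x)"
  proof (rule inv_into_f_eq)
    show "(w $ None, ?x) \<in> fst (strip_chart c)" using x s by (simp add: strip_chart_def)
    show "snd (strip_chart c) (w $ None, ?x) = w"
      unfolding strip_chart_def by (rule option_vec_eqI) (simp_all add: x(2), simp add: proj_X_def)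
  qed
  then show ?thesis by (simp add: local_rep_def)
qed

lemma complex_atlasD:
  assumes "complex_atlas A" "c \<in> A"
  shows "open (chart_image c)" "inj_on (snd c) (fst c)" "p \<in> fst c \<Longrightarrow> chart_inv c (snd c p) = p"
proof -
  have h: "open (chart_image c)" "homeomorphism (fst c) (chart_image c) (snd c) (chart_inv c)"
    using assms unfolding complex_atlas_def by blast+
  show "open (chart_image c)" by (rule h(1))
  show "inj_on (snd c) (fst c)"
    using h(2) unfolding homeomorphism_def by (metis inj_onI)
  show "p \<in> fst c \<Longrightarrow> chart_inv c (snd c p) = p"
    using h(2) unfolding homeomorphism_def by blast
qed

text \<open>
  The situation of the theorem in one chart \<open>c\<close> of the atlas. The estimates are local, so that each chart can be treated
  on its own.
\<close>

locale chart_geodesic =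
  fixes A :: "('p::t2_space, 'n::finite) chart set"
    and \<omega>0 :: "('p, 'n) mform" and u0 u1 :: "'p \<Rightarrow> real" and u :: "complex \<times> 'p \<Rightarrow> real"
    and c :: "('p, 'n) chart"
  assumes atlas: "complex_atlas A" and kahler: "kahler_form A \<omega>0"
    and u0_pot: "u0 \<in> kahler_potentials A \<omega>0"
    and u_C3: "Ck_manifold (strip_atlas A) 3 u"
    and c: "c \<in> A"
    and u_deg: "\<And>w. w \<in> chart_image (strip_chart c) \<Longrightarrow>
           wedge_power (omega_u \<omega>0 u c w) (CARD('n) + 1) = (\<lambda>v. 0)"
    and u_rank: "\<And>w. w \<in> chart_image (strip_chart c) \<Longrightarrow>
           wedge_power (omega_u \<omega>0 u c w) (CARD('n)) \<noteq> (\<lambda>v. 0)"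
    and u_inv: "\<And>x t r. t \<in> {0..1} \<Longrightarrow>
           u (complex_of_real r + \<i> * complex_of_real t, x) = u (\<i> * complex_of_real t, x)"
    and u_0: "\<And>x. u (0, x) = u0 x" and u_1: "\<And>x. u (\<i>, x) = u1 x"
begin

abbreviation D where "D \<equiv> chart_image c"

abbreviation F where "F \<equiv> local_rep (strip_chart c) u"

definition \<omega> :: "complex ^ 'n \<Rightarrow> complex ^ 'n \<Rightarrow> complex ^ 'n \<Rightarrow> real" where
  "\<omega> z x y = Re (\<omega>0 c z (pair_args x y))"

lemma open_D: "open D" and inj: "inj_on (snd c) (fst c)"
  and chart_inv: "p \<in> fst c \<Longrightarrow> chart_inv c (snd c p) = p"
  using complex_atlasD[OF atlas c] by auto

lemma \<omega>0_form:
  assumes "z \<in> D"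
  shows "is_ext_form 2 (\<omega>0 c z)" "real_form (\<omega>0 c z)" "type_1_1 (\<omega>0 c z)"
  using kahler c assms unfolding kahler_form_def smooth_2_form_def by blast+

lemma F_eq: "w \<in> strip_dom D \<Longrightarrow> F w = u (w $ None, chart_inv c (proj_X w))"
  by (rule local_rep_strip_chart[OF inj])

sublocale strip_potential D F \<omega>
proof
  show "open D" by (rule open_D)
  show "Ck_on 3 (strip_dom D) F"
    using u_C3 c unfolding Ck_manifold_def strip_atlas_def chart_image_strip_chart[symmetric] by blast
  show "F (w + r *\<^sub>R es) = F w" if w: "w \<in> strip_dom D" for w r
  proof -
    have p: "proj_X (w + r *\<^sub>R es) = proj_X w"
      by (simp add: linear_add[OF linear_proj] linear_scale[OF linear_proj])
    have w': "w + r *\<^sub>R es \<in> strip_dom D"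
      using w p by (simp add: strip_dom_def)
    have t: "Im (w $ None) \<in> {0..1}" using w by (simp add: strip_dom_def)
    have "(w + r *\<^sub>R es) $ None = complex_of_real (Re (w $ None) + r) + \<i> * complex_of_real (Im (w $ None))"
      "w $ None = complex_of_real (Re (w $ None)) + \<i> * complex_of_real (Im (w $ None))"
      by (simp_all add: complex_eq_iff)
    then show ?thesis
      unfolding F_eq[OF w] F_eq[OF w'] p using u_inv[OF t] by metis
  qed
  show "J_form (\<omega> z)" if "z \<in> D" for z
    unfolding \<omega>_def by (rule J_form_ext_form[OF \<omega>0_form(1,3)[OF that]])
  show "Ck_on 1 D (\<lambda>z. \<omega> z x y)" for x y
  proof -
    have "smooth_on D (\<lambda>z. \<omega>0 c z (pair_args x y))"
      using kahler c unfolding kahler_form_def smooth_2_form_def by blast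
    then show ?thesis unfolding \<omega>_def smooth_on_def by (intro Ck_on_Re) blast
  qed
qed

lemma omega_u_eq:
  assumes w: "w \<in> E"
  shows "omega_u \<omega>0 u c w v = complex_of_real (\<Omega> w (v 0) (v 1))"
proof -
  have z: "proj_X w \<in> D" using w by (rule E_proj)
  have "pullback proj_X (\<omega>0 c) w v = \<omega>0 c (proj_X w) (pair_args (proj_X (v 0)) (proj_X (v 1)))"
    unfolding pullback_proj by (rule ext_form_pair_args[OF \<omega>0_form(1)[OF z]])
  also have "\<dots> = complex_of_real (\<omega> (proj_X w) (proj_X (v 0)) (proj_X (v 1)))"
    using \<omega>0_form(2)[OF z] unfolding real_form_def \<omega>_def by simp
  finally show ?thesis
    unfolding omega_u_def i_ddbar_def chart_image_strip_chart i_ddbar_eq_hessian[OF E F2 w] \<Omega>_def hess_def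
    by simp
qed

lemma wedge_power_omega_u:
  assumes "w \<in> E"
  shows "wedge_power (omega_u \<omega>0 u c w) k v = complex_of_real (pfaff (\<Omega> w) k v) / 2 ^ k"
  by (rule wedge_power_eq_pfaff[OF omega_u_eq[OF assms]])

text \<open>
  Derivatives on a fibre are derivatives in the strip along vectors tangent to the fibre. The latter are
  derivatives within a set, and this covers the boundary fibres.
\<close>

lemma dird_slice:
  assumes f: "Ck_on (Suc k) E f" and t: "t \<in> {0..1}" and z: "z \<in> D"
  shows "dird D v (\<lambda>z. f (emb t z)) z = dird E (vert v) f (emb t z)"
  unfolding emb_def
  by (rule dird_affine[OF D E linear_vert _ f z]) (use t emb_E in \<open>simp add: emb_def\<close>)

lemma Ck_on_slice: "Ck_on k E f \<Longrightarrow> t \<in> {0..1} \<Longrightarrow> Ck_on k D (\<lambda>z. f (emb t z))"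
  unfolding emb_def
  by (rule Ck_on_affine[OF linear_vert]) (use emb_E in \<open>simp_all add: emb_def\<close>)

lemma F_emb: "t \<in> {0..1} \<Longrightarrow> z \<in> D \<Longrightarrow> F (emb t z) = u (\<i> * complex_of_real t, chart_inv c z)"
  using F_eq[OF emb_E] by (simp add: emb_None)

lemma fibre_form_0_pos:
  assumes z: "z \<in> D" and \<eta>: "\<eta> \<noteq> 0"
  shows "fibre_form 0 z \<eta> > 0"
proof -
  let ?f = "local_rep c u0"
  have f: "?f y = F (emb 0 y)" if "y \<in> D" for y
    using F_emb[of 0 y] that by (simp add: u_0 local_rep_def)
  have f2: "Ck_on 2 D ?f"
    using u0_pot c unfolding kahler_potentials_def Ck_manifold_def by blast
  have dird2: "dird D a (dird D b ?f) z = hess (emb 0 z) (vert a) (vert b)" for a b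
  proof -
    have "dird D b ?f y = dird E (vert b) F (emb 0 y)" if "y \<in> D" for y
      using dird_cong[OF f that, where a = b] dird_slice[OF F3 _ that] by simp
    then have "dird D a (dird D b ?f) z = dird D a (\<lambda>y. dird E (vert b) F (emb 0 y)) z"
      by (rule dird_cong[OF _ z])
    also have "\<dots> = hess (emb 0 z) (vert a) (vert b)"
      unfolding hess_def using dird_slice[OF Ck_on_dird_F[of "vert b", unfolded numeral_2_eq_2] _ z] by simp
    finally show ?thesis .
  qed
  have "positive_form (\<lambda>v. \<omega>0 c z v + i_ddbar c u0 z v)"
    using u0_pot c z unfolding kahler_potentials_def by blast
  then have "Re (\<omega>0 c z (pair_args \<eta> (J \<eta>)) + i_ddbar c u0 z (pair_args \<eta> (J \<eta>))) > 0"
    using \<eta> unfolding positive_form_def by blast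
  moreover have "i_ddbar c u0 z (pair_args \<eta> (J \<eta>)) =
    complex_of_real ((hess (emb 0 z) (J (vert \<eta>)) (J (vert \<eta>)) - hess (emb 0 z) (vert \<eta>) (J (J (vert \<eta>)))) / 2)"
    unfolding i_ddbar_def i_ddbar_eq_hessian[OF D f2 z] dird2 by (simp add: pair_args_def vert_J linear_neg[OF linear_vert])
  ultimately show ?thesis
    unfolding fibre_form_def \<Omega>_def \<omega>_def proj_J by simp
qed

sublocale strip_geodesic D F \<omega>
proof
  show "pfaff (\<Omega> w) (CARD('n) + 1) v = 0" if w: "w \<in> E" for w v
  proof -
    have "wedge_power (omega_u \<omega>0 u c w) (CARD('n) + 1) v = 0"
      using u_deg[of w] w unfolding chart_image_strip_chart by metis
    then have "complex_of_real (pfaff (\<Omega> w) (CARD('n) + 1) v) / 2 ^ (CARD('n) + 1) = 0"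
      by (simp only: wedge_power_omega_u[OF w])
    then show ?thesis by simp
  qed
  show "\<exists>v. pfaff (\<Omega> w) CARD('n) v \<noteq> 0" if w: "w \<in> E" for w
  proof -
    obtain v where "wedge_power (omega_u \<omega>0 u c w) CARD('n) v \<noteq> 0"
      using u_rank[of w] w unfolding chart_image_strip_chart by blast
    then have "pfaff (\<Omega> w) CARD('n) v \<noteq> 0"
      by (auto simp: wedge_power_omega_u[OF w])
    then show ?thesis by blast
  qed
  show "fibre_form 0 z \<eta> > 0" if "z \<in> D" "\<eta> \<noteq> 0" for z \<eta>
    using that by (rule fibre_form_0_pos)
qed

definition velocity :: "complex ^ 'n \<Rightarrow> real" where "velocity = local_rep c (initial_velocity u)"

definition difference :: "complex ^ 'n \<Rightarrow> real" where "difference = local_rep c (\<lambda>x. u1 x - u0 x)"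

lemma velocity_eq:
  assumes z: "z \<in> D"
  shows "velocity z = Ft (emb 0 z)"
proof -
  let ?x = "chart_inv c z"
  have eq: "emb 0 z + s *\<^sub>R J es = emb s z" for s by (simp add: emb_def)
  have in_E: "emb 0 z + s *\<^sub>R J es \<in> E" if "s \<in> {0..1}" for s
    unfolding eq by (rule emb_E[OF that z])
  have 0: "0 \<in> {0..1::real}" by simp
  have "((\<lambda>s. F (emb s z)) has_vector_derivative Ft (emb 0 z)) (at 0 within {0..1})"
    using has_vector_derivative_along_line[OF E F3 in_E 0] unfolding eq Ft_def .
  then have "((\<lambda>s. u (\<i> * complex_of_real s, ?x)) has_vector_derivative Ft (emb 0 z)) (at 0 within {0..1})"
    by (rule has_vector_derivative_transform[OF 0, rotated]) (simp add: F_emb z)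
  from vector_derivative_within_closed_interval[OF _ 0 this]
  show ?thesis by (simp add: velocity_def local_rep_def initial_velocity_def)
qed

lemma difference_eq: "z \<in> D \<Longrightarrow> difference z = F (emb 1 z) - F (emb 0 z)"
  using F_emb[of 0 z] F_emb[of 1 z] by (simp add: difference_def local_rep_def u_0 u_1)

lemma velocity_C2: "Ck_on 2 D velocity"
proof -
  have "Ck_on 2 D velocity \<longleftrightarrow> Ck_on 2 D (\<lambda>z. Ft (emb 0 z))"
    by (rule Ck_on_cong[OF velocity_eq])
  then show ?thesis using Ck_on_slice[OF Ft2, of 0] by simp
qed

lemma dird_velocity: "z \<in> D \<Longrightarrow> dird D v velocity z = dird E (vert v) Ft (emb 0 z)"
  using dird_cong[OF velocity_eq, where x = z and a = v] dird_slice[OF Ft2[unfolded numeral_2_eq_2], of 0 z v] by simp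

lemma difference_derivative:
  assumes z: "z \<in> D"
  shows "(difference has_derivative (\<lambda>v. dird E (vert v) F (emb 1 z) - dird E (vert v) F (emb 0 z))) (at z within D)"
proof -
  have d: "((\<lambda>z. F (emb t z)) has_derivative (\<lambda>v. dird E (vert v) F (emb t z))) (at z within D)"
    if t: "t \<in> {0..1}" for t
    using Ck_on_dird(1)[OF D Ck_on_slice[OF F3 t] z] unfolding dird_slice[OF F3 t z] .
  have "((\<lambda>z. F (emb 1 z) - F (emb 0 z)) has_derivative
      (\<lambda>v. dird E (vert v) F (emb 1 z) - dird E (vert v) F (emb 0 z))) (at z within D)"
    by (intro has_derivative_diff d) auto
  then show ?thesis
    by (rule has_derivative_transform[OF z, rotated]) (rule difference_eq)
qed

lemma dird_difference: "z \<in> D \<Longrightarrow> dird D v difference z = dird E (vert v) F (emb 1 z) - dird E (vert v) F (emb 0 z)"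
  by (rule dird_eqI[OF D _ difference_derivative])

lemma grad_vel_0_eq: "z \<in> D \<Longrightarrow> grad_vel 0 z = (\<Sum>b\<in>Basis. dird D b velocity z *\<^sub>R b)"
  unfolding grad_vel_def by (simp add: dird_velocity)

text \<open>
  The inequality \<open>|d(u\<^sub>1 - u\<^sub>0)| \<le> C |dv(0, \<cdot>)|\<close> near a critical point of the initial velocity, in coordinates.
\<close>

lemma gradient_bound:
  assumes z0: "z0 \<in> D" and crit: "\<And>v. dird D v velocity z0 = 0"
  shows "\<exists>R>0. \<exists>C\<ge>0. ball z0 R \<subseteq> D \<and> (\<forall>z\<in>ball z0 R. \<forall>w.
    \<bar>dird D w difference z\<bar> \<le> C * norm (\<Sum>b\<in>Basis. dird D b velocity z *\<^sub>R b) * norm w)"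
proof -
  obtain R C where R: "R > 0" "C \<ge> 0" "ball z0 R \<subseteq> D"
    and b: "\<forall>z\<in>ball z0 R. \<forall>v. \<bar>dird E (vert v) F (emb 1 z) - dird E (vert v) F (emb 0 z)\<bar> \<le> C * norm (grad_vel 0 z) * norm v"
    using endpoint_difference_bound[OF z0] crit dird_velocity[OF z0] by auto
  have "\<bar>dird D w difference z\<bar> \<le> C * norm (\<Sum>b\<in>Basis. dird D b velocity z *\<^sub>R b) * norm w" if "z \<in> ball z0 R" for z w
  proof -
    have "z \<in> D" using R(3) that by blast
    then show ?thesis using b[rule_format, OF that, of w] unfolding dird_difference[OF \<open>z \<in> D\<close>] grad_vel_0_eq[OF \<open>z \<in> D\<close>] by blast
  qed
  then show ?thesis using R by blast
qed

lemma critical_transfer: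
  assumes z0: "z0 \<in> D" and crit: "(velocity has_derivative (\<lambda>v. 0)) (at z0)"
  shows "dird D v velocity z0 = 0" "(difference has_derivative (\<lambda>v. 0)) (at z0)"
proof -
  have at: "at z0 within D = at z0" by (rule at_within_open[OF z0 open_D])
  show c0: "dird D v velocity z0 = 0" for v
    using dird_eqI[OF D z0, of velocity "\<lambda>v. 0" v] crit unfolding at by simp
  from gradient_bound[OF z0 c0] obtain R C where "R > 0"
    and b: "\<forall>z\<in>ball z0 R. \<forall>w. \<bar>dird D w difference z\<bar> \<le> C * norm (\<Sum>b\<in>Basis. dird D b velocity z *\<^sub>R b) * norm w"
    by blast
  have "\<bar>dird D w difference z0\<bar> \<le> 0" for w
    using b[rule_format, of z0 w] \<open>R > 0\<close> by (simp add: c0)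
  then have "dird E (vert v) F (emb 1 z0) - dird E (vert v) F (emb 0 z0) = 0" for v
    using dird_difference[OF z0] by simp
  then show "(difference has_derivative (\<lambda>v. 0)) (at z0)"
    using difference_derivative[OF z0] unfolding at by simp
qed

lemma hessian_transfer:
  assumes z0: "z0 \<in> D" and crit: "(velocity has_derivative (\<lambda>v. 0)) (at z0)" and difference: "Ck_on 2 D difference"
    and degenerate: "\<And>w. hessian velocity z0 v w = 0"
  shows "hessian difference z0 v w = 0"
proof -
  note c0 = critical_transfer(1)[OF z0 crit]
  obtain R C where R: "R > 0" "ball z0 R \<subseteq> D"
    and b: "\<forall>z\<in>ball z0 R. \<forall>w. \<bar>dird D w difference z\<bar> \<le> C * norm (\<Sum>b\<in>Basis. dird D b velocity z *\<^sub>R b) * norm w"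
    using gradient_bound[OF z0 c0] by blast
  show ?thesis
    unfolding hessian_eq_dird[OF open_D z0]
    by (rule second_derivative_dominated[OF open_D velocity_C2 difference z0 R b[rule_format] c0])
      (use degenerate in \<open>simp_all add: hessian_eq_dird[OF open_D z0]\<close>)
qed

end

theorem theorem1p1:
  fixes A :: "('p::t2_space, 'n::finite) chart set"
    and \<omega>0 :: "('p, 'n) mform"
    and u0 u1 :: "'p \<Rightarrow> real"
    and u :: "complex \<times> 'p \<Rightarrow> real"
  assumes "complex_atlas A"
    and "compact (UNIV :: 'p set)"
    and "connected (UNIV :: 'p set)"
    and "kahler_form A \<omega>0"
    and "u0 \<in> kahler_potentials A \<omega>0"
    and "u1 \<in> kahler_potentials A \<omega>0"
    and "Ck_manifold (strip_atlas A) 3 u"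
    and "\<And>c w. c \<in> A \<Longrightarrow> w \<in> chart_image (strip_chart c) \<Longrightarrow>
           wedge_power (omega_u \<omega>0 u c w) (CARD('n) + 1) = (\<lambda>v. 0)"
    and "\<And>c w. c \<in> A \<Longrightarrow> w \<in> chart_image (strip_chart c) \<Longrightarrow>
           wedge_power (omega_u \<omega>0 u c w) (CARD('n)) \<noteq> (\<lambda>v. 0)"
    and "\<And>x t r. t \<in> {0..1} \<Longrightarrow>
           u (complex_of_real r + \<i> * complex_of_real t, x) = u (\<i> * complex_of_real t, x)"
    and "\<And>x. u (0, x) = u0 x"
    and "\<And>x. u (\<i>, x) = u1 x"
  shows "(\<forall>p. critical_point A (initial_velocity u) p \<longrightarrow>
              critical_point A (\<lambda>x. u1 x - u0 x) p) \<and>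
         (morse A (\<lambda>x. u1 x - u0 x) \<longrightarrow> morse A (initial_velocity u))"
proof -
  have chart: "chart_geodesic A \<omega>0 u0 u1 u c" if "c \<in> A" for c
    using assms that by unfold_locales auto
  have crit: "critical_point A (\<lambda>x. u1 x - u0 x) p" if p: "critical_point A (initial_velocity u) p" for p
    unfolding critical_point_def
  proof (intro ballI impI)
    fix c assume cA: "c \<in> A" "p \<in> fst c"
    interpret chart_geodesic A \<omega>0 u0 u1 u c by (rule chart[OF cA(1)])
    have "(velocity has_derivative (\<lambda>v. 0)) (at (snd c p))"
      using p cA unfolding critical_point_def velocity_def by blast
    from critical_transfer(2)[OF _ this]
    show "(local_rep c (\<lambda>x. u1 x - u0 x) has_derivative (\<lambda>v. 0)) (at (snd c p))"
      using cA(2) unfolding difference_def by blast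
  qed
  moreover have "morse A (initial_velocity u)" if m: "morse A (\<lambda>x. u1 x - u0 x)"
    unfolding morse_def
  proof (intro conjI allI impI ballI)
    show "Ck_manifold A 2 (initial_velocity u)"
      unfolding Ck_manifold_def
    proof
      fix c assume "c \<in> A"
      then interpret chart_geodesic A \<omega>0 u0 u1 u c by (rule chart)
      show "Ck_on 2 D (local_rep c (initial_velocity u))" using velocity_C2 unfolding velocity_def .
    qed
  next
    fix p c and v :: "complex ^ 'n"
    assume p: "critical_point A (initial_velocity u) p" and cA: "c \<in> A" "p \<in> fst c" and v: "v \<noteq> 0"
    interpret chart_geodesic A \<omega>0 u0 u1 u c by (rule chart[OF cA(1)])
    have z0: "snd c p \<in> D" using cA(2) by blast
    have c0: "(velocity has_derivative (\<lambda>v. 0)) (at (snd c p))"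
      using p cA unfolding critical_point_def velocity_def by blast
    have difference_C2: "Ck_on 2 D difference"
      using m cA unfolding morse_def Ck_manifold_def difference_def by blast
    obtain w where "hessian difference (snd c p) v w \<noteq> 0"
      using m crit[OF p] cA v unfolding morse_def difference_def by blast
    with hessian_transfer[OF z0 c0 difference_C2]
    show "\<exists>w. hessian (local_rep c (initial_velocity u)) (snd c p) v w \<noteq> 0"
      unfolding velocity_def by blast
  qed
  ultimately show ?thesis by blast
qed

end
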